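(* For every integer $n\geqslant 5$, the kissing number of the Fermat function field lattice $\Lambda_n$ is $K(\Lambda_n)=6$.
   Context: Let $n\geqslant 4$. $\mathcal F_n$ is the Fermat curve $X^n+Y^n=Z^n$ over $\mathbb C$ (a non-singular plane curve), and $F_n=\mathbb C(x,y)$ with $x^n+y^n=1$ is its function field ($x=X/Z$, $y=Y/Z$). Let $\zeta$ be a primitive $n$-th root of unity and $\varepsilon$ a primitive $n$-th root of $-1$. The set $\mathcal P$ consists of the $3n$ points of $\mathcal F_n$ having exactly one zero coordinate: $a_j=(0:\zeta^j:1)$, $b_j=(\zeta^j:0:1)$, $c_j=(\varepsilon\zeta^j:1:0)$, $j=0,\dots,n-1$; points of $\mathcal F_n$ are identified with places of $F_n$. Let $\mathcal O_{\mathcal P}^*$ be the multiplicative group of those $z\in F_n^*$ all of whose zeros and poles lie in $\mathcal P$. The lattice $\Lambda_n\subset\mathbb R^{3n}$ is the image of the homomorphism $\mathcal O_{\mathcal P}^*\to\mathbb Z^{3n}$, $z\mapsto (v_P(z))_{P\in\mathcal P}$, where $v_P$ is the discrete valuation at $P$. The minimum distance is $d(\Lambda)=\min_{0\neq v\in\Lambda}\|v\|$ (Euclidean norm), and the kissing number is $K(\Lambda)=|\{v\in\Lambda:\|v\|=d(\Lambda)\}|$. *)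

theory Defs
  imports "HOL-Algebra.Algebraic_Closure_Type" "HOL-Algebra.Generated_Fields"
    "HOL-Analysis.L2_Norm"
begin

section \<open>The Fermat function field\<close>

text \<open>
  The function field is realised inside a fixed algebraic closure of \<open>\<complex>(x)\<close>: for \<open>y\<close> in that
  closure with \<open>x^n + y^n = 1\<close>, it is the subfield \<open>\<complex>(x, y)\<close>. Here \<open>x\<close> is transcendental over
  the constants by construction.
\<close>

type_synonym acfield = "complex poly fract alg_closure"

definition const :: "complex \<Rightarrow> acfield" where
  "const c = to_ac (to_fract [:c:])"

definition fx :: acfield where
  "fx = to_ac (to_fract [:0, 1:])"

definition fermat_field :: "acfield \<Rightarrow> acfield set" where
  "fermat_field y = generate_field ring_of_type_algebra (range const \<union> {fx, y})"

lemma ex_fermat_y: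
  assumes "n > 0"
  shows "\<exists>y. fx ^ n + y ^ n = 1"
proof -
  obtain y where "y ^ n = 1 - fx ^ n"
    using nth_root_exists[OF assms] by blast
  then show ?thesis by (intro exI[of _ y]) simp
qed


section \<open>Points and their discrete valuations\<close>

text \<open>
  Points of the projective plane are given by homogeneous coordinates \<open>(a, b, c)\<close>, so that
  two nonzero triples describe the same point iff they are proportional.
\<close>

type_synonym point = "complex \<times> complex \<times> complex"

definition proj_eq :: "point \<Rightarrow> point \<Rightarrow> bool" where
  "proj_eq P Q \<longleftrightarrow>
     (case (P, Q) of ((a, b, c), (a', b', c')) \<Rightarrow>
        \<exists>s. s \<noteq> 0 \<and> a' = s * a \<and> b' = s * b \<and> c' = s * c)"

definition fermat_curve :: "nat \<Rightarrow> point set" where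
  "fermat_curve n = {(a, b, c). (a, b, c) \<noteq> (0, 0, 0) \<and> a ^ n + b ^ n = c ^ n}"

text \<open>
  The value at \<open>(a, b, c)\<close> of the ternary form of degree \<open>d\<close> whose coefficient at
  \<open>X^i Y^j Z^(d-i-j)\<close> is \<open>h (f i j)\<close>; the map \<open>h\<close> embeds the complex coefficients into the ring
  where the form is evaluated.
\<close>

definition eval_form ::
  "(complex \<Rightarrow> 'r) \<Rightarrow> nat \<Rightarrow> (nat \<Rightarrow> nat \<Rightarrow> complex) \<Rightarrow> 'r \<Rightarrow> 'r \<Rightarrow> 'r \<Rightarrow> 'r::comm_ring_1" where
  "eval_form h d f a b c =
     (\<Sum>i\<le>d. \<Sum>j\<le>d - i. h (f i j) * a ^ i * b ^ j * c ^ (d - i - j))"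

text \<open>
  The local ring at \<open>(a : b : c)\<close>: fractions of forms of equal degree with denominator not
  vanishing at the point, where \<open>X/Z = x\<close> and \<open>Y/Z = y\<close>. If the point lies on the curve, then such
  a denominator is not divisible by the equation of the curve, so its value at \<open>(x, y, 1)\<close> is nonzero.
\<close>

definition local_ring :: "acfield \<Rightarrow> point \<Rightarrow> acfield set" where
  "local_ring y P =
     (case P of (a, b, c) \<Rightarrow>
        {eval_form const d f fx y 1 / eval_form const d g fx y 1 | d f g.
           eval_form id d g a b c \<noteq> 0})"

definition local_units :: "acfield \<Rightarrow> point \<Rightarrow> acfield set" where
  "local_units y P = {u \<in> local_ring y P. u \<noteq> 0 \<and> inverse u \<in> local_ring y P}"

definition local_params :: "acfield \<Rightarrow> point \<Rightarrow> acfield set" where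
  "local_params y P =
     {t \<in> local_ring y P. local_ring y P - local_units y P = (\<lambda>r. t * r) ` local_ring y P}"

text \<open>For \<open>z\<close> nonzero in the function field and \<open>P\<close> on the curve.\<close>

definition val :: "acfield \<Rightarrow> point \<Rightarrow> acfield \<Rightarrow> int" where
  "val y P z =
     (THE k. \<exists>t\<in>local_params y P. \<exists>u\<in>local_units y P. z = t powi k * u)"


section \<open>The Fermat function field lattice\<close>

definition primitive_root_of :: "nat \<Rightarrow> complex \<Rightarrow> complex \<Rightarrow> bool" where
  "primitive_root_of n w z \<longleftrightarrow> z ^ n = w \<and> (\<forall>k. 0 < k \<and> k < n \<longrightarrow> z ^ k \<noteq> w)"

text \<open>The points \<open>a_0, \<dots>, a_(n-1), b_0, \<dots>, b_(n-1), c_0, \<dots>, c_(n-1)\<close>, in this order.\<close>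

definition special_point :: "nat \<Rightarrow> complex \<Rightarrow> complex \<Rightarrow> nat \<Rightarrow> point" where
  "special_point n \<zeta> \<epsilon> k =
     (if k < n then (0, \<zeta> ^ k, 1)
      else if k < 2 * n then (\<zeta> ^ (k - n), 0, 1)
      else (\<epsilon> * \<zeta> ^ (k - 2 * n), 1, 0))"

definition special_units :: "nat \<Rightarrow> acfield \<Rightarrow> complex \<Rightarrow> complex \<Rightarrow> acfield set" where
  "special_units n y \<zeta> \<epsilon> =
     {z \<in> fermat_field y. z \<noteq> 0 \<and>
        (\<forall>Q\<in>fermat_curve n. val y Q z \<noteq> 0 \<longrightarrow> (\<exists>k<3 * n. proj_eq Q (special_point n \<zeta> \<epsilon> k)))}"

text \<open>Vectors of dimension \<open>m\<close> are functions on \<open>nat\<close> that vanish outside \<open>{..<m}\<close>.\<close>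

definition fermat_lattice :: "nat \<Rightarrow> acfield \<Rightarrow> complex \<Rightarrow> complex \<Rightarrow> (nat \<Rightarrow> real) set" where
  "fermat_lattice n y \<zeta> \<epsilon> =
     (\<lambda>z k. if k < 3 * n then of_int (val y (special_point n \<zeta> \<epsilon> k) z) else 0)
       ` special_units n y \<zeta> \<epsilon>"

definition min_dist :: "nat \<Rightarrow> (nat \<Rightarrow> real) set \<Rightarrow> real" where
  "min_dist m \<Lambda> = (LEAST r. \<exists>v\<in>\<Lambda> - {\<lambda>_. 0}. r = L2_set v {..<m})"

definition kissing_number :: "nat \<Rightarrow> (nat \<Rightarrow> real) set \<Rightarrow> nat" where
  "kissing_number m \<Lambda> = card {v \<in> \<Lambda>. L2_set v {..<m} = min_dist m \<Lambda>}"

end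

theory Submission
  imports Defs "HOL-Computational_Algebra.Formal_Laurent_Series"
    "HOL-Computational_Algebra.Fundamental_Theorem_Algebra"
begin

text \<open>
  Let \<open>z\<close> be a unit outside the special points, with minima \<open>m_a, m_b, m_c\<close> of its valuations on
  the three orbits \<open>a_j, b_j, c_j\<close>. Then \<open>z x^(-m_a) y^(-m_b)\<close> has no pole at finite distance, so
  it is a polynomial \<open>P(x, y)\<close>, and its poles at infinity bound the total degree of \<open>P\<close> by
  \<open>d = -(m_a + m_b + m_c)\<close>. Restricting the form \<open>P\<close> to a coordinate line shows that the minimum is
  exceeded at no more than \<open>d\<close> points of each orbit. The same holds for \<open>1/z\<close>, with maxima in place of
  minima and a degree \<open>d'\<close>. If the valuations are not constant on the orbits, this forces
  \<open>d + d' \<ge> n\<close> and so many entries of large square that the squared norm exceeds \<open>2n\<close>; the case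
  \<open>d = 1\<close> of a line needs that the tangents at the special points are flexes of order \<open>n\<close>.
  Otherwise the vector is \<open>p, q, -p - q\<close> on the three orbits, of squared norm
  \<open>2n (p^2 + p q + q^2)\<close>, and the shortest ones are the six belonging to \<open>x, y, x/y\<close> and their
  inverses.
\<close>

section \<open>Evaluating bivariate polynomials\<close>

text \<open>The valuations are given by local rings of quotients of forms inside an algebraic
  closure, so they cannot be computed directly. Each point therefore gets an embedding of the
  function field into Laurent series, and its local ring is shown to consist exactly of the elements
  of nonnegative order. The embeddings exist because all pairs \<open>(A, B)\<close> on the curve
  with \<open>A\<close> outside the constants satisfy the same polynomial relations. This rests on
  the irreducibility of the Fermat polynomial, which is itself read off from a single pair of power
  series. No theory of divisors enters: total degrees and root counts on the three coordinate lines
  take its place. In the final contradiction the minimal and the maximal entries contribute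
  \<open>2n - 4\<close> each, and \<open>2 (2n - 4) > 2n\<close> holds exactly for
  \<open>n > 4\<close>; at \<open>n = 4\<close> both sides agree.\<close>

locale rhom =
  fixes h :: "'k::comm_ring_1 \<Rightarrow> 'a::comm_ring_1"
  assumes h_add: "h (a + b) = h a + h b"
    and h_mult: "h (a * b) = h a * h b"
    and h_1: "h 1 = 1"
begin

lemma h_0: "h 0 = 0"
  using h_add[of 0 0] by simp

lemma h_uminus: "h (- a) = - h a"
  using h_add[of a "- a"] h_0 by (simp add: eq_neg_iff_add_eq_0 add.commute)

lemma h_diff: "h (a - b) = h a - h b"
  using h_add[of a "- b"] h_uminus by simp

lemma h_power: "h (a ^ k) = h a ^ k"
  by (induction k) (simp_all add: h_1 h_mult)

lemma h_sum: "h (sum f A) = (\<Sum>i\<in>A. h (f i))"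
  by (induction A rule: infinite_finite_induct) (simp_all add: h_0 h_add)

lemma map_poly_hom_add: "map_poly h (p + q) = map_poly h p + map_poly h q"
  by (rule poly_eqI) (simp add: coeff_map_poly h_0 h_add)

lemma map_poly_hom_mult: "map_poly h (p * q) = map_poly h p * map_poly h q"
  by (rule poly_eqI) (simp add: coeff_map_poly h_0 coeff_mult h_sum h_mult)

lemma rhom_eval: "rhom (\<lambda>p. poly (map_poly h p) u)"
  by unfold_locales (simp_all add: map_poly_hom_add map_poly_hom_mult h_1)

lemma eval_pCons: "poly (map_poly h (pCons c p)) u = h c + u * poly (map_poly h p) u"
  by (simp add: map_poly_pCons h_0)

end

text \<open>The inner variable is \<open>x\<close>, the outer one \<open>y\<close>:
  \<open>degree P\<close> is the degree in \<open>y\<close>, and \<open>coeff P j\<close> is the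
  polynomial in \<open>x\<close> in front of \<open>y^j\<close>.\<close>

definition ev :: "('k::comm_ring_1 \<Rightarrow> 'a::comm_ring_1) \<Rightarrow> 'k poly poly \<Rightarrow> 'a \<Rightarrow> 'a \<Rightarrow> 'a" where
  "ev h P u v = poly (map_poly (\<lambda>p. poly (map_poly h p) u) P) v"

context rhom
begin

lemma rhom_ev: "rhom (\<lambda>P. ev h P u v)"
  unfolding ev_def by (rule rhom.rhom_eval[OF rhom_eval])

lemmas ev_add = rhom.h_add[OF rhom_ev]
lemmas ev_mult = rhom.h_mult[OF rhom_ev]
lemmas ev_0 = rhom.h_0[OF rhom_ev]
lemmas ev_1 = rhom.h_1[OF rhom_ev]
lemmas ev_uminus = rhom.h_uminus[OF rhom_ev]
lemmas ev_diff = rhom.h_diff[OF rhom_ev]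
lemmas ev_power = rhom.h_power[OF rhom_ev]
lemmas ev_sum = rhom.h_sum[OF rhom_ev]

lemma ev_pCons: "ev h (pCons p P) u v = poly (map_poly h p) u + v * ev h P u v"
  unfolding ev_def by (rule rhom.eval_pCons[OF rhom_eval])

lemma ev_const: "ev h [:p:] u v = poly (map_poly h p) u"
  by (simp add: ev_pCons ev_0)

lemma ev_smult: "ev h (smult p P) u v = poly (map_poly h p) u * ev h P u v"
  using ev_mult[of "[:p:]" P] by (simp add: ev_const)

lemma ev_X: "ev h [:[:0, 1:]:] u v = u"
  by (simp add: ev_const eval_pCons h_0 h_1)

lemma ev_Y: "ev h [:0, 1:] u v = v"
  by (simp add: ev_pCons ev_0 h_1)

lemma ev_sum_coeff:
  assumes "degree P < k"
  shows "ev h P u v = (\<Sum>j<k. poly (map_poly h (coeff P j)) u * v ^ j)"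
proof -
  let ?f = "\<lambda>p. poly (map_poly h p) u"
  have "degree (map_poly ?f P) \<le> degree P"
    by (rule map_poly_degree_leq)
  with assms have "{..degree (map_poly ?f P)} \<subseteq> {..<k}" by auto
  then have "(\<Sum>i\<le>degree (map_poly ?f P). coeff (map_poly ?f P) i * v ^ i) =
      (\<Sum>i<k. coeff (map_poly ?f P) i * v ^ i)"
    by (rule sum.mono_neutral_left[rotated]) (auto simp: coeff_eq_0)
  then show ?thesis
    by (simp add: ev_def poly_altdef coeff_map_poly rhom.h_0[OF rhom_eval])
qed

end

text \<open>Parametricity: the induction over \<open>P\<close> is done once for every relation that
  respects constants, sums and products. Instances are the passage from power series to Laurent
  series, constant coefficients, closure of \<open>F\<close>, images under \<open>sp\<close>, and
  values at a point.\<close>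

lemma ev_rel:
  assumes "rhom h" "rhom h'"
    and c: "\<And>c. R (h c) (h' c)" and u: "R u u'" and v: "R v v'"
    and add: "\<And>a a' b b'. R a a' \<Longrightarrow> R b b' \<Longrightarrow> R (a + b) (a' + b')"
    and mult: "\<And>a a' b b'. R a a' \<Longrightarrow> R b b' \<Longrightarrow> R (a * b) (a' * b')"
  shows "R (ev h P u v) (ev h' P u' v')"
proof -
  interpret h: rhom h by fact
  interpret h': rhom h' by fact
  have 0: "R 0 0" using c[of 0] by (simp add: h.h_0 h'.h_0)
  have 1: "R (poly (map_poly h p) u) (poly (map_poly h' p) u')" for p
    by (induction p) (simp_all add: 0 h.eval_pCons h'.eval_pCons add mult c u)
  show ?thesis
    by (induction P) (simp_all add: 0 1 h.ev_0 h'.ev_0 h.ev_pCons h'.ev_pCons add mult c v)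
qed

section \<open>Power series\<close>

lemma rhom_fps_const: "rhom (fps_const :: complex \<Rightarrow> complex fps)"
  by unfold_locales simp_all

lemma rhom_fls_const: "rhom (fls_const :: complex \<Rightarrow> complex fls)"
  by unfold_locales (simp_all add: fls_plus_const)

lemma rhom_id: "rhom (id :: complex \<Rightarrow> complex)"
  by unfold_locales simp_all

lemma rhom_const: "rhom const"
proof unfold_locales
  fix a b :: complex
  show "const (a + b) = const a + const b"
    unfolding const_def by (metis to_ac_add to_fract_add add_pCons add.right_neutral)
  have "[:a * b:] = [:a:] * [:b:]" by simp
  then show "const (a * b) = const a * const b"
    unfolding const_def by (simp only: to_ac_mult to_fract_mult)
  show "const 1 = 1"
    unfolding const_def by (metis to_ac_1 to_fract_1 one_pCons)
qed

global_interpretation fpsc: rhom "fps_const :: complex \<Rightarrow> complex fps"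
  by (rule rhom_fps_const)
global_interpretation flsc: rhom "fls_const :: complex \<Rightarrow> complex fls"
  by (rule rhom_fls_const)
global_interpretation idc: rhom "id :: complex \<Rightarrow> complex"
  by (rule rhom_id)
global_interpretation cst: rhom const
  by (rule rhom_const)

lemma ev_fls_fps:
  fixes P :: "complex poly poly"
  shows "ev fls_const P (fps_to_fls A) (fps_to_fls B) = fps_to_fls (ev fps_const P A B)"
  by (rule ev_rel[where R = "\<lambda>u v. u = fps_to_fls v"])
     (simp_all add: rhom_fls_const rhom_fps_const fls_times_fps_to_fls)

lemma ev_fps_nth_0:
  fixes P :: "complex poly poly"
  shows "ev fps_const P A B $ 0 = ev id P (A $ 0) (B $ 0)"
  by (rule ev_rel[where R = "\<lambda>u v. u $ 0 = v"])
     (simp_all add: rhom_id rhom_fps_const)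

lemma ex_fps_nth_root:
  fixes a :: "complex fps"
  assumes "a $ 0 = c ^ n" "c \<noteq> 0" "n > 0"
  shows "\<exists>B. B ^ n = a \<and> B $ 0 = c"
proof -
  obtain k where n: "n = Suc k" using assms(3) gr0_implies_Suc by blast
  \<comment> \<open>\<open>fps_radical\<close> takes a choice of roots for the constant coefficient;
    the constant choice selects the branch starting with \<open>c\<close>.\<close>
  let ?r = "\<lambda>_ _. c"
  have "fps_radical ?r (Suc k) a ^ Suc k = a"
    using power_radical[of a ?r k] assms n by simp
  then show ?thesis
    using n by (intro exI[of _ "fps_radical ?r (Suc k) a"]) simp
qed

section \<open>Power series in \<open>t^n\<close>\<close>

definition periodic_fps :: "nat \<Rightarrow> complex fps \<Rightarrow> bool" where
  "periodic_fps n f \<longleftrightarrow> (\<forall>k. \<not> n dvd k \<longrightarrow> f $ k = 0)"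

lemma periodic_fps_const: "periodic_fps n (fps_const c)"
  unfolding periodic_fps_def by auto

lemma periodic_fps_add: "periodic_fps n f \<Longrightarrow> periodic_fps n g \<Longrightarrow> periodic_fps n (f + g)"
  unfolding periodic_fps_def by auto

lemma periodic_fps_mult:
  assumes "periodic_fps n f" "periodic_fps n g"
  shows "periodic_fps n (f * g)"
  unfolding periodic_fps_def
proof (intro allI impI)
  fix k assume k: "\<not> n dvd k"
  have "f $ i * g $ (k - i) = 0" if "i \<in> {0..k}" for i
  proof (cases "n dvd i")
    case True
    then have "\<not> n dvd (k - i)" using k that by (metis atLeastAtMost_iff dvd_diffD1 dvd_minus_self le_add_diff_inverse dvd_add)
    then show ?thesis using assms(2) unfolding periodic_fps_def by simp
  next
    case False
    then show ?thesis using assms(1) unfolding periodic_fps_def by simp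
  qed
  then show "(f * g) $ k = 0" by (simp add: fps_mult_nth del: mult_eq_0_iff)
qed

lemma periodic_fps_eval:
  assumes "periodic_fps n u"
  shows "periodic_fps n (poly (map_poly fps_const p) u)"
  using assms
  by (induction p)
     (simp_all add: fpsc.eval_pCons periodic_fps_add periodic_fps_mult periodic_fps_const
       periodic_fps_const[of n 0, simplified])

text \<open>The \<open>n\<close>-th root of \<open>1 - t\<close>, with \<open>t^n\<close>
  substituted for \<open>t\<close>. That only exponents divisible by \<open>n\<close> occur is used
  for irreducibility, for cancelling denominators at points with \<open>y = 0\<close>, and for the
  flexes.\<close>

lemma ex_periodic_root:
  assumes "n > 0"
  shows "\<exists>R. R ^ n = 1 - fps_X ^ n \<and> R $ 0 = 1 \<and> periodic_fps n R"
proof -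
  obtain S where S: "S ^ n = 1 - (fps_X :: complex fps)" "S $ 0 = 1"
    using ex_fps_nth_root[of "1 - fps_X" 1 n] assms by auto
  let ?R = "S oo (fps_X ^ n)"
  have 0: "(fps_X ^ n :: complex fps) $ 0 = 0" using assms by simp
  have "?R ^ n = (S ^ n) oo (fps_X ^ n)"
    using 0 by (rule fps_compose_power)
  also have "\<dots> = 1 - fps_X ^ n"
    using 0 by (simp add: S fps_compose_sub_distrib)
  finally have 1: "?R ^ n = 1 - fps_X ^ n" .
  have 2: "?R $ 0 = 1" by (simp add: S fps_compose_nth)
  have "periodic_fps n ?R"
    unfolding periodic_fps_def
  proof (intro allI impI)
    fix k assume "\<not> n dvd k"
    then have "(fps_X ^ n) ^ i $ k = (0::complex)" for i
      by (auto simp: power_mult[symmetric] fps_X_power_nth)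
    then show "?R $ k = 0" by (simp add: fps_compose_nth)
  qed
  with 1 2 show ?thesis by blast
qed

text \<open>The summand with \<open>fps_X ^ i\<close> occupies only exponents congruent to
  \<open>i\<close> modulo \<open>n\<close>, so different \<open>i < n\<close> cannot
  interfere.\<close>

lemma ev_periodic_nth:
  assumes u: "periodic_fps n u" and P: "degree P < n" and j: "j < n"
  shows "ev fps_const P u fps_X $ (n * q + j) = poly (map_poly fps_const (coeff P j)) u $ (n * q)"
proof -
  let ?p = "\<lambda>i. poly (map_poly fps_const (coeff P i)) u"
  have "ev fps_const P u fps_X $ (n * q + j) = (\<Sum>i<n. (?p i * fps_X ^ i) $ (n * q + j))"
    by (simp add: fpsc.ev_sum_coeff[OF P] fps_sum_nth)
  also have "\<dots> = (\<Sum>i<n. if i = j then ?p j $ (n * q) else 0)"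
  proof (rule sum.cong)
    fix i assume i: "i \<in> {..<n}"
    show "(?p i * fps_X ^ i) $ (n * q + j) = (if i = j then ?p j $ (n * q) else 0)"
    proof (cases "i = j")
      case True
      then show ?thesis by (simp add: fps_X_power_mult_right_nth)
    next
      case False
      have "\<not> n dvd (n * q + j - i)" if "i \<le> n * q + j"
      proof
        assume "n dvd (n * q + j - i)"
        then obtain r where "n * q + j - i = n * r" by blast
        then have "n * q + j = n * r + i" using that by linarith
        then have "(n * q + j) mod n = (n * r + i) mod n" by simp
        then show False using i j False by simp
      qed
      then have "n * q + j < i \<or> ?p i $ (n * q + j - i) = 0"
        using periodic_fps_eval[OF u, of "coeff P i"] unfolding periodic_fps_def
        by (meson not_le_imp_less)
      then show ?thesis using False by (auto simp: fps_X_power_mult_right_nth)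
    qed
  qed simp
  also have "\<dots> = ?p j $ (n * q)" using j by simp
  finally show ?thesis .
qed

section \<open>Generic points of the Fermat curve\<close>

text \<open>Over the complex numbers \<open>p\<close> splits into linear factors, and each of them
  takes a nonzero value \<open>A - h r\<close>. So lying outside the constants already means being
  transcendental.\<close>

lemma eval_transcendental:
  fixes h :: "complex \<Rightarrow> 'a::idom"
  assumes "rhom h" and A: "A \<notin> range h" and "p \<noteq> 0"
  shows "poly (map_poly h p) A \<noteq> 0"
  using \<open>p \<noteq> 0\<close>
proof (induction "degree p" arbitrary: p)
  case 0
  interpret rhom h by fact
  obtain c where c: "p = [:c:]" using 0 by (metis degree_eq_zeroE)
  with 0 have "c \<noteq> 0" by simp
  then have "h c * h (inverse c) = 1" by (simp add: h_mult[symmetric] h_1)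
  then have "h c \<noteq> 0" by auto
  then show ?case by (simp add: c eval_pCons)
next
  case (Suc k)
  interpret rhom h by fact
  have "\<not> constant (poly p)" using Suc.hyps(2) by (simp add: constant_degree)
  then obtain r where "poly p r = 0" using fundamental_theorem_of_algebra by blast
  then obtain q where q: "p = [:- r, 1:] * q" by (auto simp: poly_eq_0_iff_dvd)
  with Suc.prems have "q \<noteq> 0" by auto
  then have "degree p = Suc (degree q)" unfolding q by (subst degree_mult_eq) auto
  then have "poly (map_poly h q) A \<noteq> 0" using Suc \<open>q \<noteq> 0\<close> by simp
  moreover have "poly (map_poly h [:- r, 1:]) A = A - h r"
    by (simp add: eval_pCons h_1 h_uminus)
  moreover have "A - h r \<noteq> 0" using A by auto
  ultimately show ?case
    unfolding q rhom.h_mult[OF rhom_eval] by simp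
qed

definition fermat_poly :: "nat \<Rightarrow> complex poly poly" where
  "fermat_poly n = monom 1 n + [:monom 1 n - 1:]"

lemma fermat_poly_altdef: "fermat_poly n = [:0, 1:] ^ n + [:[:0, 1:]:] ^ n - 1"
proof -
  have "[:monom 1 n - 1 :: complex poly:] = [:monom 1 n:] - [:1:]" by simp
  also have "[:1 :: complex poly:] = 1" by simp
  finally show ?thesis
    unfolding fermat_poly_def by (simp add: monom_altdef poly_const_pow)
qed

lemma degree_fermat_poly:
  assumes "n > 0"
  shows "degree (fermat_poly n) = n"
proof -
  have "degree [:monom 1 n - 1 :: complex poly:] < degree (monom 1 n :: complex poly poly)"
    using assms by (simp add: degree_monom_eq)
  then have "degree (fermat_poly n) = degree (monom 1 n :: complex poly poly)"
    unfolding fermat_poly_def by (rule degree_add_eq_left)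
  then show ?thesis by (simp add: degree_monom_eq)
qed

lemma ev_fermat_poly:
  assumes "rhom h"
  shows "ev h (fermat_poly n) A B = B ^ n + A ^ n - 1"
proof -
  interpret rhom h by fact
  show ?thesis unfolding fermat_poly_altdef by (simp only: ev_diff ev_add ev_power ev_X ev_Y ev_1)
qed

text \<open>A generic zero of the Fermat equation in an arbitrary domain. It is instantiated with
  \<open>fx, y\<close> in the function field, with one pair of power series, and with the pairs of
  Laurent series that serve as expansions at a point.\<close>

locale generic_pair =
  fixes h :: "complex \<Rightarrow> 'a::idom" and n :: nat and A B :: 'a
  assumes rh: "rhom h" and n0: "n > 0" and trans: "A \<notin> range h" and curve: "A ^ n + B ^ n = 1"
begin

sublocale rhom h by (rule rh)

lemma ev_fermat: "ev h (fermat_poly n) A B = 0"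
  unfolding ev_fermat_poly[OF rh] using curve by (simp add: algebra_simps)

lemma eval_nonzero: "p \<noteq> 0 \<Longrightarrow> poly (map_poly h p) A \<noteq> 0"
  by (rule eval_transcendental[OF rh trans])

end

lemma generic_pair_base:
  assumes "n > 0" "R ^ n = 1 - fps_X ^ n"
  shows "generic_pair fps_const n R fps_X"
proof
  show "R \<notin> range fps_const"
  proof
    assume "R \<in> range fps_const"
    then obtain c where "R = fps_const c" by blast
    then have "(R ^ n) $ n = (fps_const (c ^ n)) $ n" by (simp add: fps_const_power)
    then show False using assms by (simp add: fps_X_power_nth)
  qed
qed (use assms in auto)

text \<open>A nonzero \<open>coeff P j\<close> stays nonzero at the transcendental \<open>R\<close>
  and yields a series in \<open>t^n\<close>; multiplied by \<open>t^j\<close> it fills the residue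
  class of \<open>j\<close> modulo \<open>n\<close>, where no other summand can cancel it.\<close>

lemma fermat_indep_base:
  assumes n: "n > 0" and P: "P \<noteq> 0" "degree P < n"
    and R: "R ^ n = 1 - fps_X ^ n" "periodic_fps n R"
  shows "ev fps_const P R fps_X \<noteq> 0"
proof
  interpret generic_pair fps_const n R fps_X by (rule generic_pair_base[OF n R(1)])
  assume 0: "ev fps_const P R fps_X = 0"
  have "coeff P j = 0" if j: "j < n" for j
  proof (rule ccontr)
    assume "coeff P j \<noteq> 0"
    then have "poly (map_poly fps_const (coeff P j)) R \<noteq> 0" by (rule eval_nonzero)
    then obtain k where k: "poly (map_poly fps_const (coeff P j)) R $ k \<noteq> 0"
      by (auto simp: fps_eq_iff)
    with periodic_fps_eval[OF R(2), of "coeff P j"] obtain q where "k = n * q"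
      unfolding periodic_fps_def by auto
    with k ev_periodic_nth[OF R(2) P(2) j, of q] 0 show False by simp
  qed
  then have "P = 0" using P(2) by (intro poly_eqI) (metis coeff_0 coeff_eq_0 not_less order_less_le_trans)
  with P show False by simp
qed

text \<open>
  Irreducibility of the Fermat polynomial over \<open>\<complex>(x)\<close>, without fractions: a proper factor
  would have to vanish at the generic pair \<open>((1 - t^n)^(1/n), t)\<close>, whose first entry is a
  power series in \<open>t^n\<close>.
\<close>

lemma fermat_poly_irreducible:
  assumes n: "n > 0" and a: "a \<noteq> 0" and fact: "smult a (fermat_poly n) = g * q"
    and g: "0 < degree g" "degree g < n"
  shows False
proof -
  obtain R :: "complex fps" where R: "R ^ n = 1 - fps_X ^ n" "periodic_fps n R"
    using ex_periodic_root[OF n] by blast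
  interpret generic_pair fps_const n R fps_X by (rule generic_pair_base[OF n R(1)])
  have f0: "fermat_poly n \<noteq> 0" using degree_fermat_poly[OF n] n by auto
  have g0: "g \<noteq> 0" using g by auto
  have q0: "q \<noteq> 0" using f0 a fact by auto
  have "degree (smult a (fermat_poly n)) = degree g + degree q"
    unfolding fact using g0 q0 by (rule degree_mult_eq)
  then have "degree q < n" using a g n by (simp add: degree_fermat_poly)
  then have "ev fps_const (g * q) R fps_X \<noteq> 0"
    unfolding fpsc.ev_mult using fermat_indep_base[OF n g0 g(2) R] fermat_indep_base[OF n q0 _ R] by simp
  then show False by (simp flip: fact add: fpsc.ev_smult ev_fermat)
qed

lemma pseudo_mod_fermat:
  assumes "n > 0"
  obtains a q r where "a \<noteq> 0" "smult a P = fermat_poly n * q + r" "degree r < n"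
    "r = pseudo_mod P (fermat_poly n)"
proof -
  have f0: "fermat_poly n \<noteq> 0" using degree_fermat_poly[OF assms] assms by auto
  show ?thesis
    using that pseudo_mod[OF f0, of P] degree_fermat_poly[OF assms] assms
    by (metis degree_0)
qed

context generic_pair
begin

text \<open>A nonzero polynomial of least degree vanishing at the pair divides a multiple of the
  Fermat polynomial, since the pseudo-remainder vanishes there too. Irreducibility makes it a
  polynomial in \<open>A\<close> alone, against transcendence.\<close>

lemma fermat_indep:
  assumes P: "P \<noteq> 0" "degree P < n"
  shows "ev h P A B \<noteq> 0"
proof
  assume "ev h P A B = 0"
  with P obtain g where g: "g \<noteq> 0" "degree g < n" "ev h g A B = 0"
    and min: "\<And>g'. g' \<noteq> 0 \<Longrightarrow> degree g' < n \<Longrightarrow> ev h g' A B = 0 \<Longrightarrow> degree g \<le> degree g'"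
    using ex_has_least_nat[of "\<lambda>g. g \<noteq> 0 \<and> degree g < n \<and> ev h g A B = 0" P degree] by blast
  obtain a q where aq: "a \<noteq> 0" "smult a (fermat_poly n) = g * q + pseudo_mod (fermat_poly n) g"
    and deg: "pseudo_mod (fermat_poly n) g = 0 \<or> degree (pseudo_mod (fermat_poly n) g) < degree g"
    using pseudo_mod[OF g(1)] by blast
  let ?r = "pseudo_mod (fermat_poly n) g"
  have "ev h ?r A B = ev h (smult a (fermat_poly n)) A B - ev h g A B * ev h q A B"
    unfolding aq(2) by (simp add: ev_add ev_mult)
  then have "ev h ?r A B = 0" by (simp add: ev_smult ev_fermat g)
  then have "?r = 0" using deg min[of ?r] g(2) by (metis le_less_trans not_le order_less_imp_le)
  then have "degree g = 0" using fermat_poly_irreducible[OF n0 aq(1), of g q] g(2) aq(2) by auto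
  then obtain p where p: "g = [:p:]" by (metis degree_eq_zeroE)
  then show False using g eval_nonzero[of p] by (simp add: ev_const)
qed

text \<open>The right-hand side mentions neither \<open>h\<close> nor \<open>A\<close>,
  \<open>B\<close>. Hence all generic pairs satisfy the same relations, which makes the map from one
  pair to another well defined and injective.\<close>

lemma ev_eq_0_iff: "ev h P A B = 0 \<longleftrightarrow> pseudo_mod P (fermat_poly n) = 0"
proof -
  obtain a q r where ar: "a \<noteq> 0" "smult a P = fermat_poly n * q + r" "degree r < n"
    and r: "r = pseudo_mod P (fermat_poly n)"
    using pseudo_mod_fermat[OF n0] by metis
  have "poly (map_poly h a) A * ev h P A B = ev h r A B"
    by (simp add: ev_smult[symmetric] ar ev_add ev_mult ev_fermat)
  then show ?thesis
    using eval_nonzero[OF ar(1)] fermat_indep[of r] ar(3) r by (metis ev_0 mult_eq_0_iff)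
qed

text \<open>An element of least degree in the ideal generated by \<open>Q\<close> has degree 0.\<close>

lemma ex_multiple_in_base:
  assumes Q: "ev h Q A B \<noteq> 0"
  shows "\<exists>p u. p \<noteq> 0 \<and> ev h Q A B * ev h u A B = poly (map_poly h p) A"
proof -
  let ?J = "\<lambda>g. g \<noteq> 0 \<and> degree g < n \<and> (\<exists>u. ev h Q A B * ev h u A B = ev h g A B)"
  obtain a q r where ar: "a \<noteq> 0" "smult a Q = fermat_poly n * q + r" "degree r < n"
    using pseudo_mod_fermat[OF n0] by metis
  have r: "ev h Q A B * ev h [:a:] A B = ev h r A B"
    using arg_cong[OF ar(2), of "\<lambda>P. ev h P A B"]
    by (simp add: ev_smult ev_add ev_mult ev_fermat ev_const mult.commute)
  moreover have "ev h [:a:] A B \<noteq> 0" using eval_nonzero[OF ar(1)] by (simp add: ev_const)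
  ultimately have "r \<noteq> 0" using Q by (metis ev_0 mult_eq_0_iff)
  then have "?J r" using ar r by blast
  then obtain g u where g: "g \<noteq> 0" "degree g < n" "ev h Q A B * ev h u A B = ev h g A B"
    and min: "\<And>g'. ?J g' \<Longrightarrow> degree g \<le> degree g'"
    using ex_has_least_nat[of ?J r degree] by blast
  obtain b q where bq: "b \<noteq> 0" "smult b (fermat_poly n) = g * q + pseudo_mod (fermat_poly n) g"
    and deg: "pseudo_mod (fermat_poly n) g = 0 \<or> degree (pseudo_mod (fermat_poly n) g) < degree g"
    using pseudo_mod[OF g(1)] by blast
  let ?r = "pseudo_mod (fermat_poly n) g"
  have "ev h ?r A B = ev h (smult b (fermat_poly n)) A B - ev h g A B * ev h q A B"
    unfolding bq(2) by (simp add: ev_add ev_mult)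
  also have "\<dots> = ev h Q A B * ev h (- u * q) A B"
    by (simp add: ev_smult ev_fermat g(3)[symmetric] ev_mult ev_uminus)
  finally have "\<exists>u. ev h Q A B * ev h u A B = ev h ?r A B" by metis
  then have "?r = 0" using deg min[of ?r] g(2) by (metis le_less_trans not_le order_less_imp_le)
  then have "degree g = 0" using fermat_poly_irreducible[OF n0 bq(1), of g q] g(2) bq(2) by auto
  then obtain p where p: "g = [:p:]" by (metis degree_eq_zeroE)
  with g show ?thesis by (auto simp: ev_const)
qed

end

section \<open>The function field\<close>

text \<open>The field generated by \<open>u\<close>, \<open>v\<close> over the constants, as
  explicit quotients. It is kept general in \<open>u\<close>, \<open>v\<close> because near a point
  the quotients are wanted in the coordinates of a chart.\<close>

definition frac_ev :: "acfield \<Rightarrow> acfield \<Rightarrow> acfield set" where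
  "frac_ev u v = {ev const P u v / ev const Q u v | P Q. ev const Q u v \<noteq> 0}"

lemma frac_evI: "ev const Q u v \<noteq> 0 \<Longrightarrow> ev const P u v / ev const Q u v \<in> frac_ev u v"
  unfolding frac_ev_def by blast

lemma frac_ev_ev: "ev const P u v \<in> frac_ev u v"
  using frac_evI[of 1 u v P] by (simp add: cst.ev_1)

lemma frac_ev_const: "const c \<in> frac_ev u v"
  using frac_ev_ev[of "[:[:c:]:]"] by (simp add: cst.ev_const cst.eval_pCons)

lemma frac_ev_fst: "u \<in> frac_ev u v"
  using frac_ev_ev[of "[:[:0, 1:]:]"] by (simp add: cst.ev_X)

lemma frac_ev_snd: "v \<in> frac_ev u v"
  using frac_ev_ev[of "[:0, 1:]"] by (simp add: cst.ev_Y)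

lemma frac_ev_mult:
  assumes "z \<in> frac_ev u v" "w \<in> frac_ev u v"
  shows "z * w \<in> frac_ev u v"
proof -
  obtain P Q P' Q' where "ev const Q u v \<noteq> 0" "ev const Q' u v \<noteq> 0"
    "z = ev const P u v / ev const Q u v" "w = ev const P' u v / ev const Q' u v"
    using assms unfolding frac_ev_def by blast
  then show ?thesis using frac_evI[of "Q * Q'" u v "P * P'"] by (simp add: cst.ev_mult)
qed

lemma frac_ev_add:
  assumes "z \<in> frac_ev u v" "w \<in> frac_ev u v"
  shows "z + w \<in> frac_ev u v"
proof -
  obtain P Q P' Q' where "ev const Q u v \<noteq> 0" "ev const Q' u v \<noteq> 0"
    "z = ev const P u v / ev const Q u v" "w = ev const P' u v / ev const Q' u v"
    using assms unfolding frac_ev_def by blast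
  then show ?thesis using frac_evI[of "Q * Q'" u v "P * Q' + P' * Q"]
    by (simp add: cst.ev_mult cst.ev_add add_frac_eq)
qed

lemma frac_ev_inverse:
  assumes "z \<in> frac_ev u v"
  shows "inverse z \<in> frac_ev u v"
proof (cases "z = 0")
  case False
  obtain P Q where "ev const Q u v \<noteq> 0" "z = ev const P u v / ev const Q u v"
    using assms unfolding frac_ev_def by blast
  with False show ?thesis using frac_evI[of P u v Q] by simp
qed (use assms in simp)

lemma frac_ev_uminus: "z \<in> frac_ev u v \<Longrightarrow> - z \<in> frac_ev u v"
  using frac_ev_mult[OF frac_ev_const[of "- 1"]] by (simp add: cst.h_uminus cst.h_1)

lemma ring_of_type_algebra_simps:
  "zero ring_of_type_algebra = 0" "one ring_of_type_algebra = 1"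
  "add ring_of_type_algebra = (+)" "monoid.mult ring_of_type_algebra = (*)"
  "carrier ring_of_type_algebra = UNIV"
  by (simp_all add: ring_of_type_algebra_def fun_eq_iff)

lemma ring_of_type_algebra_a_inv: "a_inv (ring_of_type_algebra :: 'a::field ring) z = - z"
proof -
  interpret field "ring_of_type_algebra :: 'a ring" by (rule field_from_type_algebra)
  show ?thesis
    by (rule minus_equality) (simp_all add: ring_of_type_algebra_simps)
qed

lemma ring_of_type_algebra_m_inv:
  assumes "z \<noteq> 0"
  shows "m_inv (ring_of_type_algebra :: 'a::field ring) z = inverse z"
proof -
  interpret field "ring_of_type_algebra :: 'a ring" by (rule field_from_type_algebra)
  show ?thesis
    by (rule comm_inv_char) (use assms in \<open>simp_all add: ring_of_type_algebra_simps\<close>)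
qed

lemma fermat_field_closed:
  shows "const c \<in> fermat_field y" "fx \<in> fermat_field y" "y \<in> fermat_field y"
    "z \<in> fermat_field y \<Longrightarrow> w \<in> fermat_field y \<Longrightarrow> z + w \<in> fermat_field y"
    "z \<in> fermat_field y \<Longrightarrow> w \<in> fermat_field y \<Longrightarrow> z * w \<in> fermat_field y"
    "z \<in> fermat_field y \<Longrightarrow> z \<noteq> 0 \<Longrightarrow> inverse z \<in> fermat_field y"
  unfolding fermat_field_def
  using generate_field.incl[of _ "range const \<union> {fx, y}" ring_of_type_algebra]
    generate_field.eng_add[of z ring_of_type_algebra "range const \<union> {fx, y}" w]
    generate_field.eng_mult[of z ring_of_type_algebra "range const \<union> {fx, y}" w]
    generate_field.m_inv[of z ring_of_type_algebra "range const \<union> {fx, y}"]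
  by (auto simp: ring_of_type_algebra_simps ring_of_type_algebra_m_inv)

lemma fermat_field_subset_frac_ev:
  assumes "fx \<in> frac_ev u v" "y \<in> frac_ev u v"
  shows "fermat_field y \<subseteq> frac_ev u v"
proof
  fix z assume "z \<in> fermat_field y"
  then show "z \<in> frac_ev u v"
    unfolding fermat_field_def
  proof (induction rule: generate_field.induct)
    case one
    show ?case using frac_ev_const[of 1] by (simp add: ring_of_type_algebra_simps cst.h_1)
  next
    case (incl z)
    then show ?case using assms frac_ev_const by auto
  next
    case (a_inv z)
    then show ?case by (simp add: ring_of_type_algebra_a_inv frac_ev_uminus)
  next
    case (m_inv z)
    then show ?case
      by (simp add: ring_of_type_algebra_m_inv ring_of_type_algebra_simps frac_ev_inverse)
  next
    case (eng_add z w)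
    then show ?case by (simp add: ring_of_type_algebra_simps frac_ev_add)
  next
    case (eng_mult z w)
    then show ?case by (simp add: ring_of_type_algebra_simps frac_ev_mult)
  qed
qed

lemma fx_notin_range_const: "fx \<notin> range const"
proof
  assume "fx \<in> range const"
  then obtain c where "fx = const c" by blast
  then have "[:0, 1:] = [:c:]" by (simp add: fx_def const_def)
  then show False by simp
qed

section \<open>Embeddings into Laurent series\<close>

text \<open>
  The embedding of the function field given by \<open>x \<mapsto> A\<close>, \<open>y \<mapsto> B\<close>; the description is
  proper only on the function field and for a generic pair \<open>(A, B)\<close>.
\<close>

definition sp :: "acfield \<Rightarrow> complex fls \<Rightarrow> complex fls \<Rightarrow> acfield \<Rightarrow> complex fls" where
  "sp y A B z =
     (THE w. \<exists>P Q. ev const Q fx y \<noteq> 0 \<and> z = ev const P fx y / ev const Q fx y \<and>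
        w = ev fls_const P A B / ev fls_const Q A B)"

definition ord :: "acfield \<Rightarrow> complex fls \<Rightarrow> complex fls \<Rightarrow> acfield \<Rightarrow> int" where
  "ord y A B z = fls_subdegree (sp y A B z)"

locale fermat =
  fixes n :: nat and y :: acfield
  assumes n_pos: "n > 0" and fermat_eq: "fx ^ n + y ^ n = 1"
begin

sublocale gen: generic_pair const n fx y
  by unfold_locales (use n_pos fermat_eq fx_notin_range_const in auto)

abbreviation F :: "acfield set" where "F \<equiv> fermat_field y"

lemmas F_const = fermat_field_closed(1)[of _ y]
  and F_fx = fermat_field_closed(2)[of y]
  and F_y = fermat_field_closed(3)[of y]
  and F_add = fermat_field_closed(4)[of _ y]
  and F_mult = fermat_field_closed(5)[of _ y]

lemma F_0: "0 \<in> F" using F_const[of 0] by (simp add: cst.h_0)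

lemma F_1: "1 \<in> F" using F_const[of 1] by (simp add: cst.h_1)

lemma F_inverse: "z \<in> F \<Longrightarrow> inverse z \<in> F"
  using fermat_field_closed(6)[of z y] by (cases "z = 0") auto

lemma F_divide: "z \<in> F \<Longrightarrow> w \<in> F \<Longrightarrow> z / w \<in> F"
  using F_mult F_inverse by (simp add: field_class.field_divide_inverse)

lemma F_uminus: "z \<in> F \<Longrightarrow> - z \<in> F"
  using F_mult[OF F_const[of "- 1"]] by (simp add: cst.h_uminus cst.h_1)

lemma F_diff: "z \<in> F \<Longrightarrow> w \<in> F \<Longrightarrow> z - w \<in> F"
  using F_add[of z "- w"] F_uminus by simp

lemma F_power: "z \<in> F \<Longrightarrow> z ^ k \<in> F"
  by (induction k) (simp_all add: F_1 F_mult)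

lemma F_power_int: "z \<in> F \<Longrightarrow> z powi k \<in> F"
  by (simp add: power_int_def F_power F_inverse)

lemma F_sum: "(\<And>i. i \<in> S \<Longrightarrow> f i \<in> F) \<Longrightarrow> sum f S \<in> F"
  by (induction S rule: infinite_finite_induct) (simp_all add: F_0 F_add)

lemma F_ev: "u \<in> F \<Longrightarrow> v \<in> F \<Longrightarrow> ev const P u v \<in> F"
  by (rule ev_rel[where R = "\<lambda>z _. z \<in> F" and h' = const])
     (simp_all add: rhom_const F_const F_add F_mult)

lemma F_eval: "u \<in> F \<Longrightarrow> poly (map_poly const p) u \<in> F"
  using F_ev[of u 0 "[:p:]"] by (simp add: cst.ev_const F_0)

lemma F_fracE:
  assumes "z \<in> F"
  obtains P Q where "ev const Q fx y \<noteq> 0" "z = ev const P fx y / ev const Q fx y"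
  using fermat_field_subset_frac_ev[OF frac_ev_fst frac_ev_snd] assms
  unfolding frac_ev_def by blast

lemma fx_nonzero: "fx \<noteq> 0"
  using fx_notin_range_const cst.h_0 by (metis rangeI)

lemma y_nonzero: "y \<noteq> 0"
proof
  assume "y = 0"
  then have "poly (map_poly const (monom 1 n - 1)) fx = 0"
    using fermat_eq n_pos
    by (simp add: rhom.h_diff[OF cst.rhom_eval] map_poly_monom cst.h_0 cst.h_1 poly_monom zero_power)
  moreover have "monom 1 n - 1 \<noteq> (0 :: complex poly)"
  proof
    assume "monom 1 n - 1 = (0 :: complex poly)"
    then have "degree (monom (1::complex) n) = degree (1 :: complex poly)" by simp
    then show False using n_pos by (simp add: degree_monom_eq)
  qed
  ultimately show False using gen.eval_nonzero by blast
qed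

end

locale specialization = fermat n y + spec: generic_pair fls_const n A B
  for n y and A B :: "complex fls"
begin

abbreviation s where "s \<equiv> sp y A B"
abbreviation \<nu> where "\<nu> \<equiv> ord y A B"

lemma ev_spec_eq_0_iff: "ev fls_const P A B = 0 \<longleftrightarrow> ev const P fx y = 0"
  by (simp add: spec.ev_eq_0_iff gen.ev_eq_0_iff)

text \<open>Independence of the chosen quotient: cross-multiplying two representations gives a
  polynomial vanishing at \<open>fx, y\<close>, hence also at \<open>A, B\<close>.\<close>

lemma sp_frac:
  assumes "ev const Q fx y \<noteq> 0"
  shows "s (ev const P fx y / ev const Q fx y) = ev fls_const P A B / ev fls_const Q A B"
  unfolding sp_def
proof (rule the_equality)
  show "\<exists>P' Q'. ev const Q' fx y \<noteq> 0 \<and> ev const P fx y / ev const Q fx y = ev const P' fx y / ev const Q' fx y \<and>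
        ev fls_const P A B / ev fls_const Q A B = ev fls_const P' A B / ev fls_const Q' A B"
    using assms by blast
  fix w
  assume "\<exists>P' Q'. ev const Q' fx y \<noteq> 0 \<and> ev const P fx y / ev const Q fx y = ev const P' fx y / ev const Q' fx y \<and>
        w = ev fls_const P' A B / ev fls_const Q' A B"
  then obtain P' Q' where Q': "ev const Q' fx y \<noteq> 0"
    and eq: "ev const P fx y / ev const Q fx y = ev const P' fx y / ev const Q' fx y"
    and w: "w = ev fls_const P' A B / ev fls_const Q' A B" by blast
  have "ev const (P * Q' - P' * Q) fx y = 0"
    using eq assms Q' by (simp add: cst.ev_diff cst.ev_mult frac_eq_eq)
  then have "ev fls_const (P * Q' - P' * Q) A B = 0" by (simp only: ev_spec_eq_0_iff)
  then show "w = ev fls_const P A B / ev fls_const Q A B"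
    using assms Q' ev_spec_eq_0_iff w by (simp add: flsc.ev_diff flsc.ev_mult frac_eq_eq)
qed

lemma sp_ev: "s (ev const P fx y) = ev fls_const P A B"
  using sp_frac[of 1 P] by (simp add: cst.ev_1 flsc.ev_1)

lemma sp_const: "s (const c) = fls_const c"
  using sp_ev[of "[:[:c:]:]"] by (simp add: cst.ev_const flsc.ev_const cst.eval_pCons flsc.eval_pCons)

lemma sp_0: "s 0 = 0"
  using sp_const[of 0] by (simp add: cst.h_0)

lemma sp_1: "s 1 = 1"
  using sp_const[of 1] by (simp add: cst.h_1)

lemma sp_fx: "s fx = A"
  using sp_ev[of "[:[:0, 1:]:]"] by (simp add: cst.ev_X flsc.ev_X)

lemma sp_y: "s y = B"
  using sp_ev[of "[:0, 1:]"] by (simp add: cst.ev_Y flsc.ev_Y)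

lemma sp_mult:
  assumes "z \<in> F" "w \<in> F"
  shows "s (z * w) = s z * s w"
proof -
  obtain P Q where z: "ev const Q fx y \<noteq> 0" "z = ev const P fx y / ev const Q fx y"
    using F_fracE[OF assms(1)] .
  obtain P' Q' where w: "ev const Q' fx y \<noteq> 0" "w = ev const P' fx y / ev const Q' fx y"
    using F_fracE[OF assms(2)] .
  have "z * w = ev const (P * P') fx y / ev const (Q * Q') fx y" "ev const (Q * Q') fx y \<noteq> 0"
    using z w by (simp_all add: cst.ev_mult)
  then show ?thesis using z w by (simp add: sp_frac flsc.ev_mult)
qed

lemma sp_add:
  assumes "z \<in> F" "w \<in> F"
  shows "s (z + w) = s z + s w"
proof -
  obtain P Q where z: "ev const Q fx y \<noteq> 0" "z = ev const P fx y / ev const Q fx y"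
    using F_fracE[OF assms(1)] .
  obtain P' Q' where w: "ev const Q' fx y \<noteq> 0" "w = ev const P' fx y / ev const Q' fx y"
    using F_fracE[OF assms(2)] .
  have "z + w = ev const (P * Q' + P' * Q) fx y / ev const (Q * Q') fx y"
    and 0: "ev const (Q * Q') fx y \<noteq> 0"
    using z w by (simp_all add: cst.ev_mult cst.ev_add add_frac_eq)
  then have "s (z + w) = ev fls_const (P * Q' + P' * Q) A B / ev fls_const (Q * Q') A B"
    by (simp add: sp_frac)
  also have "\<dots> = s z + s w"
    using z w ev_spec_eq_0_iff by (simp add: sp_frac flsc.ev_mult flsc.ev_add add_frac_eq)
  finally show ?thesis .
qed

lemma sp_eq_0_iff:
  assumes "z \<in> F"
  shows "s z = 0 \<longleftrightarrow> z = 0"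
proof -
  obtain P Q where z: "ev const Q fx y \<noteq> 0" "z = ev const P fx y / ev const Q fx y"
    using F_fracE[OF assms(1)] .
  then show ?thesis using ev_spec_eq_0_iff by (simp add: sp_frac)
qed

lemma sp_inverse:
  assumes "z \<in> F"
  shows "s (inverse z) = inverse (s z)"
proof (cases "z = 0")
  case False
  then have "s z * s (inverse z) = 1"
    using sp_mult[OF assms F_inverse[OF assms]] by (simp add: sp_1)
  then show ?thesis by (metis inverse_unique)
qed (simp add: sp_0)

lemma sp_divide: "z \<in> F \<Longrightarrow> w \<in> F \<Longrightarrow> s (z / w) = s z / s w"
  by (simp add: field_class.field_divide_inverse sp_mult sp_inverse F_inverse)

lemma sp_power: "z \<in> F \<Longrightarrow> s (z ^ k) = s z ^ k"
  by (induction k) (simp_all add: sp_1 sp_mult F_power)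

lemma sp_power_int: "z \<in> F \<Longrightarrow> s (z powi k) = s z powi k"
  by (simp add: power_int_def sp_power sp_inverse F_inverse)

lemma sp_sum: "(\<And>i. i \<in> S \<Longrightarrow> f i \<in> F) \<Longrightarrow> s (sum f S) = (\<Sum>i\<in>S. s (f i))"
  by (induction S rule: infinite_finite_induct) (simp_all add: sp_0 sp_add F_sum)

lemma sp_diff: "z \<in> F \<Longrightarrow> w \<in> F \<Longrightarrow> s (z - w) = s z - s w"
  using sp_add[of "z - w" w] by (simp add: F_diff)

lemma sp_ev': "u \<in> F \<Longrightarrow> v \<in> F \<Longrightarrow> s (ev const P u v) = ev fls_const P (s u) (s v)"
  using ev_rel[where R = "\<lambda>z w. z \<in> F \<and> s z = w", OF rhom_const rhom_fls_const, of u "s u" v "s v" P]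
  by (simp add: F_const F_add F_mult sp_const sp_add sp_mult)

lemma ord_mult:
  "z \<in> F \<Longrightarrow> w \<in> F \<Longrightarrow> z \<noteq> 0 \<Longrightarrow> w \<noteq> 0 \<Longrightarrow> \<nu> (z * w) = \<nu> z + \<nu> w"
  by (simp add: ord_def sp_mult sp_eq_0_iff)

lemma ord_power_int: "z \<in> F \<Longrightarrow> \<nu> (z powi k) = k * \<nu> z"
  by (simp add: ord_def sp_power_int)

lemma ord_inverse: "z \<in> F \<Longrightarrow> \<nu> (inverse z) = - \<nu> z"
  using ord_power_int[of z "-1"] by simp

end

section \<open>Forms and local rings\<close>

lemma eval_form_altdef:
  "eval_form h d f a b c =
     (\<Sum>(i, j)\<in>Sigma {..d} (\<lambda>i. {..d - i}). h (f i j) * a ^ i * b ^ j * c ^ (d - i - j))"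
  unfolding eval_form_def by (rule sum.Sigma) auto

text \<open>Collects a finite family of monomials of degree \<open>d\<close>, in which exponents may
  repeat, into one coefficient function. Products of forms arise as such families, indexed by pairs
  of monomials.\<close>

lemma eval_form_of_monomials:
  fixes h :: "complex \<Rightarrow> 'a::comm_ring_1"
  assumes h: "rhom h" and S: "finite S" and deg: "\<And>m. m \<in> S \<Longrightarrow> i m + j m + k m = d"
  shows "eval_form h d (\<lambda>p q. \<Sum>m\<in>{m \<in> S. (i m, j m) = (p, q)}. e m) a b c =
    (\<Sum>m\<in>S. h (e m) * a ^ i m * b ^ j m * c ^ k m)"
proof -
  let ?T = "Sigma {..d} (\<lambda>i. {..d - i})"
  have "eval_form h d (\<lambda>p q. \<Sum>m\<in>{m \<in> S. (i m, j m) = (p, q)}. e m) a b c =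
    (\<Sum>t\<in>?T. \<Sum>m\<in>{m \<in> S. (i m, j m) = t}. h (e m) * a ^ i m * b ^ j m * c ^ k m)"
    unfolding eval_form_altdef
  proof (rule sum.cong)
    fix t assume "t \<in> ?T"
    obtain p q where t: "t = (p, q)" by (cases t)
    have *: "h (e m) * a ^ p * b ^ q * c ^ (d - p - q) = h (e m) * a ^ i m * b ^ j m * c ^ k m"
      if "m \<in> {m \<in> S. (i m, j m) = t}" for m
    proof -
      have "k m = d - p - q" using that deg[of m] t by auto
      then show ?thesis using that t by simp
    qed
    show "(case t of (p, q) \<Rightarrow> h (\<Sum>m\<in>{m \<in> S. (i m, j m) = (p, q)}. e m) * a ^ p * b ^ q * c ^ (d - p - q)) =
        (\<Sum>m\<in>{m \<in> S. (i m, j m) = t}. h (e m) * a ^ i m * b ^ j m * c ^ k m)"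
      unfolding t prod.case rhom.h_sum[OF h] sum_distrib_right
      by (rule sum.cong) (use * in \<open>simp_all add: t\<close>)
  qed simp
  also have "\<dots> = (\<Sum>m\<in>S. h (e m) * a ^ i m * b ^ j m * c ^ k m)"
  proof (rule sum.group)
    show "(\<lambda>m. (i m, j m)) ` S \<subseteq> ?T" using deg by force
  qed (use S in auto)
  finally show ?thesis .
qed

lemma eval_form_scale: "eval_form h d f (r * a) (r * b) (r * c) = r ^ d * eval_form h d f a b c"
  unfolding eval_form_def sum_distrib_left
proof (intro sum.cong refl)
  fix i j assume "i \<in> {..d}" "j \<in> {..d - i}"
  then have "d = i + j + (d - i - j)" by simp
  then have "r ^ d = r ^ i * r ^ j * r ^ (d - i - j)" by (metis power_add)
  then show "h (f i j) * (r * a) ^ i * (r * b) ^ j * (r * c) ^ (d - i - j) =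
      r ^ d * (h (f i j) * a ^ i * b ^ j * c ^ (d - i - j))"
    by (simp add: power_mult_distrib mult_ac)
qed

lemma eval_form_fls:
  "eval_form fls_const d f (fps_to_fls a) (fps_to_fls b) (fps_to_fls c) =
     fps_to_fls (eval_form fps_const d f a b c)"
proof -
  have sum: "fps_to_fls (sum g S) = (\<Sum>i\<in>S. fps_to_fls (g i))" for g :: "nat \<Rightarrow> complex fps" and S
    by (induction S rule: infinite_finite_induct) simp_all
  show ?thesis
    unfolding eval_form_def by (simp add: sum fls_times_fps_to_fls fps_to_fls_power)
qed

lemma eval_form_fps_nth_0:
  "eval_form fps_const d f a b c $ 0 = eval_form id d f (a $ 0) (b $ 0) (c $ 0)"
  unfolding eval_form_def by (simp add: fps_sum_nth fps_power_zeroth)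

text \<open>Couples a field element with a complex number when one and the same form produces both.
  As a relation it avoids the question whether the number depends on the form.\<close>

definition form_values :: "acfield \<Rightarrow> complex \<Rightarrow> complex \<Rightarrow> complex \<Rightarrow> nat \<Rightarrow> acfield \<Rightarrow> complex \<Rightarrow> bool" where
  "form_values y a b c d z e \<longleftrightarrow>
     (\<exists>f. z = eval_form const d f fx y 1 \<and> e = eval_form id d f a b c)"

lemma form_values_of_monomials:
  assumes "finite S" "\<And>m. m \<in> S \<Longrightarrow> i m + j m + k m = d"
  shows "form_values y a b c d (\<Sum>m\<in>S. const (e m) * fx ^ i m * y ^ j m * 1 ^ k m)
    (\<Sum>m\<in>S. e m * a ^ i m * b ^ j m * c ^ k m)"
  unfolding form_values_def
  using eval_form_of_monomials[OF rhom_const assms, where e = e and a = fx and b = y and c = 1] eval_form_of_monomials[OF rhom_id assms, where e = e and a = a and b = b and c = c]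
  by (intro exI[of _ "\<lambda>p q. \<Sum>m\<in>{m \<in> S. (i m, j m) = (p, q)}. e m"]) simp

lemma form_values_monomial:
  assumes "i + j + k = d"
  shows "form_values y a b c d (const e * fx ^ i * y ^ j) (e * a ^ i * b ^ j * c ^ k)"
  using form_values_of_monomials[of "{()}" "\<lambda>_. i" "\<lambda>_. j" "\<lambda>_. k" d y a b c "\<lambda>_. e"] assms by simp

lemma form_values_add:
  assumes "form_values y a b c d z e" "form_values y a b c d z' e'"
  shows "form_values y a b c d (z + z') (e + e')"
proof -
  obtain f g where "z = eval_form const d f fx y 1" "e = eval_form id d f a b c"
    "z' = eval_form const d g fx y 1" "e' = eval_form id d g a b c"
    using assms unfolding form_values_def by blast
  then show ?thesis
    unfolding form_values_def
    by (intro exI[of _ "\<lambda>i j. f i j + g i j"])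
       (simp add: eval_form_def sum.distrib cst.h_add algebra_simps)
qed

lemma form_values_mult:
  assumes "form_values y a b c d z e" "form_values y a b c d' z' e'"
  shows "form_values y a b c (d + d') (z * z') (e * e')"
proof -
  obtain f g where f: "z = eval_form const d f fx y 1" "e = eval_form id d f a b c"
    and g: "z' = eval_form const d' g fx y 1" "e' = eval_form id d' g a b c"
    using assms unfolding form_values_def by blast
  let ?T = "\<lambda>d. Sigma {..d} (\<lambda>i. {..d - i})"
  let ?e = "\<lambda>((i, j), (i', j')). f i j * g i' j'"
  let ?i = "\<lambda>((i, j), (i', j')). i + i'"
  let ?j = "\<lambda>((i, j), (i', j')). j + j'"
  let ?k = "\<lambda>((i, j), (i', j')). (d - i - j) + (d' - i' - j')"
  have "form_values y a b c (d + d')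
     (\<Sum>m\<in>?T d \<times> ?T d'. const (?e m) * fx ^ ?i m * y ^ ?j m * 1 ^ ?k m)
     (\<Sum>m\<in>?T d \<times> ?T d'. ?e m * a ^ ?i m * b ^ ?j m * c ^ ?k m)"
    by (rule form_values_of_monomials) auto
  moreover have "(\<Sum>m\<in>?T d \<times> ?T d'. const (?e m) * fx ^ ?i m * y ^ ?j m * 1 ^ ?k m) = z * z'"
    unfolding f g eval_form_altdef sum_product sum.cartesian_product
    by (rule sum.cong) (simp_all only: split_def cst.h_mult power_add mult_ac)
  moreover have "(\<Sum>m\<in>?T d \<times> ?T d'. ?e m * a ^ ?i m * b ^ ?j m * c ^ ?k m) = e * e'"
    unfolding f g eval_form_altdef sum_product sum.cartesian_product
    by (rule sum.cong) (simp_all only: split_def id_apply power_add mult_ac)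
  ultimately show ?thesis by simp
qed

text \<open>Membership in the local ring, with a value at the point carried along: that the value is
  nonzero is what permits inversion inside the local ring.\<close>

definition regular_value :: "acfield \<Rightarrow> point \<Rightarrow> acfield \<Rightarrow> complex \<Rightarrow> bool" where
  "regular_value y P z e \<longleftrightarrow>
     (case P of (a, b, c) \<Rightarrow> \<exists>d u v p q. form_values y a b c d u p \<and> form_values y a b c d v q \<and>
        v \<noteq> 0 \<and> q \<noteq> 0 \<and> z = u / v \<and> e = p / q)"

lemma regular_valueI:
  assumes "form_values y a b c d u p" "form_values y a b c d v q" "v \<noteq> 0" "q \<noteq> 0"
    and "z = u / v" "e = p / q"
  shows "regular_value y (a, b, c) z e"
  unfolding regular_value_def prod.case
  by (intro exI[of _ d] exI[of _ u] exI[of _ v] exI[of _ p] exI[of _ q]) (use assms in simp)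

lemma regular_value_add:
  assumes "regular_value y P z e" "regular_value y P z' e'"
  shows "regular_value y P (z + z') (e + e')"
proof -
  obtain a b c where P: "P = (a, b, c)" by (cases P)
  obtain d u v p q where 1: "form_values y a b c d u p" "form_values y a b c d v q"
    "v \<noteq> 0" "q \<noteq> 0" "z = u / v" "e = p / q"
    using assms(1) unfolding regular_value_def P by auto
  obtain d' u' v' p' q' where 2: "form_values y a b c d' u' p'" "form_values y a b c d' v' q'"
    "v' \<noteq> 0" "q' \<noteq> 0" "z' = u' / v'" "e' = p' / q'"
    using assms(2) unfolding regular_value_def P by auto
  have "form_values y a b c (d + d') (u * v' + u' * v) (p * q' + p' * q)"
    using form_values_add[OF form_values_mult[OF 1(1) 2(2)] form_values_mult[OF 1(2) 2(1)]]
    by (simp add: mult.commute)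
  moreover have "form_values y a b c (d + d') (v * v') (q * q')"
    by (rule form_values_mult[OF 1(2) 2(2)])
  ultimately show ?thesis
    unfolding P by (rule regular_valueI) (use 1 2 in \<open>simp_all add: add_frac_eq\<close>)
qed

lemma regular_value_mult:
  assumes "regular_value y P z e" "regular_value y P z' e'"
  shows "regular_value y P (z * z') (e * e')"
proof -
  obtain a b c where P: "P = (a, b, c)" by (cases P)
  obtain d u v p q where 1: "form_values y a b c d u p" "form_values y a b c d v q"
    "v \<noteq> 0" "q \<noteq> 0" "z = u / v" "e = p / q"
    using assms(1) unfolding regular_value_def P by auto
  obtain d' u' v' p' q' where 2: "form_values y a b c d' u' p'" "form_values y a b c d' v' q'"
    "v' \<noteq> 0" "q' \<noteq> 0" "z' = u' / v'" "e' = p' / q'"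
    using assms(2) unfolding regular_value_def P by auto
  have "form_values y a b c (d + d') (u * u') (p * p')"
    by (rule form_values_mult[OF 1(1) 2(1)])
  moreover have "form_values y a b c (d + d') (v * v') (q * q')"
    by (rule form_values_mult[OF 1(2) 2(2)])
  ultimately show ?thesis
    unfolding P by (rule regular_valueI) (use 1 2 in simp_all)
qed

lemma regular_value_inverse:
  assumes "regular_value y P z e" "z \<noteq> 0" "e \<noteq> 0"
  shows "regular_value y P (inverse z) (inverse e)"
proof -
  obtain a b c where P: "P = (a, b, c)" by (cases P)
  obtain d u v p q where 1: "form_values y a b c d u p" "form_values y a b c d v q"
    "v \<noteq> 0" "q \<noteq> 0" "z = u / v" "e = p / q"
    using assms(1) unfolding regular_value_def P by auto
  then have "u \<noteq> 0" "p \<noteq> 0" "inverse z = v / u" "inverse e = q / p" using assms by auto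
  then show ?thesis unfolding P using 1 by (intro regular_valueI[of y a b c d v q u p])
qed

lemma regular_value_const: "regular_value y P (const e) e"
proof -
  obtain a b c where P: "P = (a, b, c)" by (cases P)
  have "form_values y a b c 0 (const e) e" for e
    using form_values_monomial[of 0 0 0 0 y a b c e] by simp
  from this[of e] this[of 1] show ?thesis
    unfolding P by (rule regular_valueI) (simp_all add: cst.h_1)
qed

lemma form_values_coords:
  "form_values y a b c 1 fx a" "form_values y a b c 1 y b" "form_values y a b c 1 1 c"
  using form_values_monomial[of 1 0 0 1 y a b c 1] form_values_monomial[of 0 1 0 1 y a b c 1]
    form_values_monomial[of 0 0 1 1 y a b c 1]
  by (simp_all add: cst.h_1)

lemma regular_value_ev:
  assumes "regular_value y P u u0" "regular_value y P v v0"
  shows "regular_value y P (ev const Q u v) (ev id Q u0 v0)"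
  by (rule ev_rel[where R = "regular_value y P", OF rhom_const rhom_id])
     (use assms regular_value_const[of y P] regular_value_add[of y P] regular_value_mult[of y P]
       in simp_all)

lemma regular_value_local_ring:
  assumes "regular_value y P z e"
  shows "z \<in> local_ring y P"
proof -
  obtain a b c where P: "P = (a, b, c)" by (cases P)
  obtain d f g where "z = eval_form const d f fx y 1 / eval_form const d g fx y 1"
    "eval_form id d g a b c \<noteq> 0"
    using assms unfolding regular_value_def form_values_def P by auto
  then show ?thesis unfolding local_ring_def P prod.case by blast
qed

text \<open>The bridge from local rings to orders: if the local ring is the valuation ring of
  \<open>\<nu>\<close>, its units are the elements of order 0 and its parameters those of order 1,
  so the exponent in the definition of \<open>val\<close> can only be
  \<open>\<nu> z\<close>.\<close>

lemma val_eqI: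
  fixes \<nu> :: "acfield \<Rightarrow> int"
  assumes O: "local_ring y P = {z \<in> K. z = 0 \<or> \<nu> z \<ge> 0}"
    and K: "1 \<in> K" "\<And>z w. z \<in> K \<Longrightarrow> w \<in> K \<Longrightarrow> z * w \<in> K" "\<And>z. z \<in> K \<Longrightarrow> inverse z \<in> K"
    and mult: "\<And>z w. z \<in> K \<Longrightarrow> w \<in> K \<Longrightarrow> z \<noteq> 0 \<Longrightarrow> w \<noteq> 0 \<Longrightarrow> \<nu> (z * w) = \<nu> z + \<nu> w"
    and \<tau>: "\<tau> \<in> K" "\<tau> \<noteq> 0" "\<nu> \<tau> = 1"
    and z: "z \<in> K" "z \<noteq> 0"
  shows "val y P z = \<nu> z"
proof -
  have one: "\<nu> 1 = 0" using mult[of 1 1] K by simp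
  have inv: "\<nu> (inverse w) = - \<nu> w" if "w \<in> K" "w \<noteq> 0" for w
    using mult[of w "inverse w"] that K one by simp
  have units: "local_units y P = {u \<in> K. u \<noteq> 0 \<and> \<nu> u = 0}"
    unfolding local_units_def O using K inv by fastforce
  have pow: "w powi k \<in> K \<and> w powi k \<noteq> 0 \<and> \<nu> (w powi k) = k * \<nu> w" if w: "w \<in> K" "w \<noteq> 0" for w k
  proof -
    have nat: "v ^ m \<in> K \<and> v ^ m \<noteq> 0 \<and> \<nu> (v ^ m) = int m * \<nu> v" if "v \<in> K" "v \<noteq> 0" for v m
      using that by (induction m) (auto simp: K one mult algebra_simps)
    show ?thesis
      using nat[OF w] nat[of "inverse w"] K(3)[OF w(1)] w inv[OF w] by (auto simp: power_int_def)
  qed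
  have params: "local_params y P = {t \<in> K. t \<noteq> 0 \<and> \<nu> t = 1}" (is "?L = ?R")
  proof (intro equalityI subsetI)
    fix t assume t: "t \<in> ?L"
    then have tO: "t \<in> local_ring y P"
      and eq: "local_ring y P - local_units y P = (\<lambda>r. t * r) ` local_ring y P"
      unfolding local_params_def by auto
    \<comment> \<open>A nonunit is a multiple of \<open>t\<close>. For \<open>\<tau>\<close>, of
      order 1, this excludes \<open>t = 0\<close> and leaves no room for
      \<open>\<nu> t > 1\<close>.\<close>
    have "\<tau> \<in> local_ring y P - local_units y P" using \<tau> by (simp add: O units)
    then obtain r where r: "r \<in> local_ring y P" "\<tau> = t * r" unfolding eq by blast
    have "1 \<in> local_ring y P" using K one by (simp add: O)
    then have "t * 1 \<in> local_ring y P - local_units y P" unfolding eq by blast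
    then have "t = 0 \<or> \<nu> t \<ge> 1" by (auto simp: O units)
    moreover have "t \<noteq> 0" "r \<noteq> 0" using r \<tau> by auto
    moreover have "1 = \<nu> t + \<nu> r" using mult[of t r] r tO \<tau> \<open>t \<noteq> 0\<close> \<open>r \<noteq> 0\<close> by (simp add: O)
    moreover have "\<nu> r \<ge> 0" using r \<open>r \<noteq> 0\<close> by (simp add: O)
    ultimately show "t \<in> ?R" using tO by (auto simp: O)
  next
    fix t assume t: "t \<in> ?R"
    have "local_ring y P - local_units y P = (\<lambda>r. t * r) ` local_ring y P"
    proof (intro equalityI subsetI)
      fix z assume "z \<in> local_ring y P - local_units y P"
      then have z: "z \<in> K" "z = 0 \<or> \<nu> z \<ge> 1" by (auto simp: O units)
      have "z * inverse t \<in> local_ring y P"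
        using z t K mult[of z "inverse t"] inv[of t] by (cases "z = 0") (auto simp: O)
      moreover have "z = t * (z * inverse t)" using t by simp
      ultimately show "z \<in> (\<lambda>r. t * r) ` local_ring y P" by blast
    next
      fix z assume "z \<in> (\<lambda>r. t * r) ` local_ring y P"
      then obtain r where "r \<in> local_ring y P" "z = t * r" by blast
      then show "z \<in> local_ring y P - local_units y P"
        using t K mult[of t r] by (cases "r = 0") (auto simp: O units)
    qed
    then show "t \<in> ?L" using t unfolding local_params_def by (simp add: O)
  qed
  show ?thesis
    unfolding val_def
  proof (rule the_equality)
    let ?u = "z * \<tau> powi (- \<nu> z)"
    have "?u \<in> local_units y P"
      using mult[OF z(1) _ z(2)] pow[OF \<tau>(1,2), of "- \<nu> z"] \<tau> z K by (simp add: units)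
    moreover have "z = \<tau> powi \<nu> z * ?u"
      using \<tau> by (simp add: power_int_minus mult.left_commute)
    ultimately show "\<exists>t\<in>local_params y P. \<exists>u\<in>local_units y P. z = t powi \<nu> z * u"
      using \<tau> unfolding params by blast
    fix k assume "\<exists>t\<in>local_params y P. \<exists>u\<in>local_units y P. z = t powi k * u"
    then obtain t u where "t \<in> K" "t \<noteq> 0" "\<nu> t = 1" "u \<in> K" "u \<noteq> 0" "\<nu> u = 0" "z = t powi k * u"
      unfolding params units by auto
    then show "k = \<nu> z" using mult[of "t powi k" u] pow[of t k] by simp
  qed
qed

section \<open>Local rings compared with orders of Laurent series\<close>

context specialization
begin

lemma F_eval_form: "eval_form const d f fx y 1 \<in> F"
  unfolding eval_form_def by (intro F_sum F_mult F_power F_const F_fx F_y F_1)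

lemma sp_eval_form: "s (eval_form const d f fx y 1) = eval_form fls_const d f A B 1"
  unfolding eval_form_def
  by (simp add: sp_sum sp_mult sp_power sp_const sp_fx sp_y sp_1 F_sum F_mult F_power F_const F_fx F_y)

text \<open>\<open>(v : w : u)\<close> are power series coordinates of the generic point
  \<open>(A : B : 1)\<close>, reducing to the given point at \<open>t = 0\<close>. Multiplying a
  form of degree \<open>d\<close> by \<open>u^d\<close> makes it a power series, also at infinity,
  and the denominator then has a nonzero constant coefficient.\<close>

lemma local_ring_ord_nonneg:
  assumes XYZ: "A * fps_to_fls u = fps_to_fls v" "B * fps_to_fls u = fps_to_fls w" "u \<noteq> 0"
    and z: "z \<in> local_ring y (v $ 0, w $ 0, u $ 0)"
  shows "z \<in> F \<and> (z = 0 \<or> \<nu> z \<ge> 0)"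
proof -
  obtain d f g where z: "z = eval_form const d f fx y 1 / eval_form const d g fx y 1"
    and g: "eval_form id d g (v $ 0) (w $ 0) (u $ 0) \<noteq> 0"
    using z unfolding local_ring_def by auto
  let ?u = "fps_to_fls u"
  have eq: "?u ^ d * s (eval_form const d f fx y 1) = fps_to_fls (eval_form fps_const d f v w u)" for f
    using eval_form_scale[of fls_const d f ?u A B 1] XYZ
    by (simp add: sp_eval_form eval_form_fls mult.commute)
  have u: "?u ^ d \<noteq> 0" using XYZ(3) by simp
  have z_F: "z \<in> F" unfolding z by (intro F_divide F_eval_form)
  let ?f = "eval_form const d f fx y 1" and ?g = "eval_form const d g fx y 1"
  have g0: "eval_form fps_const d g v w u $ 0 \<noteq> 0" using g by (simp add: eval_form_fps_nth_0)
  then have "eval_form fps_const d g v w u \<noteq> 0" by auto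
  then have "s ?g \<noteq> 0" using eq[of g] by auto
  then have "?g \<noteq> 0" by (auto simp: sp_0)
  have "\<nu> z \<ge> 0" if "z \<noteq> 0"
  proof -
    from that have "?f \<noteq> 0" unfolding z by auto
    then have "s ?f \<noteq> 0" by (simp add: sp_eq_0_iff F_eval_form)
    then have f: "fls_subdegree (?u ^ d) + \<nu> ?f \<ge> 0"
      using arg_cong[OF eq[of f], of fls_subdegree] u fls_subdegree_fls_to_fps_gt0
      by (simp add: ord_def)
    have g: "fls_subdegree (?u ^ d) + \<nu> ?g = 0"
      using arg_cong[OF eq[of g], of fls_subdegree] u \<open>s ?g \<noteq> 0\<close> g0
      by (simp add: ord_def fls_subdegree_fls_to_fps)
    have "\<nu> z = \<nu> ?f - \<nu> ?g"
      unfolding z field_class.field_divide_inverse using \<open>?f \<noteq> 0\<close> \<open>?g \<noteq> 0\<close>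
      by (simp add: ord_mult ord_inverse F_inverse F_eval_form)
    with f g show ?thesis by linarith
  qed
  with z_F show ?thesis by blast
qed

end

lemma ev_id_split:
  fixes P :: "complex poly poly"
  shows "ev id P u v = poly (poly P [:v:]) u"
  by (induction P)
     (simp_all only: idc.ev_0 idc.ev_pCons map_poly_id poly_0 poly_pCons poly_add poly_mult, simp_all)

text \<open>
  A chart at \<open>P\<close>: affine coordinates \<open>U, V\<close> in which the curve reads
  \<open>V^n - v0^n = sg (U^n - u0^n)\<close> with \<open>v0 \<noteq> 0\<close>, so that \<open>U - u0\<close> is a local parameter.
\<close>

locale chart = specialization +
  fixes P :: point and U V :: acfield and u0 v0 sg :: complex and Vs :: "complex fps"
  assumes UF: "U \<in> F" and VF: "V \<in> F"
    and gen: "fx \<in> frac_ev U V" "y \<in> frac_ev U V"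
    and regU: "regular_value y P U u0" and regV: "regular_value y P V v0"
    and v0: "v0 \<noteq> 0"
    and eqn: "V ^ n - const v0 ^ n = const sg * (U ^ n - const u0 ^ n)"
    and sU: "s U = fps_to_fls (fps_const u0 + fps_X)"
    and sV: "s V = fps_to_fls Vs" and Vs0: "Vs $ 0 = v0"
    and nonneg: "\<And>z. z \<in> local_ring y P \<Longrightarrow> z \<in> F \<and> (z = 0 \<or> \<nu> z \<ge> 0)"
begin

abbreviation \<tau> where "\<tau> \<equiv> U - const u0"

lemma tau: "\<tau> \<in> F" "\<nu> \<tau> = 1" "\<tau> \<noteq> 0"
proof -
  show "\<tau> \<in> F" by (intro F_diff UF F_const)
  have "s \<tau> = fps_to_fls fps_X"
    using UF by (simp add: sp_diff F_const sp_const sU)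
  then show "\<nu> \<tau> = 1" by (simp add: ord_def fls_subdegree_fls_to_fps)
  then show "\<tau> \<noteq> 0" by (auto simp: ord_def sp_0)
qed

text \<open>The implicit function argument inside the local ring. \<open>Q\<close> lies in the ideal
  of \<open>U - u0\<close> and \<open>V - v0\<close>; multiplying by
  \<open>S = (V^n - v0^n) / (V - v0)\<close> lets the curve equation trade \<open>V - v0\<close> for
  \<open>U - u0\<close>. The value of \<open>S\<close> at the point is \<open>n v0^(n - 1)\<close>,
  which is nonzero.\<close>

lemma factor_tau:
  assumes "ev id Q u0 v0 = 0"
  obtains Q' S where "ev const Q U V * ev const S U V = \<tau> * ev const Q' U V" "ev id S u0 v0 \<noteq> 0"
proof -
  have "poly (Q - [:poly Q [:v0:]:]) [:v0:] = 0" by simp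
  then obtain T where "Q - [:poly Q [:v0:]:] = [:- [:v0:], 1:] * T"
    unfolding poly_eq_0_iff_dvd by (elim dvdE)
  then have T: "Q = [:poly Q [:v0:]:] + ([:0, 1:] - [:[:v0:]:]) * T"
    by (simp add: algebra_simps)
  have "poly (poly Q [:v0:]) u0 = 0" using assms by (simp add: ev_id_split)
  then obtain p where p: "poly Q [:v0:] = [:- u0, 1:] * p" by (auto simp: poly_eq_0_iff_dvd)
  have 1: "ev const Q U V = \<tau> * poly (map_poly const p) U + (V - const v0) * ev const T U V"
    by (subst T) (simp only: cst.ev_add cst.ev_mult cst.ev_diff cst.ev_Y cst.ev_const p
        rhom.h_mult[OF cst.rhom_eval] cst.eval_pCons cst.h_uminus cst.h_1 map_poly_0 poly_0
        mult_zero_right add_0_right mult_1_right uminus_add_conv_diff)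
  define S :: "complex poly poly" where "S = (\<Sum>i<n. [:[:v0 ^ (n - Suc i):]:] * [:0, 1:] ^ i)"
  define R :: "complex poly poly" where "R = (\<Sum>i<n. [:[:u0 ^ (n - Suc i):]:] * [:[:0, 1:]:] ^ i)"
  have ev_c: "ev const [:[:c:]:] u v = const c" for c u v
    by (simp add: cst.ev_const cst.eval_pCons)
  have S: "(V - const v0) * ev const S U V = V ^ n - const v0 ^ n"
    unfolding S_def power_diff_sumr2
    by (simp only: cst.ev_sum cst.ev_mult cst.ev_power cst.ev_Y ev_c cst.h_power)
  have R: "\<tau> * ev const R U V = U ^ n - const u0 ^ n"
    unfolding R_def power_diff_sumr2
    by (simp only: cst.ev_sum cst.ev_mult cst.ev_power cst.ev_X ev_c cst.h_power)
  have "ev id S u0 v0 = (\<Sum>i<n. v0 ^ (n - Suc i) * v0 ^ i)"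
    unfolding S_def
    by (simp only: idc.ev_sum idc.ev_mult idc.ev_power idc.ev_Y idc.ev_const idc.eval_pCons)
       simp
  also have "\<dots> = (\<Sum>i<n. v0 ^ (n - 1))"
    by (intro sum.cong refl) (auto simp flip: power_add)
  finally have "ev id S u0 v0 \<noteq> 0" using n_pos v0 by simp
  moreover have "ev const Q U V * ev const S U V =
      \<tau> * ev const ([:p:] * S + [:[:sg:]:] * T * R) U V"
  proof -
    have "ev const Q U V * ev const S U V = \<tau> * poly (map_poly const p) U * ev const S U V
        + ((V - const v0) * ev const S U V) * ev const T U V"
      unfolding 1 by (simp add: algebra_simps)
    also have "(V - const v0) * ev const S U V = const sg * (\<tau> * ev const R U V)"
      unfolding S R by (rule eqn)
    finally show ?thesis
      by (simp only: cst.ev_add cst.ev_mult ev_c) (simp add: cst.ev_const algebra_simps)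
  qed
  ultimately show ?thesis using that by blast
qed

lemma regular_unit:
  assumes "regular_value y P u e" "e \<noteq> 0" "u \<noteq> 0"
  shows "u \<in> F" "\<nu> u = 0"
proof -
  show "u \<in> F" using nonneg regular_value_local_ring[OF assms(1)] by blast
  have "\<nu> u \<ge> 0" using nonneg regular_value_local_ring[OF assms(1)] assms by blast
  moreover have "\<nu> (inverse u) \<ge> 0"
    using nonneg regular_value_local_ring[OF regular_value_inverse[OF assms(1,3,2)]] assms by fastforce
  ultimately show "\<nu> u = 0" using \<open>u \<in> F\<close> by (simp add: ord_inverse)
qed

lemma s_ev: "s (ev const Q U V) = fps_to_fls (ev fps_const Q (fps_const u0 + fps_X) Vs)"
  by (simp only: sp_ev'[OF UF VF] sU sV ev_fls_fps)

lemma ev_UV_nonzero: "ev id Q u0 v0 \<noteq> 0 \<Longrightarrow> ev const Q U V \<noteq> 0"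
proof
  assume "ev id Q u0 v0 \<noteq> 0" "ev const Q U V = 0"
  then have "ev fps_const Q (fps_const u0 + fps_X) Vs = 0" using s_ev[of Q] by (simp add: sp_0)
  then have "ev id Q u0 v0 = 0"
    using ev_fps_nth_0[of Q "fps_const u0 + fps_X" Vs] Vs0 by simp
  with \<open>ev id Q u0 v0 \<noteq> 0\<close> show False ..
qed

text \<open>\<open>\<tau>\<close> is split off as long as the value vanishes. The order, a
  nonnegative integer, drops by 1 each time because the cofactor \<open>S\<close> is a unit.\<close>

lemma ev_factorization:
  assumes "ev const Q U V \<noteq> 0"
  shows "\<exists>u e. regular_value y P u e \<and> e \<noteq> 0 \<and> u \<noteq> 0 \<and>
    ev const Q U V = \<tau> ^ nat (\<nu> (ev const Q U V)) * u"
  using assms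
proof (induction "nat (\<nu> (ev const Q U V))" arbitrary: Q rule: less_induct)
  case less
  have reg: "regular_value y P (ev const Q U V) (ev id Q u0 v0)" for Q
    by (rule regular_value_ev[OF regU regV])
  have nn: "\<nu> (ev const Q U V) \<ge> 0" for Q
    unfolding ord_def s_ev by (rule fls_subdegree_fls_to_fps_gt0)
  show ?case
  proof (cases "ev id Q u0 v0 = 0")
    case False
    then show ?thesis using regular_unit[OF reg False less.prems] reg less.prems by auto
  next
    case True
    then obtain Q' S where QS: "ev const Q U V * ev const S U V = \<tau> * ev const Q' U V"
      and S: "ev id S u0 v0 \<noteq> 0" using factor_tau by blast
    note S0 = ev_UV_nonzero[OF S]
    note Su = regular_unit[OF reg S S0]
    have Q'0: "ev const Q' U V \<noteq> 0" using QS S0 less.prems by auto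
    have "\<nu> (ev const Q U V) + \<nu> (ev const S U V) = \<nu> \<tau> + \<nu> (ev const Q' U V)"
      using ord_mult[OF F_ev[OF UF VF, of Q] F_ev[OF UF VF, of S] less.prems S0]
        ord_mult[OF tau(1) F_ev[OF UF VF, of Q'] tau(3) Q'0] QS by simp
    then have *: "\<nu> (ev const Q U V) = 1 + \<nu> (ev const Q' U V)" by (simp add: Su tau)
    then have **: "nat (\<nu> (ev const Q U V)) = Suc (nat (\<nu> (ev const Q' U V)))"
      using nn[of Q'] by simp
    with less.hyps[of Q'] Q'0 obtain u e where u: "regular_value y P u e" "e \<noteq> 0" "u \<noteq> 0"
      "ev const Q' U V = \<tau> ^ nat (\<nu> (ev const Q' U V)) * u" by auto
    let ?u = "u * inverse (ev const S U V)" and ?e = "e * inverse (ev id S u0 v0)"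
    have "regular_value y P ?u ?e"
      by (intro regular_value_mult u regular_value_inverse reg S S0)
    moreover have "?e \<noteq> 0" "?u \<noteq> 0" using u S S0 by auto
    moreover have "ev const Q U V = \<tau> * ev const Q' U V * inverse (ev const S U V)"
      using S0 by (simp flip: QS)
    then have "ev const Q U V = \<tau> ^ nat (\<nu> (ev const Q U V)) * ?u"
      unfolding ** by (subst (asm) u(4)) simp
    ultimately show ?thesis by blast
  qed
qed

text \<open>The work lies in the inclusion from right to left: numerator and denominator are both a
  power of \<open>\<tau>\<close> times a unit, and nonnegative order means that the power in the
  denominator cancels.\<close>

lemma local_ring_eq: "local_ring y P = {z \<in> F. z = 0 \<or> \<nu> z \<ge> 0}"
proof (intro equalityI subsetI)
  fix z assume "z \<in> {z \<in> F. z = 0 \<or> \<nu> z \<ge> 0}"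
  then have z: "z \<in> F" "z = 0 \<or> \<nu> z \<ge> 0" by auto
  show "z \<in> local_ring y P"
  proof (cases "z = 0")
    case True
    then show ?thesis
      using regular_value_local_ring[OF regular_value_const[of y P 0]] by (simp add: cst.h_0)
  next
    case False
    obtain Q R where R: "ev const R U V \<noteq> 0" and zQR: "z = ev const Q U V / ev const R U V"
      using fermat_field_subset_frac_ev[OF gen] z(1) unfolding frac_ev_def by blast
    with False have Q: "ev const Q U V \<noteq> 0" by auto
    let ?k = "nat (\<nu> (ev const Q U V))" and ?l = "nat (\<nu> (ev const R U V))"
    have nn: "\<nu> (ev const Q U V) \<ge> 0" for Q
      unfolding ord_def s_ev by (rule fls_subdegree_fls_to_fps_gt0)
    obtain u e where u: "regular_value y P u e" "e \<noteq> 0" "u \<noteq> 0" "ev const Q U V = \<tau> ^ ?k * u"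
      using ev_factorization[OF Q] by blast
    obtain v f where v: "regular_value y P v f" "f \<noteq> 0" "v \<noteq> 0" "ev const R U V = \<tau> ^ ?l * v"
      using ev_factorization[OF R] by blast
    have "\<nu> z = \<nu> (ev const Q U V) - \<nu> (ev const R U V)"
      unfolding zQR field_class.field_divide_inverse using Q R
      by (simp add: ord_mult ord_inverse F_inverse F_ev UF VF)
    then have kl: "?k = ?l + (?k - ?l)" using z False nn[of Q] nn[of R] by linarith
    have "ev const Q U V = \<tau> ^ ?l * \<tau> ^ (?k - ?l) * u"
      using u(4) kl by (metis power_add)
    then have "z = (\<tau> ^ ?l * \<tau> ^ (?k - ?l) * u) / (\<tau> ^ ?l * v)"
      unfolding zQR v(4)[symmetric] by (rule arg_cong)
    then have "z = \<tau> ^ (?k - ?l) * (u * inverse v)"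
      using tau(3) by (simp add: field_class.field_divide_inverse mult.assoc)
    moreover have "regular_value y P \<tau> 0"
      using regular_value_add[OF regU regular_value_const[of y P "- u0"]] by (simp add: cst.h_uminus)
    then have "\<exists>e. regular_value y P (\<tau> ^ m) e" for m
    proof (induction m)
      case 0
      show ?case using regular_value_const[of y P 1] by (auto simp: cst.h_1)
    next
      case (Suc m)
      then show ?case using regular_value_mult by (metis power_Suc)
    qed
    ultimately show ?thesis
      using regular_value_local_ring regular_value_mult[OF _ regular_value_mult[OF u(1)
        regular_value_inverse[OF v(1,3,2)]]] by metis
  qed
qed (use nonneg in auto)

theorem val_eq_ord:
  assumes "z \<in> F" "z \<noteq> 0"
  shows "val y P z = \<nu> z"
  using val_eqI[OF local_ring_eq F_1 F_mult F_inverse ord_mult tau(1,3,2) assms] .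

end

section \<open>The points of the curve\<close>

text \<open>One fixed branch of \<open>(1 - t^n)^(1/n)\<close>. Up to constant factors it describes
  the curve near every special point.\<close>

definition unit_root :: "nat \<Rightarrow> complex fps" where
  "unit_root n = (SOME R. R ^ n = 1 - fps_X ^ n \<and> R $ 0 = 1 \<and> periodic_fps n R)"

lemma unit_root:
  assumes "n > 0"
  shows "unit_root n ^ n = 1 - fps_X ^ n" "unit_root n $ 0 = 1" "periodic_fps n (unit_root n)"
  using someI_ex[OF ex_periodic_root[OF assms]] unfolding unit_root_def by blast+

definition coord :: "complex \<Rightarrow> complex fls" where
  "coord c = fps_to_fls (fps_const c + fps_X)"

definition root_coord :: "nat \<Rightarrow> complex \<Rightarrow> complex fls" where
  "root_coord n c = fps_to_fls (fps_const c * unit_root n)"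

lemma coord_nonzero: "coord c \<noteq> 0"
proof -
  have "(fps_const c + fps_X) $ 1 \<noteq> 0" by simp
  then have "fps_const c + fps_X \<noteq> 0" by (metis fps_zero_nth)
  then show ?thesis unfolding coord_def by (simp only: fps_to_fls_eq_0_iff simp_thms)
qed

lemma subdegree_coord: "fls_subdegree (coord c) = (if c = 0 then 1 else 0)"
proof -
  have "subdegree (fps_const c + fps_X) = (if c = 0 then 1 else 0)"
    by (auto simp: subdegree_eq_0_iff)
  then show ?thesis unfolding coord_def fls_subdegree_fls_to_fps by simp
qed

lemma root_coord_subdegree:
  assumes "n > 0" "c \<noteq> 0"
  shows "root_coord n c \<noteq> 0" "fls_subdegree (root_coord n c) = 0"
proof -
  have nth: "(fps_const c * unit_root n) $ 0 \<noteq> 0" using assms unit_root(2)[OF assms(1)] by simp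
  then have "fps_const c * unit_root n \<noteq> 0" by (metis fps_zero_nth)
  then show "root_coord n c \<noteq> 0" unfolding root_coord_def by (simp only: fps_to_fls_eq_0_iff simp_thms)
  show "fls_subdegree (root_coord n c) = 0"
    unfolding root_coord_def fls_subdegree_fls_to_fps using nth by (metis of_nat_0 subdegree_eq_0_iff)
qed

lemma coord_power: "coord c ^ k = fps_to_fls ((fps_const c + fps_X) ^ k)"
  unfolding coord_def by (rule fps_to_fls_power[symmetric])

lemma root_coord_power:
  assumes "n > 0"
  shows "root_coord n c ^ n = fls_const (c ^ n) * (1 - coord 0 ^ n)"
proof -
  have "(fps_const c * unit_root n) ^ n = fps_const (c ^ n) * (1 - (fps_const 0 + fps_X) ^ n)"
    by (simp add: power_mult_distrib unit_root[OF assms] fps_const_power)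
  then show ?thesis
    unfolding root_coord_def coord_power fps_to_fls_power[symmetric]
    by (simp add: fls_times_fps_to_fls)
qed

lemma coord_notin_range: "coord c \<notin> range fls_const"
proof
  assume "coord c \<in> range fls_const"
  then obtain d where "coord c = fls_const d" by blast
  then have "fls_nth (fps_to_fls (fps_const c + fps_X)) 1 = fls_nth (fls_const d) 1"
    by (simp only: coord_def)
  then show False by (subst (asm) fps_to_fls_nth) simp
qed

lemma root_coord_notin_range:
  assumes "n > 0" "c \<noteq> 0"
  shows "root_coord n c \<notin> range fls_const"
proof
  assume "root_coord n c \<in> range fls_const"
  then obtain d where "root_coord n c = fls_const d" by blast
  then have "coord 0 ^ n = fls_const (1 - (d / c) ^ n)"
    using root_coord_power[OF assms(1), of c] assms
    by (simp add: fls_const_power[symmetric] power_divide flsc.h_diff flsc.h_1 field_simps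
        flip: fls_const_mult_const fls_const_divide_const)
  then have "fls_subdegree (coord 0 ^ n) = 0" by simp
  then show False using assms by (simp add: fls_subdegree_pow subdegree_coord)
qed

lemma val_scale:
  assumes "r \<noteq> 0"
  shows "val y (r * a, r * b, r * c) = val y (a, b, c)"
proof -
  have "local_ring y (r * a, r * b, r * c) = local_ring y (a, b, c)"
    unfolding local_ring_def prod.case eval_form_scale using assms by auto
  then show ?thesis
    unfolding val_def[abs_def] local_params_def local_units_def by simp
qed

lemma val_proj_eq: "proj_eq P Q \<Longrightarrow> val y P = val y Q"
  unfolding proj_eq_def by (auto simp: val_scale)

section \<open>Charts at the three kinds of points\<close>

context fermat
begin

text \<open>The projection to \<open>x\<close> is unramified where \<open>y0 \<noteq> 0\<close>, so
  \<open>x - x0\<close> is a parameter there. The points \<open>a_j\<close> are included, with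
  \<open>x0 = 0\<close>.\<close>

lemma chart_finite:
  assumes "x0 ^ n + y0 ^ n = 1" "y0 \<noteq> 0" "Bs ^ n = 1 - (fps_const x0 + fps_X) ^ n" "Bs $ 0 = y0"
  shows "chart n y (coord x0) (fps_to_fls Bs) (x0, y0, 1) fx y x0 y0 (- 1) Bs"
proof -
  interpret specialization n y "coord x0" "fps_to_fls Bs"
  proof unfold_locales
    show "coord x0 ^ n + fps_to_fls Bs ^ n = 1"
      by (simp only: coord_power fps_to_fls_power[symmetric] fps_to_fls_plus[symmetric] assms(3)) simp
  qed (use n_pos coord_notin_range in simp_all)
  show ?thesis
  proof unfold_locales
    show "regular_value y (x0, y0, 1) fx x0" "regular_value y (x0, y0, 1) y y0"
      by (rule regular_valueI[OF form_values_coords(1,3)], simp_all)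
        (rule regular_valueI[OF form_values_coords(2,3)], simp_all)
    show "y ^ n - const y0 ^ n = const (- 1) * (fx ^ n - const x0 ^ n)"
    proof -
      have "const x0 ^ n + const y0 ^ n = 1"
        using arg_cong[OF assms(1), of const] by (simp add: cst.h_add cst.h_power cst.h_1)
      with fermat_eq show ?thesis by (simp add: cst.h_uminus cst.h_1 algebra_simps)
    qed
    show "s fx = fps_to_fls (fps_const x0 + fps_X)" unfolding coord_def[symmetric] by (rule sp_fx)
    fix z assume "z \<in> local_ring y (x0, y0, 1)"
    then show "z \<in> F \<and> (z = 0 \<or> \<nu> z \<ge> 0)"
      using local_ring_ord_nonneg[of 1 "fps_const x0 + fps_X" Bs z] assms(4)
      by (simp only: coord_def) simp
  qed (use assms in \<open>simp_all add: F_fx F_y frac_ev_fst frac_ev_snd sp_y\<close>)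
qed

text \<open>Here the projection to \<open>x\<close> ramifies, so the coordinates exchange their
  roles and \<open>y\<close> becomes the parameter.\<close>

lemma chart_b:
  assumes "x0 ^ n = 1"
  shows "chart n y (root_coord n x0) (coord 0) (x0, 0, 1) y fx 0 x0 (- 1) (fps_const x0 * unit_root n)"
proof -
  have x0: "x0 \<noteq> 0" using assms n_pos by (auto simp: zero_power)
  interpret specialization n y "root_coord n x0" "coord 0"
    by unfold_locales
      (use n_pos root_coord_notin_range[OF n_pos x0] in
        \<open>simp_all add: root_coord_power assms\<close>)
  show ?thesis
  proof unfold_locales
    show "regular_value y (x0, 0, 1) fx x0" "regular_value y (x0, 0, 1) y 0"
      by (rule regular_valueI[OF form_values_coords(1,3)], simp_all)
        (rule regular_valueI[OF form_values_coords(2,3)], simp_all)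
    show "fx ^ n - const x0 ^ n = const (- 1) * (y ^ n - const 0 ^ n)"
    proof -
      have "const x0 ^ n = 1"
        using arg_cong[OF assms(1), of const] by (simp add: cst.h_power cst.h_1)
      with fermat_eq n_pos show ?thesis
        by (simp add: cst.h_uminus cst.h_1 cst.h_0 zero_power algebra_simps)
    qed
    show "s y = fps_to_fls (fps_const 0 + fps_X)" unfolding coord_def[symmetric] by (rule sp_y)
    show "s fx = fps_to_fls (fps_const x0 * unit_root n)" unfolding root_coord_def[symmetric] by (rule sp_fx)
    fix z assume "z \<in> local_ring y (x0, 0, 1)"
    then show "z \<in> F \<and> (z = 0 \<or> \<nu> z \<ge> 0)"
      using local_ring_ord_nonneg[of 1 "fps_const x0 * unit_root n" "fps_const 0 + fps_X" z]
        unit_root[OF n_pos]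
      by (simp only: coord_def root_coord_def) simp
  qed (use x0 unit_root[OF n_pos] in
    \<open>simp_all add: F_fx F_y frac_ev_fst frac_ev_snd\<close>)
qed

text \<open>With the parameter \<open>t = 1/y\<close> the equation reads
  \<open>(x/y)^n + 1 = t^n\<close>, which accounts for the sign \<open>1\<close> in place of
  \<open>- 1\<close>.\<close>

lemma chart_c:
  assumes "x0 ^ n = - 1"
  shows "chart n y (root_coord n x0 / coord 0) (inverse (coord 0))
    (x0, 1, 0) (inverse y) (fx / y) 0 x0 1 (fps_const x0 * unit_root n)"
proof -
  have x0: "x0 \<noteq> 0" using assms n_pos by (auto simp: zero_power)
  have subx: "fls_subdegree (root_coord n x0 / coord 0) = - 1"
    unfolding field_class.field_divide_inverse
    using root_coord_subdegree[OF n_pos x0] coord_nonzero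
    by (subst fls_subdegree_mult) (simp_all add: subdegree_coord)
  interpret specialization n y "root_coord n x0 / coord 0" "inverse (coord 0)"
  proof unfold_locales
    show "root_coord n x0 / coord 0 \<notin> range fls_const"
    proof
      assume "root_coord n x0 / coord 0 \<in> range fls_const"
      then obtain c where "root_coord n x0 / coord 0 = fls_const c" by blast
      then show False using subx by simp
    qed
    show "(root_coord n x0 / coord 0) ^ n + inverse (coord 0) ^ n = 1"
      using coord_nonzero[of 0]
      by (simp add: power_divide power_inverse root_coord_power[OF n_pos] assms field_simps)
  qed (use n_pos in simp)
  have y0: "y \<noteq> 0" by (rule y_nonzero)
  show ?thesis
  proof unfold_locales
    show "regular_value y (x0, 1, 0) (inverse y) 0"
      by (rule regular_valueI[OF form_values_coords(3,2)]) (simp_all add: y0 field_class.field_divide_inverse)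
    show "regular_value y (x0, 1, 0) (fx / y) x0"
      by (rule regular_valueI[OF form_values_coords(1,2)]) (simp_all add: y0)
    show yf: "y \<in> frac_ev (inverse y) (fx / y)"
      using frac_ev_inverse[OF frac_ev_fst[of "inverse y" "fx / y"]] by simp
    show "fx \<in> frac_ev (inverse y) (fx / y)"
      using frac_ev_mult[OF yf frac_ev_snd] y0 by simp
    show "(fx / y) ^ n - const x0 ^ n = const 1 * (inverse y ^ n - const 0 ^ n)"
    proof -
      have "const x0 ^ n = - 1"
        using arg_cong[OF assms(1), of const] by (simp add: cst.h_power cst.h_uminus cst.h_1)
      moreover have "fx ^ n = 1 - y ^ n" using fermat_eq by (simp add: algebra_simps)
      ultimately show ?thesis
        using n_pos y0 by (simp add: cst.h_1 cst.h_0 zero_power power_divide power_inverse field_simps)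
    qed
    show "s (inverse y) = fps_to_fls (fps_const 0 + fps_X)"
      unfolding coord_def[symmetric] by (simp add: sp_inverse F_y sp_y)
    have "s (fx / y) = root_coord n x0"
      using coord_nonzero[of 0] by (simp add: sp_divide F_fx F_y sp_fx sp_y)
    then show "s (fx / y) = fps_to_fls (fps_const x0 * unit_root n)" by (simp only: root_coord_def)
    fix z assume z: "z \<in> local_ring y (x0, 1, 0)"
    show "z \<in> F \<and> (z = 0 \<or> \<nu> z \<ge> 0)"
    proof (rule local_ring_ord_nonneg[of "fps_const 0 + fps_X" "fps_const x0 * unit_root n" 1])
      show "root_coord n x0 / coord 0 * fps_to_fls (fps_const 0 + fps_X) = fps_to_fls (fps_const x0 * unit_root n)"
        unfolding coord_def[symmetric] root_coord_def[symmetric] using coord_nonzero[of 0] by simp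
      show "inverse (coord 0) * fps_to_fls (fps_const 0 + fps_X) = fps_to_fls 1"
        unfolding coord_def[symmetric] using coord_nonzero[of 0] by simp
    qed (use z unit_root[OF n_pos] in simp_all)
  qed (use x0 unit_root[OF n_pos] in \<open>simp_all add: F_fx F_y F_inverse F_divide\<close>)
qed

lemma ex_branch:
  assumes "x0 ^ n + y0 ^ n = 1" "y0 \<noteq> (0::complex)"
  shows "\<exists>Bs. Bs ^ n = 1 - (fps_const x0 + fps_X) ^ n \<and> Bs $ 0 = y0"
proof (rule ex_fps_nth_root)
  show "(1 - (fps_const x0 + fps_X) ^ n) $ 0 = y0 ^ n"
    using assms(1) by (simp add: fps_power_zeroth algebra_simps)
qed (use assms n_pos in auto)

lemma curve_cases:
  assumes "Q \<in> fermat_curve n"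
  obtains (finite) x0 y0 where "x0 ^ n + y0 ^ n = 1" "y0 \<noteq> 0" "proj_eq Q (x0, y0, 1)"
  | (b) x0 where "x0 ^ n = 1" "proj_eq Q (x0, 0, 1)"
  | (c) x0 where "x0 ^ n = - 1" "proj_eq Q (x0, 1, 0)"
proof -
  obtain p q r where Q: "Q = (p, q, r)" by (cases Q)
  with assms have nz: "(p, q, r) \<noteq> (0, 0, 0)" and eq: "p ^ n + q ^ n = r ^ n"
    unfolding fermat_curve_def by auto
  show ?thesis
  proof (cases "r = 0")
    case False
    then have 1: "(p / r) ^ n + (q / r) ^ n = 1"
      using eq by (simp add: power_divide flip: add_divide_distrib)
    have 2: "proj_eq Q (p / r, q / r, 1)"
      unfolding Q proj_eq_def using False by (auto intro!: exI[of _ "1 / r"])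
    show ?thesis
    proof (cases "q = 0")
      case True
      then show ?thesis using b[of "p / r"] 1 2 n_pos by (simp add: zero_power)
    next
      case False
      then show ?thesis using finite[OF 1 _ 2] \<open>r \<noteq> 0\<close> by simp
    qed
  next
    case True
    then have eq: "p ^ n = - (q ^ n)" using eq n_pos by (simp add: zero_power eq_neg_iff_add_eq_0)
    have "q \<noteq> 0"
    proof
      assume "q = 0"
      with eq n_pos have "p = 0" by (simp add: zero_power)
      with nz True \<open>q = 0\<close> show False by simp
    qed
    then have "(p / q) ^ n = - 1" "proj_eq Q (p / q, 1, 0)"
      using eq True unfolding Q proj_eq_def by (auto simp: power_divide intro!: exI[of _ "1 / q"])
    then show ?thesis by (rule c)
  qed
qed

lemma curve_point:
  assumes "Q \<in> fermat_curve n"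
  obtains A B where "specialization n y A B" "\<And>z. z \<in> F \<Longrightarrow> z \<noteq> 0 \<Longrightarrow> val y Q z = ord y A B z"
  using assms
proof (cases rule: curve_cases)
  case (finite x0 y0)
  then obtain Bs where "Bs ^ n = 1 - (fps_const x0 + fps_X) ^ n" "Bs $ 0 = y0" using ex_branch by blast
  then interpret chart n y "coord x0" "fps_to_fls Bs" "(x0, y0, 1)" fx y x0 y0 "- 1" Bs
    using chart_finite finite by blast
  show ?thesis
    by (rule that[OF specialization_axioms]) (simp add: val_proj_eq[OF finite(3)] val_eq_ord)
next
  case (b x0)
  then interpret chart n y "root_coord n x0" "coord 0"
    "(x0, 0, 1)" y fx 0 x0 "- 1" "fps_const x0 * unit_root n" using chart_b by blast
  show ?thesis
    by (rule that[OF specialization_axioms]) (simp add: val_proj_eq[OF b(2)] val_eq_ord)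
next
  case (c x0)
  then interpret chart n y "root_coord n x0 / coord 0"
    "inverse (coord 0)" "(x0, 1, 0)" "inverse y" "fx / y" 0 x0 1 "fps_const x0 * unit_root n"
    using chart_c by blast
  show ?thesis
    by (rule that[OF specialization_axioms]) (simp add: val_proj_eq[OF c(2)] val_eq_ord)
qed

lemma val_mult:
  assumes "Q \<in> fermat_curve n" "z \<in> F" "w \<in> F" "z \<noteq> 0" "w \<noteq> 0"
  shows "val y Q (z * w) = val y Q z + val y Q w"
proof -
  obtain A B where "specialization n y A B" and v: "\<And>z. z \<in> F \<Longrightarrow> z \<noteq> 0 \<Longrightarrow> val y Q z = ord y A B z"
    using curve_point[OF assms(1)] by blast
  then interpret specialization n y A B by simp
  show ?thesis using assms by (simp add: v F_mult ord_mult)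
qed

lemma val_power_int:
  assumes "Q \<in> fermat_curve n" "z \<in> F" "z \<noteq> 0"
  shows "val y Q (z powi k) = k * val y Q z"
proof -
  obtain A B where "specialization n y A B" and v: "\<And>z. z \<in> F \<Longrightarrow> z \<noteq> 0 \<Longrightarrow> val y Q z = ord y A B z"
    using curve_point[OF assms(1)] by blast
  then interpret specialization n y A B by simp
  show ?thesis using assms by (simp add: v F_power_int ord_power_int)
qed

text \<open>Together with the two lemmas that follow: \<open>x\<close> has simple zeros at the
  \<open>a_j\<close>, \<open>y\<close> has simple zeros at the \<open>b_j\<close>, both have simple
  poles at the \<open>c_j\<close>, and there are no other zeros or poles.\<close>

lemma val_finite_coords:
  assumes "x0 ^ n + y0 ^ n = 1" "y0 \<noteq> 0"
  shows "val y (x0, y0, 1) fx = (if x0 = 0 then 1 else 0)" "val y (x0, y0, 1) y = 0"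
proof -
  obtain Bs where Bs: "Bs ^ n = 1 - (fps_const x0 + fps_X) ^ n" "Bs $ 0 = y0" using ex_branch[OF assms] by blast
  then interpret chart n y "coord x0" "fps_to_fls Bs" "(x0, y0, 1)" fx y x0 y0 "- 1" Bs
    using chart_finite assms by blast
  show "val y (x0, y0, 1) fx = (if x0 = 0 then 1 else 0)"
    by (simp add: val_eq_ord F_fx fx_nonzero ord_def sp_fx subdegree_coord)
  have "subdegree Bs = 0" using Bs assms by (simp add: subdegree_eq_0_iff)
  then show "val y (x0, y0, 1) y = 0"
    by (simp add: val_eq_ord F_y y_nonzero ord_def sp_y fls_subdegree_fls_to_fps)
qed

lemma val_b_coords:
  assumes "x0 ^ n = 1"
  shows "val y (x0, 0, 1) fx = 0" "val y (x0, 0, 1) y = 1"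
proof -
  interpret chart n y "root_coord n x0" "coord 0"
    "(x0, 0, 1)" y fx 0 x0 "- 1" "fps_const x0 * unit_root n" using chart_b[OF assms] .
  show "val y (x0, 0, 1) fx = 0"
    by (simp add: val_eq_ord F_fx fx_nonzero ord_def sp_fx root_coord_subdegree n_pos v0)
  show "val y (x0, 0, 1) y = 1"
    by (simp add: val_eq_ord F_y y_nonzero ord_def sp_y subdegree_coord)
qed

lemma val_c_coords:
  assumes "x0 ^ n = - 1"
  shows "val y (x0, 1, 0) fx = - 1" "val y (x0, 1, 0) y = - 1"
proof -
  interpret chart n y "root_coord n x0 / coord 0"
    "inverse (coord 0)" "(x0, 1, 0)" "inverse y" "fx / y" 0 x0 1 "fps_const x0 * unit_root n"
    using chart_c[OF assms] .
  have y: "\<nu> y = - 1"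
    by (simp add: ord_def sp_y subdegree_coord)
  then show "val y (x0, 1, 0) y = - 1"
    by (simp add: val_eq_ord F_y y_nonzero)
  have "\<nu> (fx * inverse y) = \<nu> fx + \<nu> (inverse y)"
    by (intro ord_mult F_fx F_inverse F_y fx_nonzero) (simp add: y_nonzero)
  moreover have "\<nu> (fx / y) = 0"
    unfolding ord_def sV root_coord_def[symmetric] using n_pos v0 by (rule root_coord_subdegree)
  ultimately show "val y (x0, 1, 0) fx = - 1"
    unfolding field_class.field_divide_inverse[of fx y] using y by (simp add: ord_inverse F_y val_eq_ord F_fx fx_nonzero)
qed

end

section \<open>Functions with prescribed poles\<close>

lemma eval_fps_nth_0: "poly (map_poly fps_const p) (a :: complex fps) $ 0 = poly p (a $ 0)"
  using ev_fps_nth_0[of "[:p:]" a 0] by (simp add: fpsc.ev_const idc.ev_const)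

lemma card_nth_roots_eq:
  assumes "n > 0" "c \<noteq> (0::complex)" "degree p < n" "\<And>u. u ^ n = c \<Longrightarrow> poly p u = 0"
  shows "p = 0"
proof (rule ccontr)
  assume p: "p \<noteq> 0"
  have "n = card {u. u ^ n = c}" using card_nth_roots[OF assms(2,1)] by simp
  also have "\<dots> \<le> card {u. poly p u = 0}"
    using assms(4) poly_roots_finite[OF p] by (intro card_mono) auto
  also have "\<dots> \<le> degree p" using p by (rule card_poly_roots_bound)
  finally show False using assms(3) by simp
qed

definition total_degree_le :: "complex poly poly \<Rightarrow> nat \<Rightarrow> bool" where
  "total_degree_le P d \<longleftrightarrow> (\<forall>i j. coeff (coeff P j) i \<noteq> 0 \<longrightarrow> i + j \<le> d)"

lemma ex_total_degree_le: "\<exists>d. total_degree_le P d"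
proof -
  have "degree (coeff P j) \<le> (\<Sum>j\<le>degree P. degree (coeff P j))" if "j \<le> degree P" for j
    using that by (intro member_le_sum) auto
  then have "total_degree_le P ((\<Sum>j\<le>degree P. degree (coeff P j)) + degree P)"
    unfolding total_degree_le_def
  proof (intro allI impI)
    fix i j assume nz: "coeff (coeff P j) i \<noteq> 0"
    then have "coeff P j \<noteq> 0" by auto
    then have "j \<le> degree P" by (rule le_degree)
    moreover have "i \<le> degree (coeff P j)" using nz by (rule le_degree)
    ultimately show "i + j \<le> (\<Sum>j\<le>degree P. degree (coeff P j)) + degree P"
      using \<open>\<And>j. j \<le> degree P \<Longrightarrow> degree (coeff P j) \<le> _\<close> by (meson add_mono order_trans)
  qed
  then show ?thesis by blast
qed

lemma ev_eq_eval_form: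
  assumes h: "rhom h" and P: "total_degree_le P d"
  shows "ev h P a b = eval_form h d (\<lambda>i j. coeff (coeff P j) i) a b 1"
proof -
  interpret rhom h by fact
  have 0: "coeff (coeff P j) i = 0" if "\<not> i + j \<le> d" for i j
    using P that unfolding total_degree_le_def by blast
  have degP: "degree P < Suc d"
    using 0 by (intro le_imp_less_Suc degree_le) (auto intro!: poly_eqI)
  have eval: "poly (map_poly h (coeff P j)) a = (\<Sum>i\<le>d. h (coeff (coeff P j) i) * a ^ i)" for j
  proof -
    have "degree (map_poly h (coeff P j)) \<le> d"
      using 0 by (intro degree_le) (auto simp: coeff_map_poly h_0)
    then have "{..degree (map_poly h (coeff P j))} \<subseteq> {..d}" by auto
    then have "(\<Sum>i\<le>degree (map_poly h (coeff P j)). coeff (map_poly h (coeff P j)) i * a ^ i) =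
        (\<Sum>i\<le>d. coeff (map_poly h (coeff P j)) i * a ^ i)"
      by (rule sum.mono_neutral_left[rotated]) (auto simp: coeff_eq_0)
    then show ?thesis by (simp add: poly_altdef coeff_map_poly h_0)
  qed
  have "ev h P a b = (\<Sum>j\<le>d. \<Sum>i\<le>d. h (coeff (coeff P j) i) * a ^ i * b ^ j)"
    unfolding ev_sum_coeff[OF degP] eval lessThan_Suc_atMost sum_distrib_right ..
  also have "\<dots> = (\<Sum>i\<le>d. \<Sum>j\<le>d. h (coeff (coeff P j) i) * a ^ i * b ^ j)"
    by (rule sum.swap)
  also have "\<dots> = (\<Sum>i\<le>d. \<Sum>j\<le>d - i. h (coeff (coeff P j) i) * a ^ i * b ^ j)"
  proof (rule sum.cong[OF refl])
    fix i
    show "(\<Sum>j\<le>d. h (coeff (coeff P j) i) * a ^ i * b ^ j) =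
        (\<Sum>j\<le>d - i. h (coeff (coeff P j) i) * a ^ i * b ^ j)"
    proof (rule sum.mono_neutral_right)
      show "\<forall>j\<in>{..d} - {..d - i}. h (coeff (coeff P j) i) * a ^ i * b ^ j = 0"
      proof
        fix j assume "j \<in> {..d} - {..d - i}"
        then have "\<not> i + j \<le> d" by auto
        then show "h (coeff (coeff P j) i) * a ^ i * b ^ j = 0" by (simp add: 0 h_0)
      qed
    qed auto
  qed
  finally show ?thesis unfolding eval_form_def by simp
qed

lemma eval_form_at_infinity:
  "eval_form id d f a 1 0 = (\<Sum>i\<le>d. f i (d - i) * a ^ i)"
proof -
  have "(\<Sum>j\<le>d - i. id (f i j) * a ^ i * 1 ^ j * 0 ^ (d - i - j)) = f i (d - i) * a ^ i" for i
  proof -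
    have "(\<Sum>j\<le>d - i. id (f i j) * a ^ i * 1 ^ j * 0 ^ (d - i - j)) =
        (\<Sum>j\<le>d - i. if j = d - i then f i (d - i) * a ^ i else 0)"
      by (intro sum.cong refl) auto
    then show ?thesis by simp
  qed
  then show ?thesis unfolding eval_form_def by (intro sum.cong refl)
qed

lemma (in specialization) ord_ev_fps:
  assumes "A = fps_to_fls a" "B = fps_to_fls b" "ev const P fx y \<noteq> 0"
  shows "\<nu> (ev const P fx y) \<ge> 0" "\<nu> (ev const P fx y) > 0 \<longleftrightarrow> ev id P (a $ 0) (b $ 0) = 0"
proof -
  have eq: "s (ev const P fx y) = fps_to_fls (ev fps_const P a b)"
    using sp_ev[of P] unfolding assms(1,2) ev_fls_fps .
  then have "ev fps_const P a b \<noteq> 0" using assms(3) ev_spec_eq_0_iff[of P] sp_ev[of P] by auto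
  then show "\<nu> (ev const P fx y) > 0 \<longleftrightarrow> ev id P (a $ 0) (b $ 0) = 0"
    unfolding ord_def eq fls_subdegree_fls_to_fps ev_fps_nth_0[symmetric]
    using subdegree_eq_0_iff[of "ev fps_const P a b"] by auto
  show "\<nu> (ev const P fx y) \<ge> 0"
    unfolding ord_def eq by (rule fls_subdegree_fls_to_fps_gt0)
qed

lemma (in specialization) sp_eval: "s (poly (map_poly const p) fx) = poly (map_poly fls_const p) A"
  using sp_ev[of "[:p:]"] by (simp add: cst.ev_const flsc.ev_const)

text \<open>Where \<open>w\<close> has no pole its expansion is a power series \<open>W\<close>, so
  the relation with denominator \<open>p\<close> can be compared coefficient by coefficient; the low
  coefficients of \<open>P\<close> must vanish along with those of \<open>p\<close>.\<close>

lemma (in specialization) regular_mult_eval: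
  assumes "A = fps_to_fls a" "B = fps_to_fls b" and w: "w \<in> F" "\<nu> w \<ge> 0"
    and eq: "w * poly (map_poly const p) fx = ev const P fx y"
  shows "\<exists>W. W * poly (map_poly fps_const p) a = ev fps_const P a b"
proof -
  have "fps_to_fls (fls_regpart (s w)) = s w" using w(2) unfolding ord_def by simp
  moreover have "poly (map_poly fls_const p) (fps_to_fls a) = fps_to_fls (poly (map_poly fps_const p) a)"
    using ev_fls_fps[of "[:p:]" a 0] by (simp only: flsc.ev_const fpsc.ev_const)
  moreover have "s w * s (poly (map_poly const p) fx) = s (ev const P fx y)"
    unfolding eq[symmetric] by (rule sp_mult[symmetric]) (simp_all add: w F_eval F_fx)
  then have "s w * poly (map_poly fls_const p) A = ev fls_const P A B"
    unfolding sp_eval sp_ev .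
  ultimately have "fps_to_fls (fls_regpart (s w) * poly (map_poly fps_const p) a) =
      fps_to_fls (ev fps_const P a b)"
    unfolding fls_times_fps_to_fls by (simp add: assms(1,2) ev_fls_fps)
  then show ?thesis by auto
qed

context fermat
begin

lemma finite_point:
  assumes "x0 ^ n + y0 ^ n = 1"
  obtains a b where "specialization n y (fps_to_fls a) (fps_to_fls b)" "a $ 0 = x0" "b $ 0 = y0"
    "\<And>z. z \<in> F \<Longrightarrow> z \<noteq> 0 \<Longrightarrow> val y (x0, y0, 1) z = ord y (fps_to_fls a) (fps_to_fls b) z"
proof (cases "y0 = 0")
  case True
  then have x0: "x0 ^ n = 1" using assms n_pos by (simp add: zero_power)
  interpret chart n y "root_coord n x0" "coord 0"
    "(x0, 0, 1)" y fx 0 x0 "- 1" "fps_const x0 * unit_root n" by (rule chart_b[OF x0])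
  show ?thesis
    by (rule that[of "fps_const x0 * unit_root n" "fps_const 0 + fps_X"];
        (unfold coord_def[symmetric] root_coord_def[symmetric])?)
      (use True in \<open>simp_all add: unit_root[OF n_pos] specialization_axioms val_eq_ord\<close>)
next
  case False
  obtain Bs where "Bs ^ n = 1 - (fps_const x0 + fps_X) ^ n" and Bs: "Bs $ 0 = y0"
    using ex_branch[OF assms False] by blast
  then interpret chart n y "coord x0" "fps_to_fls Bs" "(x0, y0, 1)" fx y x0 y0 "- 1" Bs
    using chart_finite assms False by blast
  show ?thesis
    by (rule that[of "fps_const x0 + fps_X" Bs]; (unfold coord_def[symmetric])?)
      (simp_all add: specialization_axioms val_eq_ord Bs)
qed

lemma finite_on_curve: "x0 ^ n + y0 ^ n = 1 \<Longrightarrow> (x0, y0, 1) \<in> fermat_curve n"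
  unfolding fermat_curve_def by simp

lemma infinite_on_curve: "x0 ^ n = - 1 \<Longrightarrow> (x0, 1, 0) \<in> fermat_curve n"
  unfolding fermat_curve_def using n_pos by (simp add: zero_power)

lemma val_ev_finite:
  assumes "x0 ^ n + y0 ^ n = 1" "ev const P fx y \<noteq> 0"
  shows "val y (x0, y0, 1) (ev const P fx y) \<ge> 0"
    "val y (x0, y0, 1) (ev const P fx y) > 0 \<longleftrightarrow> ev id P x0 y0 = 0"
proof -
  obtain a b where ab: "specialization n y (fps_to_fls a) (fps_to_fls b)" "a $ 0 = x0" "b $ 0 = y0"
    and v: "\<And>z. z \<in> F \<Longrightarrow> z \<noteq> 0 \<Longrightarrow> val y (x0, y0, 1) z = ord y (fps_to_fls a) (fps_to_fls b) z"
    using finite_point[OF assms(1)] by blast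
  interpret specialization n y "fps_to_fls a" "fps_to_fls b" by (rule ab(1))
  show "val y (x0, y0, 1) (ev const P fx y) \<ge> 0"
    "val y (x0, y0, 1) (ev const P fx y) > 0 \<longleftrightarrow> ev id P x0 y0 = 0"
    using ord_ev_fps[OF refl refl assms(2)] v[OF F_ev[OF F_fx F_y] assms(2)] ab by simp_all
qed

text \<open>In the chart at infinity, \<open>t^d P(x, y)\<close> is the homogenised form at
  \<open>(x0 R, 1, t)\<close> with \<open>R\<close> the series \<open>unit_root n\<close>. It is a
  power series whose constant coefficient is the part of degree \<open>d\<close> at
  \<open>(x0, 1)\<close>.\<close>

lemma val_ev_infinite:
  assumes x0: "x0 ^ n = - 1" and P: "total_degree_le P d" and nz: "ev const P fx y \<noteq> 0"
  shows "val y (x0, 1, 0) (ev const P fx y) \<ge> - int d"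
    "val y (x0, 1, 0) (ev const P fx y) > - int d \<longleftrightarrow> (\<Sum>i\<le>d. coeff (coeff P (d - i)) i * x0 ^ i) = 0"
proof -
  interpret chart n y "root_coord n x0 / coord 0"
    "inverse (coord 0)" "(x0, 1, 0)" "inverse y" "fx / y" 0 x0 1 "fps_const x0 * unit_root n"
    using chart_c[OF x0] .
  let ?w = "ev const P fx y" and ?f = "\<lambda>i j. coeff (coeff P j) i"
  let ?G = "eval_form fps_const d ?f (fps_const x0 * unit_root n) 1 (fps_const 0 + fps_X)"
  have "coord 0 ^ d * s ?w = eval_form fls_const d ?f (coord 0 * (root_coord n x0 / coord 0))
      (coord 0 * inverse (coord 0)) (coord 0 * 1)"
    unfolding eval_form_scale sp_ev ev_eq_eval_form[OF rhom_fls_const P] ..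
  also have "\<dots> = eval_form fls_const d ?f (fps_to_fls (fps_const x0 * unit_root n)) (fps_to_fls 1)
      (fps_to_fls (fps_const 0 + fps_X))"
    unfolding coord_def[symmetric] root_coord_def[symmetric] using coord_nonzero[of 0] by simp
  also have "\<dots> = fps_to_fls ?G" by (rule eval_form_fls)
  finally have eq: "coord 0 ^ d * s ?w = fps_to_fls ?G" .
  have sw: "s ?w \<noteq> 0" using nz by (simp add: sp_eq_0_iff F_ev F_fx F_y)
  then have G0: "?G \<noteq> 0" using eq coord_nonzero[of 0] by auto
  have "int d + \<nu> ?w = int (subdegree ?G)"
    using arg_cong[OF eq, of fls_subdegree] sw coord_nonzero[of 0]
    by (simp add: ord_def fls_subdegree_fls_to_fps fls_subdegree_pow subdegree_coord)
  moreover have "subdegree ?G = 0 \<longleftrightarrow> ?G $ 0 \<noteq> 0" using G0 by (simp add: subdegree_eq_0_iff)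
  moreover have "?G $ 0 = (\<Sum>i\<le>d. coeff (coeff P (d - i)) i * x0 ^ i)"
    by (simp add: eval_form_fps_nth_0 unit_root[OF n_pos] eval_form_at_infinity)
  moreover have "val y (x0, 1, 0) ?w = \<nu> ?w" by (rule val_eq_ord[OF F_ev[OF F_fx F_y] nz])
  ultimately have "val y (x0, 1, 0) ?w = int (subdegree ?G) - int d"
    "subdegree ?G = 0 \<longleftrightarrow> (\<Sum>i\<le>d. coeff (coeff P (d - i)) i * x0 ^ i) \<noteq> 0"
    by simp_all
  then show "val y (x0, 1, 0) ?w \<ge> - int d"
    "val y (x0, 1, 0) ?w > - int d \<longleftrightarrow> (\<Sum>i\<le>d. coeff (coeff P (d - i)) i * x0 ^ i) = 0"
    by auto
qed

text \<open>
  A common denominator of least degree has no root \<open>x0\<close>: if \<open>x0^n \<noteq> 1\<close>, the numerator vanishes at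
  all \<open>n\<close> points above \<open>x0\<close>; if \<open>x0^n = 1\<close>, then \<open>y\<close> is a parameter at the only point above \<open>x0\<close>,
  and the powers of \<open>y\<close> do not mix because \<open>x\<close> is a series in \<open>y^n\<close>.
\<close>

lemma regular_imp_polynomial:
  assumes w: "w \<in> F" "w \<noteq> 0"
    and reg: "\<And>x0 y0. x0 ^ n + y0 ^ n = 1 \<Longrightarrow> val y (x0, y0, 1) w \<ge> 0"
  shows "\<exists>P. degree P < n \<and> w = ev const P fx y"
proof -
  let ?J = "\<lambda>h. h \<noteq> 0 \<and> (\<exists>P. degree P < n \<and> w * poly (map_poly const h) fx = ev const P fx y)"
  have "\<exists>h. ?J h"
  proof -
    obtain P0 Q0 where Q0: "ev const Q0 fx y \<noteq> 0" "w = ev const P0 fx y / ev const Q0 fx y"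
      using F_fracE[OF w(1)] .
    \<comment> \<open>Rationalising the denominator: some nonzero multiple of it depends on
      \<open>x\<close> alone.\<close>
    obtain p u where p: "p \<noteq> 0" "ev const Q0 fx y * ev const u fx y = poly (map_poly const p) fx"
      using gen.ex_multiple_in_base[OF Q0(1)] by blast
    obtain a q r where ar: "a \<noteq> 0" "smult a (P0 * u) = fermat_poly n * q + r" "degree r < n"
      using pseudo_mod_fermat[OF n_pos] by metis
    have "w * poly (map_poly const (a * p)) fx
        = poly (map_poly const a) fx * ev const (P0 * u) fx y"
      using Q0 p(2)[symmetric] by (simp add: rhom.h_mult[OF cst.rhom_eval] cst.ev_mult)
    also have "\<dots> = ev const r fx y"
      unfolding cst.ev_smult[symmetric] ar(2) by (simp add: cst.ev_add cst.ev_mult gen.ev_fermat)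
    finally show ?thesis using ar p by (metis no_zero_divisors)
  qed
  then obtain h where h: "?J h" and min: "\<And>g. ?J g \<Longrightarrow> degree h \<le> degree g"
    using ex_has_least_nat[of ?J _ degree] by blast
  then obtain P where h0: "h \<noteq> 0" and P: "degree P < n"
    and eq: "w * poly (map_poly const h) fx = ev const P fx y" by blast
  show ?thesis
  proof (cases "degree h = 0")
    case True
    then obtain c where c: "h = [:c:]" by (metis degree_eq_zeroE)
    with h0 have "const (1 / c) * const c = 1"
      by (simp flip: cst.h_mult add: cst.h_1)
    then have "w = ev const (smult [:1 / c:] P) fx y"
      unfolding cst.ev_smult eq[symmetric] c by (simp add: cst.eval_pCons mult.left_commute)
    then show ?thesis using P degree_smult_le[of "[:1 / c:]" P] by (metis le_less_trans)
  next
    case False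
    then have "\<not> constant (poly h)" by (simp add: constant_degree)
    then obtain x0 where x0: "poly h x0 = 0" using fundamental_theorem_of_algebra by blast
    have "poly (coeff P j) x0 = 0" for j
    proof (cases "x0 ^ n = 1")
      case False
      let ?q = "map_poly (\<lambda>p. poly p x0) P"
      have "?q = 0"
      proof (rule card_nth_roots_eq[OF n_pos, of "1 - x0 ^ n"])
        show "degree ?q < n" using map_poly_degree_leq[of "\<lambda>p. poly p x0" P] P by simp
        fix y0 assume "y0 ^ n = 1 - x0 ^ n"
        then have on: "x0 ^ n + y0 ^ n = 1" by simp
        obtain a b where ab: "specialization n y (fps_to_fls a) (fps_to_fls b)" "a $ 0 = x0" "b $ 0 = y0"
          and v: "\<And>z. z \<in> F \<Longrightarrow> z \<noteq> 0 \<Longrightarrow> val y (x0, y0, 1) z = ord y (fps_to_fls a) (fps_to_fls b) z"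
          using finite_point[OF on] by blast
        interpret specialization n y "fps_to_fls a" "fps_to_fls b" by (rule ab(1))
        obtain W where "W * poly (map_poly fps_const h) a = ev fps_const P a b"
          using regular_mult_eval[OF refl refl w(1) _ eq] reg[OF on] v[OF w] by auto
        then have "ev fps_const P a b $ 0 = 0" using x0 ab by (auto simp: eval_fps_nth_0 dest: sym)
        then have "ev id P x0 y0 = 0" using ab by (simp add: ev_fps_nth_0)
        then show "poly ?q y0 = 0" by (simp add: ev_def)
      qed (use False in simp)
      then have "coeff ?q j = 0" by simp
      then show ?thesis by (simp add: coeff_map_poly)
    next
      case True
      interpret chart n y "root_coord n x0" "coord 0"
        "(x0, 0, 1)" y fx 0 x0 "- 1" "fps_const x0 * unit_root n" by (rule chart_b[OF True])
      let ?a = "fps_const x0 * unit_root n" and ?h = "poly (map_poly fps_const h)"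
      have on: "x0 ^ n + 0 ^ n = 1" using True n_pos by (simp add: zero_power)
      obtain W where W: "W * ?h ?a = ev fps_const P ?a (fps_const 0 + fps_X)"
        using regular_mult_eval[OF root_coord_def coord_def w(1) _ eq] reg[OF on] val_eq_ord[OF w] by auto
      have per: "periodic_fps n ?a"
        by (intro periodic_fps_mult periodic_fps_const unit_root n_pos)
      have h0: "?h ?a $ k = 0" if "k < n" for k
      proof (cases "k = 0")
        case True
        then show ?thesis using x0 by (simp add: eval_fps_nth_0 unit_root[OF n_pos])
      next
        case False
        with that have "\<not> n dvd k" by (auto dest: dvd_imp_le)
        then show ?thesis using periodic_fps_eval[OF per, of h] unfolding periodic_fps_def by blast
      qed
      show ?thesis
      proof (cases "j < n")
        case True
        then have "(W * ?h ?a) $ j = 0" unfolding fps_mult_nth by (intro sum.neutral) (auto simp: h0)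
        then have "poly (map_poly fps_const (coeff P j)) ?a $ 0 = 0"
          using ev_periodic_nth[OF per P True, of 0] by (simp add: W)
        then show ?thesis by (simp add: eval_fps_nth_0 unit_root[OF n_pos])
      next
        case False
        then show ?thesis using P by (simp add: coeff_eq_0)
      qed
    qed
    then have "[:[:- x0, 1:]:] dvd P" by (simp add: const_poly_dvd_iff poly_eq_0_iff_dvd)
    then obtain P' where P': "P = [:[:- x0, 1:]:] * P'" by (elim dvdE)
    obtain h' where h': "h = [:- x0, 1:] * h'" using x0 unfolding poly_eq_0_iff_dvd by (elim dvdE)
    have lin: "poly (map_poly const [:- x0, 1:]) fx \<noteq> 0" by (rule gen.eval_nonzero) simp
    have h'0: "h' \<noteq> 0" using h0 h' by auto
    have "poly (map_poly const [:- x0, 1:]) fx * (w * poly (map_poly const h') fx) =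
        poly (map_poly const [:- x0, 1:]) fx * ev const P' fx y"
      using eq unfolding h' P' rhom.h_mult[OF cst.rhom_eval] cst.ev_mult cst.ev_const
      by (simp add: mult.left_commute)
    then have "w * poly (map_poly const h') fx = ev const P' fx y" using lin by simp
    moreover have "degree P' < n" using P unfolding P' by (simp add: degree_smult_eq)
    ultimately have "degree h \<le> degree h'" using min[of h'] h'0 by blast
    moreover have "degree h = Suc (degree h')" unfolding h' using h'0 by (subst degree_mult_eq) auto
    ultimately show ?thesis by simp
  qed
qed

text \<open>If the least total degree bound \<open>e\<close> exceeded \<open>d\<close>, the part of
  degree \<open>e\<close> would vanish at all \<open>n\<close> points at infinity. As a polynomial
  in \<open>Y / X\<close> it has degree below \<open>n\<close>, so it would be zero, against the
  choice of \<open>e\<close>.\<close>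

lemma total_degree_of_poles:
  assumes P: "P \<noteq> 0" "degree P < n"
    and bound: "\<And>x0. x0 ^ n = - 1 \<Longrightarrow> val y (x0, 1, 0) (ev const P fx y) \<ge> - d"
  shows "d \<ge> 0 \<and> total_degree_le P (nat d)"
proof -
  define e where "e = (LEAST e. total_degree_le P e)"
  have e: "total_degree_le P e" unfolding e_def using ex_total_degree_le by (rule LeastI_ex)
  have nz: "ev const P fx y \<noteq> 0" by (rule gen.fermat_indep[OF P])
  have "int e \<le> d"
  proof (rule ccontr)
    assume "\<not> int e \<le> d"
    \<comment> \<open>Top form with \<open>X = 1\<close>, because it is the degree in
      \<open>y\<close> that is known to be below \<open>n\<close>. The points at infinity are
      normalised by \<open>Y = 1\<close>, hence the reciprocals \<open>1 / u\<close> below.\<close>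
    let ?c = "\<lambda>j. if j \<le> e then coeff (coeff P j) (e - j) else 0"
    define q where "q = (\<Sum>j<n. monom (?c j) j)"
    have coeff_q: "coeff q j = (if j < n then ?c j else 0)" for j
      by (simp add: q_def coeff_sum)
    have "q = 0"
    proof (rule card_nth_roots_eq[OF n_pos, of "- 1"])
      have "degree q \<le> n - 1" by (intro degree_le) (auto simp: coeff_q)
      then show "degree q < n" using n_pos by simp
      fix u :: complex assume u: "u ^ n = - 1"
      then have u0: "u \<noteq> 0" using n_pos by (auto simp: zero_power)
      have iu: "(1 / u) ^ n = - 1" using u by (simp add: power_divide)
      have "val y (1 / u, 1, 0) (ev const P fx y) > - int e"
        using bound[OF iu] \<open>\<not> int e \<le> d\<close> by linarith
      then have "(\<Sum>i\<le>e. coeff (coeff P (e - i)) i * (1 / u) ^ i) = 0"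
        using val_ev_infinite(2)[OF iu e nz] by blast
      then have "0 = u ^ e * (\<Sum>i\<le>e. coeff (coeff P (e - i)) i * (1 / u) ^ i)" by simp
      also have "\<dots> = (\<Sum>i\<le>e. coeff (coeff P (e - i)) i * u ^ (e - i))"
        unfolding sum_distrib_left
      proof (intro sum.cong refl)
        fix i assume "i \<in> {..e}"
        then have "u ^ e = u ^ (e - i) * u ^ i" by (simp flip: power_add)
        then show "u ^ e * (coeff (coeff P (e - i)) i * (1 / u) ^ i) = coeff (coeff P (e - i)) i * u ^ (e - i)"
          using u0 by (simp add: power_divide)
      qed
      also have "\<dots> = (\<Sum>j\<le>e. coeff (coeff P j) (e - j) * u ^ j)"
        by (rule sum.reindex_bij_witness[of _ "\<lambda>j. e - j" "\<lambda>j. e - j"]) auto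
      also have "\<dots> = (\<Sum>j\<le>e + n. ?c j * u ^ j)"
        by (intro sum.mono_neutral_cong_left) auto
      also have "\<dots> = (\<Sum>j<n. ?c j * u ^ j)"
      proof (intro sum.mono_neutral_right)
        show "\<forall>j\<in>{..e + n} - {..<n}. ?c j * u ^ j = 0"
        proof
          fix j assume "j \<in> {..e + n} - {..<n}"
          then have "coeff P j = 0" using P by (intro coeff_eq_0) auto
          then show "?c j * u ^ j = 0" by simp
        qed
      qed auto
      finally show "poly q u = 0" by (simp add: q_def poly_sum poly_monom)
    qed simp
    then have c0: "?c j = 0" if "j < n" for j using coeff_q[of j] that by simp
    have top: "coeff (coeff P j) i = 0" if "i + j = e" for i j
    proof (cases "j < n")
      case True
      then show ?thesis using c0[OF True] that by auto
    next
      case False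
      then show ?thesis using P by (simp add: coeff_eq_0)
    qed
    show False
    proof (cases e)
      case 0
      have "P = 0"
      proof (intro poly_eqI)
        fix j i
        show "coeff (coeff P j) i = coeff (coeff 0 j) i"
          using e top[of i j] 0 unfolding total_degree_le_def by fastforce
      qed
      with P show False by simp
    next
      case (Suc e')
      have "total_degree_le P e'"
        using e top unfolding total_degree_le_def Suc by (metis le_SucE)
      then have "e \<le> e'" unfolding e_def by (rule Least_le)
      with Suc show False by simp
    qed
  qed
  then have "e \<le> nat d" "d \<ge> 0" by linarith+
  then show ?thesis using e unfolding total_degree_le_def by (meson order_trans)
qed

end

section \<open>Functions supported on the special points\<close>

text \<open>Apart from 0 and 1, only multiples of \<open>n\<close> occur as exponents.\<close>

lemma subdegree_linear_plus_periodic: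
  fixes R :: "complex fps"
  assumes R: "periodic_fps n R"
    and f: "f = fps_const p + fps_const q * fps_X + fps_const r * R" "f \<noteq> 0"
  shows "subdegree f \<le> 1 \<or> n \<le> subdegree f"
proof (rule ccontr)
  assume "\<not> (subdegree f \<le> 1 \<or> n \<le> subdegree f)"
  then have big: "1 < subdegree f" and small: "subdegree f < n" by auto
  then have "\<not> n dvd subdegree f" by (auto dest: dvd_imp_le)
  then have "R $ subdegree f = 0" using R unfolding periodic_fps_def by blast
  then have "f $ subdegree f = 0" using big by (simp add: f(1))
  then show False using f(2) by simp
qed

lemma ev_total_degree_1:
  assumes "rhom h" "total_degree_le P 1"
  shows "ev h P a b = h (coeff (coeff P 0) 0) + h (coeff (coeff P 0) 1) * a + h (coeff (coeff P 1) 0) * b"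
proof -
  have "{..1::nat} = {0, 1}" by auto
  then show ?thesis unfolding ev_eq_eval_form[OF assms] eval_form_def by simp
qed

lemma card_roots_le:
  assumes "degree q \<le> k" "poly q u \<noteq> 0" "\<And>\<omega>. Q \<omega> \<Longrightarrow> poly q \<omega> = (0 :: complex)"
  shows "card {\<omega>. Q \<omega>} \<le> k"
proof -
  have "q \<noteq> 0" using assms(2) by auto
  then have "card {\<omega>. Q \<omega>} \<le> card {\<omega>. poly q \<omega> = 0}"
    using assms(3) poly_roots_finite by (intro card_mono) auto
  also have "\<dots> \<le> degree q" using \<open>q \<noteq> 0\<close> by (rule card_poly_roots_bound)
  finally show ?thesis using assms(1) by simp
qed

text \<open>The bounds are required to be attained: a point where the minimum is reached keeps the
  restriction of the numerator to a coordinate line from vanishing identically, so that its roots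
  can be counted.\<close>

locale cusp_unit = fermat +
  fixes z :: acfield and \<alpha> \<beta> \<gamma> :: int
  assumes z: "z \<in> F" "z \<noteq> 0"
    and generic: "\<And>x0 y0. x0 ^ n + y0 ^ n = 1 \<Longrightarrow> x0 \<noteq> 0 \<Longrightarrow> y0 \<noteq> 0 \<Longrightarrow> val y (x0, y0, 1) z = 0"
    and a_ge: "\<And>\<omega>. \<omega> ^ n = 1 \<Longrightarrow> \<alpha> \<le> val y (0, \<omega>, 1) z"
    and b_ge: "\<And>\<omega>. \<omega> ^ n = 1 \<Longrightarrow> \<beta> \<le> val y (\<omega>, 0, 1) z"
    and c_ge: "\<And>\<omega>. \<omega> ^ n = - 1 \<Longrightarrow> \<gamma> \<le> val y (\<omega>, 1, 0) z"
    and a_eq: "\<exists>\<omega>. \<omega> ^ n = 1 \<and> val y (0, \<omega>, 1) z = \<alpha>"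
    and b_eq: "\<exists>\<omega>. \<omega> ^ n = 1 \<and> val y (\<omega>, 0, 1) z = \<beta>"
    and c_eq: "\<exists>\<omega>. \<omega> ^ n = - 1 \<and> val y (\<omega>, 1, 0) z = \<gamma>"
begin

definition w where "w = z * fx powi (- \<alpha>) * y powi (- \<beta>)"
text \<open>At the \<open>c_j\<close> the two power factors of \<open>w\<close> contribute
  \<open>\<alpha> + \<beta>\<close>, since \<open>x\<close> and \<open>y\<close> have simple poles
  there; so \<open>w\<close> has valuation at least \<open>- d\<close>.\<close>

definition d where "d = - (\<alpha> + \<beta> + \<gamma>)"

lemma w: "w \<in> F" "w \<noteq> 0"
  unfolding w_def by (auto intro!: F_mult F_power_int F_fx F_y z simp: z fx_nonzero y_nonzero)

lemma val_w:
  assumes "Q \<in> fermat_curve n"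
  shows "val y Q w = val y Q z - \<alpha> * val y Q fx - \<beta> * val y Q y"
proof -
  have "z * fx powi (- \<alpha>) \<noteq> 0" using z fx_nonzero by simp
  then show ?thesis
    unfolding w_def using assms
    by (simp add: val_mult val_power_int F_mult F_power_int F_fx F_y z fx_nonzero y_nonzero)
qed

lemma val_w_a: "\<omega> ^ n = 1 \<Longrightarrow> val y (0, \<omega>, 1) w = val y (0, \<omega>, 1) z - \<alpha>"
proof -
  assume \<omega>: "\<omega> ^ n = 1"
  then have "\<omega> \<noteq> 0" using n_pos by (auto simp: zero_power)
  moreover have "0 ^ n + \<omega> ^ n = 1" using \<omega> n_pos by (simp add: zero_power)
  ultimately show ?thesis using val_finite_coords[of 0 \<omega>] by (simp add: val_w finite_on_curve)
qed

lemma val_w_b: "\<omega> ^ n = 1 \<Longrightarrow> val y (\<omega>, 0, 1) w = val y (\<omega>, 0, 1) z - \<beta>"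
  using val_b_coords[of \<omega>] n_pos by (simp add: val_w finite_on_curve zero_power)

lemma val_w_c: "\<omega> ^ n = - 1 \<Longrightarrow> val y (\<omega>, 1, 0) w = val y (\<omega>, 1, 0) z + \<alpha> + \<beta>"
  using val_c_coords[of \<omega>] by (simp add: val_w infinite_on_curve)

lemma ex_polynomial: "\<exists>P. degree P < n \<and> w = ev const P fx y \<and> total_degree_le P (nat d) \<and> d \<ge> 0"
proof -
  have "val y (x0, y0, 1) w \<ge> 0" if on: "x0 ^ n + y0 ^ n = 1" for x0 y0
  proof (cases "x0 = 0 \<or> y0 = 0")
    case True
    then show ?thesis
      using on val_w_a[of y0] val_w_b[of x0] a_ge[of y0] b_ge[of x0] n_pos by (auto simp: zero_power)
  next
    case False
    then show ?thesis
      using generic[OF on] val_finite_coords[OF on] val_w[OF finite_on_curve[OF on]] by simp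
  qed
  then obtain P where P: "degree P < n" "w = ev const P fx y"
    using regular_imp_polynomial[OF w] by blast
  have "P \<noteq> 0" using P w by (auto simp: cst.ev_0)
  moreover have "val y (x0, 1, 0) (ev const P fx y) \<ge> - d" if "x0 ^ n = - 1" for x0
    using val_w_c[OF that] c_ge[OF that] P by (simp add: d_def)
  ultimately show ?thesis using total_degree_of_poles[of P d] P by blast
qed

definition P where
  "P = (SOME P. degree P < n \<and> w = ev const P fx y \<and> total_degree_le P (nat d) \<and> d \<ge> 0)"

lemma P: "degree P < n" "w = ev const P fx y" "total_degree_le P (nat d)" and d_nonneg: "d \<ge> 0"
  using someI_ex[OF ex_polynomial] unfolding P_def by blast+

lemma ev_P_nonzero: "ev const P fx y \<noteq> 0"
  using P(2) w(2) by simp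

lemma card_a: "card {\<omega>. \<omega> ^ n = 1 \<and> \<alpha> < val y (0, \<omega>, 1) z} \<le> nat d"
proof -
  let ?q = "map_poly (\<lambda>p. poly p 0) P"
  have ev: "ev id P 0 \<omega> = poly ?q \<omega>" for \<omega> by (simp add: ev_def)
  have iff: "\<alpha> < val y (0, \<omega>, 1) z \<longleftrightarrow> poly ?q \<omega> = 0" if "\<omega> ^ n = 1" for \<omega>
    using val_ev_finite(2)[of 0 \<omega>, OF _ ev_P_nonzero] that n_pos val_w_a[OF that] P(2)
    by (simp add: ev zero_power)
  obtain u where u: "u ^ n = 1" "val y (0, u, 1) z = \<alpha>" using a_eq by blast
  show ?thesis
  proof (rule card_roots_le[of ?q _ u])
    show "degree ?q \<le> nat d"
      using P(3) unfolding total_degree_le_def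
      by (intro degree_le) (fastforce simp: coeff_map_poly poly_0_coeff_0)
    show "poly ?q u \<noteq> 0" using iff[OF u(1)] u(2) by simp
  qed (use iff in auto)
qed

lemma card_b: "card {\<omega>. \<omega> ^ n = 1 \<and> \<beta> < val y (\<omega>, 0, 1) z} \<le> nat d"
proof -
  let ?q = "coeff P 0"
  have ev: "ev id P \<omega> 0 = poly ?q \<omega>" for \<omega> by (simp add: ev_id_split poly_0_coeff_0)
  have iff: "\<beta> < val y (\<omega>, 0, 1) z \<longleftrightarrow> poly ?q \<omega> = 0" if "\<omega> ^ n = 1" for \<omega>
    using val_ev_finite(2)[of \<omega> 0, OF _ ev_P_nonzero] that n_pos val_w_b[OF that] P(2)
    by (simp add: ev zero_power)
  obtain u where u: "u ^ n = 1" "val y (u, 0, 1) z = \<beta>" using b_eq by blast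
  show ?thesis
  proof (rule card_roots_le[of ?q _ u])
    show "degree ?q \<le> nat d"
      using P(3) unfolding total_degree_le_def by (intro degree_le) fastforce
    show "poly ?q u \<noteq> 0" using iff[OF u(1)] u(2) by simp
  qed (use iff in auto)
qed

text \<open>\<open>q\<close> is the part of degree \<open>d\<close> with \<open>Y = 1\<close>, that
  is, the restriction to the line at infinity. By \<open>val_ev_infinite\<close> its roots are the
  points where \<open>w\<close> has a valuation above \<open>- d\<close>.\<close>

lemma card_c: "card {\<omega>. \<omega> ^ n = - 1 \<and> \<gamma> < val y (\<omega>, 1, 0) z} \<le> nat d"
proof -
  define q where "q = (\<Sum>i\<le>nat d. monom (coeff (coeff P (nat d - i)) i) i)"
  have iff: "\<gamma> < val y (\<omega>, 1, 0) z \<longleftrightarrow> poly q \<omega> = 0" if "\<omega> ^ n = - 1" for \<omega>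
    using val_ev_infinite(2)[OF that P(3) ev_P_nonzero] val_w_c[OF that] P(2) d_nonneg
    by (auto simp: q_def poly_sum poly_monom d_def)
  obtain u where u: "u ^ n = - 1" "val y (u, 1, 0) z = \<gamma>" using c_eq by blast
  show ?thesis
  proof (rule card_roots_le[of q _ u])
    show "degree q \<le> nat d"
      by (intro degree_le) (auto simp: q_def coeff_sum)
    show "poly q u \<noteq> 0" using iff[OF u(1)] u(2) by simp
  qed (use iff in auto)
qed

text \<open>
  The tangents at the special points meet the curve with multiplicity \<open>n\<close>: for \<open>d = 1\<close> the
  numerator is a linear form, vanishing at a special point to order at most 1 or at least \<open>n\<close>.
\<close>

lemma gap_a:
  assumes d: "d = 1" and \<omega>: "\<omega> ^ n = 1"
  shows "val y (0, \<omega>, 1) z \<le> \<alpha> + 1 \<or> \<alpha> + n \<le> val y (0, \<omega>, 1) z"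
proof -
  let ?r = "fps_const \<omega> * unit_root n"
  have \<omega>0: "\<omega> \<noteq> 0" using \<omega> n_pos by (auto simp: zero_power)
  have "?r ^ n = 1 - (fps_const 0 + fps_X) ^ n"
    by (simp add: power_mult_distrib unit_root[OF n_pos] \<omega> fps_const_power)
  then interpret chart n y "coord 0" "fps_to_fls ?r" "(0, \<omega>, 1)" fx y 0 \<omega> "- 1" ?r
    by (intro chart_finite) (simp_all add: \<omega> \<omega>0 unit_root[OF n_pos] n_pos zero_power)
  let ?f = "ev fps_const P (fps_const 0 + fps_X) ?r"
  have s: "s w = fps_to_fls ?f"
    using sp_ev[of P] unfolding P(2)[symmetric] coord_def ev_fls_fps .
  have f0: "?f \<noteq> 0" using w by (auto simp: s sp_eq_0_iff[symmetric])
  have "val y (0, \<omega>, 1) w = int (subdegree ?f)"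
    unfolding val_eq_ord[OF w] ord_def s by (rule fls_subdegree_fls_to_fps)
  moreover have "subdegree ?f \<le> 1 \<or> n \<le> subdegree ?f"
  proof (rule subdegree_linear_plus_periodic[OF unit_root(3)[OF n_pos] _ f0])
    have "total_degree_le P 1" using P(3) d by simp
    then show "?f = fps_const (coeff (coeff P 0) 0) + fps_const (coeff (coeff P 0) 1) * fps_X
        + fps_const (coeff (coeff P 1) 0 * \<omega>) * unit_root n"
      by (simp add: ev_total_degree_1[OF rhom_fps_const] mult.assoc flip: fps_const_mult)
  qed
  ultimately show ?thesis using val_w_a[OF \<omega>] by linarith
qed

lemma gap_b:
  assumes d: "d = 1" and \<omega>: "\<omega> ^ n = 1"
  shows "val y (\<omega>, 0, 1) z \<le> \<beta> + 1 \<or> \<beta> + n \<le> val y (\<omega>, 0, 1) z"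
proof -
  let ?r = "fps_const \<omega> * unit_root n"
  interpret chart n y "root_coord n \<omega>" "coord 0" "(\<omega>, 0, 1)" y fx 0 \<omega> "- 1" ?r
    by (rule chart_b[OF \<omega>])
  let ?f = "ev fps_const P ?r (fps_const 0 + fps_X)"
  have s: "s w = fps_to_fls ?f"
    using sp_ev[of P] unfolding P(2)[symmetric] coord_def root_coord_def ev_fls_fps .
  have f0: "?f \<noteq> 0" using w by (auto simp: s sp_eq_0_iff[symmetric])
  have "val y (\<omega>, 0, 1) w = int (subdegree ?f)"
    unfolding val_eq_ord[OF w] ord_def s by (rule fls_subdegree_fls_to_fps)
  moreover have "subdegree ?f \<le> 1 \<or> n \<le> subdegree ?f"
  proof (rule subdegree_linear_plus_periodic[OF unit_root(3)[OF n_pos] _ f0])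
    have "total_degree_le P 1" using P(3) d by simp
    then show "?f = fps_const (coeff (coeff P 0) 0) + fps_const (coeff (coeff P 1) 0) * fps_X
        + fps_const (coeff (coeff P 0) 1 * \<omega>) * unit_root n"
      by (simp add: ev_total_degree_1[OF rhom_fps_const] mult.assoc flip: fps_const_mult)
  qed
  ultimately show ?thesis using val_w_b[OF \<omega>] by linarith
qed

lemma gap_c:
  assumes d: "d = 1" and \<omega>: "\<omega> ^ n = - 1"
  shows "val y (\<omega>, 1, 0) z \<le> \<gamma> + 1 \<or> \<gamma> + n \<le> val y (\<omega>, 1, 0) z"
proof -
  let ?r = "fps_const \<omega> * unit_root n"
  interpret chart n y "root_coord n \<omega> / coord 0" "inverse (coord 0)" "(\<omega>, 1, 0)" "inverse y" "fx / y"
    0 \<omega> 1 ?r by (rule chart_c[OF \<omega>])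
  let ?f = "fps_const (coeff (coeff P 1) 0) + fps_const (coeff (coeff P 0) 0) * fps_X
        + fps_const (coeff (coeff P 0) 1 * \<omega>) * unit_root n"
  have deg: "total_degree_le P 1" using P(3) d by simp
  \<comment> \<open>Multiplication by \<open>t = 1/y\<close> turns \<open>1, x, y\<close> into
    \<open>t, \<omega> R, 1\<close>, with \<open>R\<close> the series \<open>unit_root n\<close>:
    the same shape as at the finite points.\<close>
  have "coord 0 * s w = fls_const (coeff (coeff P 0) 0) * coord 0
      + fls_const (coeff (coeff P 0) 1) * root_coord n \<omega> + fls_const (coeff (coeff P 1) 0)"
    unfolding P(2) sp_ev ev_total_degree_1[OF rhom_fls_const deg] using coord_nonzero[of 0]
    by (simp add: field_simps)
  also have "\<dots> = fps_to_fls ?f"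
    unfolding coord_def root_coord_def
    by (simp add: fls_times_fps_to_fls mult.assoc flip: fps_const_mult)
  finally have s: "coord 0 * s w = fps_to_fls ?f" .
  have sw: "s w \<noteq> 0" using w by (simp add: sp_eq_0_iff)
  then have "?f \<noteq> 0" using s coord_nonzero[of 0] by (metis fps_zero_to_fls mult_eq_0_iff)
  then have "subdegree ?f \<le> 1 \<or> n \<le> subdegree ?f"
    by (rule subdegree_linear_plus_periodic[OF unit_root(3)[OF n_pos] refl])
  moreover have "1 + val y (\<omega>, 1, 0) w = int (subdegree ?f)"
    using arg_cong[OF s, of fls_subdegree] sw coord_nonzero[of 0]
    by (simp only: fls_subdegree_fls_to_fps fls_subdegree_mult subdegree_coord if_True
        val_eq_ord[OF w] ord_def simp_thms)
  moreover have "\<alpha> + \<beta> = - 1 - \<gamma>" using d unfolding d_def by simp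
  ultimately show ?thesis using val_w_c[OF \<omega>] by linarith
qed

end

section \<open>Short vectors\<close>

text \<open>A single orbit: \<open>f\<close> lists the valuations of a function, \<open>d\<close>
  bounds the number of entries above the minimum, and \<open>d'\<close>, coming from the inverse
  function, the number of entries below the maximum.\<close>

context
  fixes n :: nat and f :: "nat \<Rightarrow> int" and m M d d' :: int
  assumes m: "\<And>k. k < n \<Longrightarrow> m \<le> f k" and M: "\<And>k. k < n \<Longrightarrow> f k \<le> M"
    and m_att: "\<exists>k<n. f k = m" and M_att: "\<exists>k<n. f k = M"
    and card_m: "int (card {k. k < n \<and> m < f k}) \<le> d"
    and card_M: "int (card {k. k < n \<and> f k < M}) \<le> d'"
begin

lemma card_at_min: "int n - d \<le> card {k. k < n \<and> f k = m}"
proof -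
  have "{..<n} = {k. k < n \<and> f k = m} \<union> {k. k < n \<and> m < f k}" using m by force
  then have "n = card ({k. k < n \<and> f k = m} \<union> {k. k < n \<and> m < f k})" by (metis card_lessThan)
  also have "\<dots> \<le> card {k. k < n \<and> f k = m} + card {k. k < n \<and> m < f k}" by (rule card_Un_le)
  finally show ?thesis using card_m by linarith
qed

lemma card_at_max: "int n - d' \<le> card {k. k < n \<and> f k = M}"
proof -
  have "{..<n} = {k. k < n \<and> f k = M} \<union> {k. k < n \<and> f k < M}" using M by force
  then have "n = card ({k. k < n \<and> f k = M} \<union> {k. k < n \<and> f k < M})" by (metis card_lessThan)
  also have "\<dots> \<le> card {k. k < n \<and> f k = M} + card {k. k < n \<and> f k < M}" by (rule card_Un_le)
  finally show ?thesis using card_M by linarith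
qed

lemma orbit_le: "m \<le> M"
  using m M m_att by (metis order_trans)

lemma orbit_disjoint:
  assumes "m < M"
  shows "card {k. k < n \<and> f k = m} + card {k. k < n \<and> f k = M} \<le> n"
    "card {k. k < n \<and> f k = m} * m ^ 2 + card {k. k < n \<and> f k = M} * M ^ 2 \<le> (\<Sum>k<n. f k ^ 2)"
proof -
  let ?A = "{k. k < n \<and> f k = m}" and ?B = "{k. k < n \<and> f k = M}"
  have disj: "?A \<inter> ?B = {}" using assms by auto
  have sub: "?A \<union> ?B \<subseteq> {..<n}" by auto
  have fin: "finite ?A" "finite ?B" by auto
  show "card ?A + card ?B \<le> n"
    using card_mono[OF _ sub] card_Un_disjoint[OF fin disj] by simp
  have "(\<Sum>k\<in>?A. f k ^ 2) = (\<Sum>k\<in>?A. m ^ 2)" "(\<Sum>k\<in>?B. f k ^ 2) = (\<Sum>k\<in>?B. M ^ 2)"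
    by (rule sum.cong; simp)+
  then have "card ?A * m ^ 2 + card ?B * M ^ 2 = (\<Sum>k\<in>?A. f k ^ 2) + (\<Sum>k\<in>?B. f k ^ 2)" by simp
  also have "\<dots> = (\<Sum>k\<in>?A \<union> ?B. f k ^ 2)" by (rule sum.union_disjoint[OF fin disj, symmetric])
  also have "\<dots> \<le> (\<Sum>k<n. f k ^ 2)" by (rule sum_mono2) (use sub in auto)
  finally show "card ?A * m ^ 2 + card ?B * M ^ 2 \<le> (\<Sum>k<n. f k ^ 2)" .
qed

lemma orbit_const: "m = M \<Longrightarrow> (\<Sum>k<n. f k ^ 2) = n * m ^ 2"
proof -
  assume "m = M"
  then have "f k = m" if "k < n" for k using m M that by force
  then show ?thesis by simp
qed

lemma card_pos: "card {k. k < n \<and> f k = m} \<ge> 1" "card {k. k < n \<and> f k = M} \<ge> 1"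
  using m_att M_att by (auto simp: Suc_le_eq card_gt_0_iff)

text \<open>At least \<open>n - d\<close> entries equal \<open>m\<close> and at least
  \<open>n - d'\<close> equal \<open>M\<close>; for \<open>m < M\<close> these are disjoint
  sets.\<close>

lemma orbit_wide: "m < M \<Longrightarrow> int n \<le> d + d'"
  using orbit_disjoint(1) card_at_min card_at_max by linarith

lemma orbit_d_0:
  assumes "d = 0"
  shows "m = M"
proof -
  have "{k. k < n \<and> m < f k} = {}" using card_m assms by simp
  then show ?thesis using M_att m by force
qed

text \<open>Arranged to cover constant orbits as well: there \<open>1 \<le> d\<close> leaves room
  for the additional \<open>M^2\<close>.\<close>

lemma orbit_norm_1:
  assumes "1 \<le> d"
  shows "(int n - d) * m ^ 2 + M ^ 2 \<le> (\<Sum>k<n. f k ^ 2)"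
proof (cases "m < M")
  case True
  have "(int n - d) * m ^ 2 + 1 * M ^ 2 \<le>
      int (card {k. k < n \<and> f k = m}) * m ^ 2 + int (card {k. k < n \<and> f k = M}) * M ^ 2"
    by (intro add_mono mult_right_mono card_at_min) (use card_pos in auto)
  then show ?thesis using orbit_disjoint(2)[OF True] by simp
next
  case False
  then have eq: "m = M" using orbit_le by simp
  have "(int n - d + 1) * m ^ 2 \<le> int n * m ^ 2" by (rule mult_right_mono) (use assms in auto)
  then show ?thesis using orbit_const[OF eq] eq by (simp add: algebra_simps)
qed

text \<open>On a constant orbit, \<open>n \<le> d + d'\<close> keeps the two multiplicities from
  adding up to more than \<open>n\<close>.\<close>

lemma orbit_norm_2:
  assumes "int n \<le> d + d'"
  shows "(int n - d) * m ^ 2 + (int n - d') * M ^ 2 \<le> (\<Sum>k<n. f k ^ 2)"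
proof (cases "m < M")
  case True
  have "(int n - d) * m ^ 2 + (int n - d') * M ^ 2 \<le>
      int (card {k. k < n \<and> f k = m}) * m ^ 2 + int (card {k. k < n \<and> f k = M}) * M ^ 2"
    by (intro add_mono mult_right_mono card_at_min card_at_max) auto
  then show ?thesis using orbit_disjoint(2)[OF True] by simp
next
  case False
  then have eq: "m = M" using orbit_le by simp
  have "((int n - d) + (int n - d')) * m ^ 2 \<le> int n * m ^ 2" by (rule mult_right_mono) (use assms in auto)
  then show ?thesis using orbit_const[OF eq] eq by (simp add: algebra_simps)
qed

text \<open>One entry equals \<open>m\<close> and, if \<open>m < M\<close>, another equals
  \<open>M\<close>; and \<open>(M - m)^2 + (M + m)^2 = 2 (m^2 + M^2)\<close>.\<close>

lemma orbit_norm_width: "(M - m) ^ 2 \<le> 2 * (\<Sum>k<n. f k ^ 2)"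
proof (cases "m < M")
  case True
  have "1 * m ^ 2 + 1 * M ^ 2 \<le>
      int (card {k. k < n \<and> f k = m}) * m ^ 2 + int (card {k. k < n \<and> f k = M}) * M ^ 2"
    by (intro add_mono mult_right_mono) (use card_pos in auto)
  moreover have "(M - m) ^ 2 \<le> 2 * (m ^ 2 + M ^ 2)"
    using zero_le_power2[of "M + m"] by (simp add: power2_eq_square algebra_simps)
  ultimately show ?thesis using orbit_disjoint(2)[OF True] by simp
next
  case False
  then show ?thesis using orbit_le by (simp add: sum_nonneg)
qed

end

section \<open>The three orbits together\<close>

lemma square_sum3_le: "((a::int) + b + c) ^ 2 \<le> 3 * (a ^ 2 + b ^ 2 + c ^ 2)"
  using zero_le_power2[of "a - b"] zero_le_power2[of "b - c"] zero_le_power2[of "a - c"]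
  by (simp add: power2_eq_square algebra_simps)

lemma sum_lessThan_3: "(\<Sum>i<3::nat. g i) = g 0 + g 1 + (g 2 :: 'a::comm_monoid_add)"
  by (simp add: eval_nat_numeral add.assoc)

text \<open>Here \<open>d\<close> and \<open>d'\<close> are the degrees of the numerators of a function and of its inverse.\<close>

definition degree_bounds :: "nat \<Rightarrow> (nat \<Rightarrow> nat \<Rightarrow> int) \<Rightarrow> (nat \<Rightarrow> int) \<Rightarrow> bool" where
  "degree_bounds n f m \<longleftrightarrow>
     (\<forall>i<3. (\<forall>k<n. m i \<le> f i k) \<and> (\<exists>k<n. f i k = m i)) \<and>
     (let d = - (\<Sum>i<3. m i) in d \<ge> 0 \<and>
       (\<forall>i<3. int (card {k. k < n \<and> m i < f i k}) \<le> d) \<and>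
       (d = 1 \<longrightarrow> (\<forall>i<3. \<forall>k<n. f i k \<le> m i + 1 \<or> m i + int n \<le> f i k)))"

text \<open>
  For \<open>d \<ge> 2\<close> the \<open>n - d\<close> minimal entries of each orbit contribute at least \<open>(n - d) d \<ge> 2n - 4\<close>,
  which leaves at most 4 for the maxima; hence \<open>d' \<le> 3\<close>, and then the \<open>n - d'\<close> maximal entries
  contribute \<open>2n - 4\<close> as well.
\<close>

lemma short_imp_constant_aux:
  fixes f :: "nat \<Rightarrow> nat \<Rightarrow> int"
  assumes n: "n \<ge> 5"
    and m: "degree_bounds n f m"
    and M: "degree_bounds n (\<lambda>i k. - f i k) (\<lambda>i. - M i)"
    and le: "- (\<Sum>i<3. m i) \<le> (\<Sum>i<3. M i)"
    and short: "(\<Sum>i<3. \<Sum>k<n. f i k ^ 2) \<le> 2 * int n"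
    and i: "i < 3"
  shows "m i = M i"
proof (rule ccontr)
  assume ne: "m i \<noteq> M i"
  define d d' where "d = - (\<Sum>i<3. m i)" and "d' = (\<Sum>i<3. M i)"
  define N where "N = int n"
  define S where "S i = (\<Sum>k<n. f i k ^ 2)" for i
  have dd: "d = - m 0 - m 1 - m 2" "d' = M 0 + M 1 + M 2"
    unfolding d_def d'_def sum_lessThan_3 by simp_all
  have short: "S 0 + S 1 + S 2 \<le> 2 * N" using short unfolding S_def N_def sum_lessThan_3 .
  have d_le: "d \<le> d'" using le by (simp add: d_def d'_def)
  have md: "- (\<Sum>i<3. - M i) = d'" by (simp add: d'_def sum_negf)
  note m' = m[unfolded degree_bounds_def Let_def, folded d_def]
  note M' = M[unfolded degree_bounds_def Let_def md]
  have d0: "d \<ge> 0" "d' \<ge> 0" using m' M' by blast+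
  have orb: "\<And>k. k < n \<Longrightarrow> m i \<le> f i k" "\<And>k. k < n \<Longrightarrow> f i k \<le> M i"
    "\<exists>k<n. f i k = m i" "\<exists>k<n. f i k = M i"
    "int (card {k. k < n \<and> m i < f i k}) \<le> d" "int (card {k. k < n \<and> f i k < M i}) \<le> d'"
    if "i < 3" for i
    using m' M' that by auto
  have le: "m i \<le> M i" if "i < 3" for i using orbit_le[OF orb[OF that]] by simp
  have width: "(M i - m i) ^ 2 \<le> 2 * S i" if "i < 3" for i
    unfolding S_def by (rule orbit_norm_width[OF orb[OF that]])
  have norm1: "(N - d) * m i ^ 2 + M i ^ 2 \<le> S i" if "1 \<le> d" "i < 3" for i
    unfolding S_def N_def by (rule orbit_norm_1[OF orb[OF that(2)] that(1)])
  have W: "N \<le> d + d'"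
  proof -
    have "m i < M i" using le[OF i] ne by linarith
    then show ?thesis unfolding N_def using orbit_wide[where f = "f i", OF orb[OF i]] by blast
  qed
  have norm2: "(N - d) * m i ^ 2 + (N - d') * M i ^ 2 \<le> S i" if "i < 3" for i
    unfolding S_def N_def by (rule orbit_norm_2[OF orb[OF that]]) (use W[unfolded N_def] in simp_all)
  have N5: "N \<ge> 5" using n by (simp add: N_def)
  have S0: "S i \<ge> 0" for i unfolding S_def by (simp add: sum_nonneg)
  have "d \<noteq> 0" using orbit_d_0[OF orb[OF i]] ne by blast
  moreover have "d \<noteq> 1"
  proof
    assume d1: "d = 1"
    \<comment> \<open>By the gap, a width above 1 would be a width of at least \<open>n\<close>, and
      the norm would give \<open>n^2 \<le> 4 n\<close>. Widths of at most 1 in all three orbits mean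
      \<open>d + d' \<le> 3 < n\<close>.\<close>
    have "M i \<le> m i + 1" if i: "i < 3" for i
    proof (rule ccontr)
      assume "\<not> M i \<le> m i + 1"
      moreover obtain k where "k < n" "f i k = M i" using orb(4)[OF i] by blast
      ultimately have "m i + N \<le> M i" using m' i d1 unfolding N_def by fastforce
      then have "N ^ 2 \<le> (M i - m i) ^ 2" using N5 by (intro power_mono) auto
      also have "\<dots> \<le> 2 * S i" by (rule width[OF i])
      also have "\<dots> \<le> 2 * (S 0 + S 1 + S 2)"
        using i S0[of 0] S0[of 1] S0[of 2] by (auto simp: eval_nat_numeral less_Suc_eq)
      finally have "N * N \<le> 4 * N" using short by (simp add: power2_eq_square)
      then show False using N5 by simp
    qed
    from this[of 0] this[of 1] this[of 2] show False using W N5 dd by simp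
  qed
  ultimately have d2: "d \<ge> 2" using d0 by linarith
  \<comment> \<open>\<open>d + d'\<close> is the sum of the three widths, each controlled by the
    norm. The resulting \<open>d^2 \<le> 3 n\<close> serves to exclude \<open>d \<ge> n - 1\<close>,
    where \<open>(n - d) d\<close> would be too small.\<close>
  have "(2 * d) ^ 2 \<le> (d + d') ^ 2" using d0 d_le by (intro power_mono) auto
  also have "\<dots> = ((M 0 - m 0) + (M 1 - m 1) + (M 2 - m 2)) ^ 2"
    by (rule arg_cong[of _ _ "\<lambda>a. a ^ 2"]) (use dd in linarith)
  also have "\<dots> \<le> 3 * ((M 0 - m 0) ^ 2 + (M 1 - m 1) ^ 2 + (M 2 - m 2) ^ 2)" by (rule square_sum3_le)
  also have "\<dots> \<le> 12 * N" using width[of 0] width[of 1] width[of 2] short by simp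
  finally have dsq: "d * d \<le> 3 * N" by (simp add: power2_eq_square)
  have dN: "d \<le> N - 2"
  proof (rule ccontr)
    assume "\<not> d \<le> N - 2"
    then have "(N - 1) * (N - 1) \<le> d * d" using N5 by (intro mult_mono) auto
    moreover have "5 * N \<le> N * N" using N5 by (intro mult_right_mono) auto
    ultimately show False using dsq N5 by (simp add: algebra_simps)
  qed
  \<comment> \<open>Integrality enters here: \<open>a \<le> a^2\<close> bounds the sums
    \<open>d\<close> and \<open>d'\<close> by sums of squares.\<close>
  have sq: "a \<le> a ^ 2" for a :: int
  proof (cases "a \<ge> 1")
    case True
    then have "a * 1 \<le> a * a" by (intro mult_left_mono) auto
    then show ?thesis by (simp add: power2_eq_square)
  next
    case False
    then show ?thesis using zero_le_power2[of a] by linarith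
  qed
  have q: "d \<le> m 0 ^ 2 + m 1 ^ 2 + m 2 ^ 2" "d' \<le> M 0 ^ 2 + M 1 ^ 2 + M 2 ^ 2"
    using sq[of "- m 0"] sq[of "- m 1"] sq[of "- m 2"] sq[of "M 0"] sq[of "M 1"] sq[of "M 2"]
    unfolding dd by simp_all
  have prod: "2 * N - 4 \<le> (N - a) * a" if "2 \<le> a" "a \<le> N - 2" for a
  proof -
    \<comment> \<open>This product equals \<open>(N - a) a - (2 N - 4)\<close>; the concave
      \<open>(N - a) a\<close> is smallest at the ends \<open>2\<close> and
      \<open>N - 2\<close>.\<close>
    have "0 \<le> (N - a - 2) * (a - 2)" using that by simp
    then show ?thesis by (simp add: algebra_simps)
  qed
  have qd: "2 * N - 4 \<le> (N - d) * (m 0 ^ 2 + m 1 ^ 2 + m 2 ^ 2)"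
    using prod[OF d2 dN] mult_left_mono[OF q(1), of "N - d"] dN by linarith
  have "(N - d) * (m 0 ^ 2 + m 1 ^ 2 + m 2 ^ 2) + (M 0 ^ 2 + M 1 ^ 2 + M 2 ^ 2) \<le> S 0 + S 1 + S 2"
    using norm1[of 0] norm1[of 1] norm1[of 2] d2 by (simp add: algebra_simps)
  then have M4: "M 0 ^ 2 + M 1 ^ 2 + M 2 ^ 2 \<le> 4" using qd short by linarith
  \<comment> \<open>Cauchy-Schwarz with three terms, \<open>12 = 3 * 4\<close>. It gives
    \<open>d' \<le> 3\<close>, and \<open>3 \<le> N - 2\<close> because
    \<open>N \<ge> 5\<close>.\<close>
  have "d' ^ 2 \<le> 12" using square_sum3_le[of "M 0" "M 1" "M 2"] M4 dd by simp
  then have "d' \<le> 3"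
    using power_mono[of 4 d' 2] by (cases "d' \<le> 3") auto
  then have d'N: "2 \<le> d'" "d' \<le> N - 2" using d2 d_le N5 by linarith+
  have "(N - d) * (m 0 ^ 2 + m 1 ^ 2 + m 2 ^ 2) + (N - d') * (M 0 ^ 2 + M 1 ^ 2 + M 2 ^ 2) \<le> S 0 + S 1 + S 2"
    using norm2[of 0] norm2[of 1] norm2[of 2] by (simp add: algebra_simps)
  moreover have "2 * N - 4 \<le> (N - d') * (M 0 ^ 2 + M 1 ^ 2 + M 2 ^ 2)"
    using prod[OF d'N] mult_left_mono[OF q(2), of "N - d'"] d'N by linarith
  \<comment> \<open>Both contributions together give \<open>4 N - 8 \<le> 2 N\<close>, that is
    \<open>N \<le> 4\<close>.\<close>
  ultimately show False using qd short N5 by linarith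
qed

text \<open>Passing to the inverse function exchanges \<open>m\<close> with \<open>- M\<close> and
  \<open>d\<close> with \<open>d'\<close>, so the smaller of the two degrees may be taken
  first.\<close>

lemma short_imp_constant:
  fixes f :: "nat \<Rightarrow> nat \<Rightarrow> int"
  assumes n: "n \<ge> 5"
    and m: "degree_bounds n f m"
    and M: "degree_bounds n (\<lambda>i k. - f i k) (\<lambda>i. - M i)"
    and short: "(\<Sum>i<3. \<Sum>k<n. f i k ^ 2) \<le> 2 * int n"
    and i: "i < 3"
  shows "m i = M i"
proof (cases "- (\<Sum>i<3. m i) \<le> (\<Sum>i<3. M i)")
  case True
  show ?thesis by (rule short_imp_constant_aux[OF n m M True short i])
next
  case False
  have "- M i = - m i"
    by (rule short_imp_constant_aux[OF n M _ _ _ i])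
      (use m short False in \<open>simp_all add: sum_negf\<close>)
  then show ?thesis by simp
qed

section \<open>Indexing the special points by powers of \<open>\<zeta>\<close>\<close>

lemma primitive_root_enumeration:
  assumes n: "n > 0" and \<zeta>: "primitive_root_of n 1 \<zeta>" and c: "c ^ n = b" "b \<noteq> 0"
  shows "bij_betw (\<lambda>k. c * \<zeta> ^ k) {..<n} {\<omega>. \<omega> ^ n = b}"
proof -
  have \<zeta>n: "\<zeta> ^ n = 1" and \<zeta>k: "\<And>k. 0 < k \<Longrightarrow> k < n \<Longrightarrow> \<zeta> ^ k \<noteq> 1"
    using \<zeta> unfolding primitive_root_of_def by auto
  have \<zeta>0: "\<zeta> \<noteq> 0" using \<zeta>n n by (auto simp: zero_power)
  have c0: "c \<noteq> 0" using c n by (auto simp: zero_power)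
  have "\<zeta> ^ i \<noteq> \<zeta> ^ j" if "i < j" "j < n" for i j
  proof
    assume eq: "\<zeta> ^ i = \<zeta> ^ j"
    have "\<zeta> ^ j = \<zeta> ^ i * \<zeta> ^ (j - i)" using that by (simp flip: power_add)
    then have "\<zeta> ^ (j - i) = 1" using eq \<zeta>0 by simp
    then show False using \<zeta>k[of "j - i"] that by simp
  qed
  then have inj: "inj_on (\<lambda>k. c * \<zeta> ^ k) {..<n}"
    using c0 by (auto simp: inj_on_def) (metis linorder_neqE_nat)
  have sub: "(\<lambda>k. c * \<zeta> ^ k) ` {..<n} \<subseteq> {\<omega>. \<omega> ^ n = b}"
    using c \<zeta>n by (auto simp: power_mult_distrib) (metis mult.commute power_mult power_one)
  have "card {\<omega>. \<omega> ^ n = b} = n" using card_nth_roots[OF c(2) n] .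
  moreover from this have "finite {\<omega>. \<omega> ^ n = b}" using n by (intro card_ge_0_finite) simp
  ultimately have "(\<lambda>k. c * \<zeta> ^ k) ` {..<n} = {\<omega>. \<omega> ^ n = b}"
    using sub inj by (intro card_subset_eq) (simp_all add: card_image)
  with inj show ?thesis unfolding bij_betw_def by blast
qed

lemma card_bij_betw_Collect:
  assumes "bij_betw g {..<n} {\<omega>. R \<omega>}"
  shows "card {k. k < n \<and> Q (g k)} = card {\<omega>. R \<omega> \<and> Q \<omega>}"
proof -
  have "R \<omega> \<longleftrightarrow> \<omega> \<in> g ` {..<n}" for \<omega>
    using assms unfolding bij_betw_def by blast
  then have "{\<omega>. R \<omega> \<and> Q \<omega>} = g ` {k. k < n \<and> Q (g k)}" by auto
  moreover have "inj_on g {k. k < n \<and> Q (g k)}"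
    using assms unfolding bij_betw_def inj_on_def by auto
  ultimately show ?thesis by (simp add: card_image)
qed

lemma less_3_cases: "i < 3 \<Longrightarrow> (i = 0 \<Longrightarrow> R) \<Longrightarrow> (i = 1 \<Longrightarrow> R) \<Longrightarrow> (i = 2 \<Longrightarrow> R) \<Longrightarrow> (R :: bool)"
  for i :: nat
  by linarith

locale fermat_roots = fermat +
  fixes \<zeta> \<epsilon> :: complex
  assumes \<zeta>: "primitive_root_of n 1 \<zeta>" and \<epsilon>: "primitive_root_of n (- 1) \<epsilon>"
begin

abbreviation root_a where "root_a k \<equiv> \<zeta> ^ k"
abbreviation root_c where "root_c k \<equiv> \<epsilon> * \<zeta> ^ k"

lemma bij_a: "bij_betw root_a {..<n} {\<omega>. \<omega> ^ n = 1}"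
  using primitive_root_enumeration[OF n_pos \<zeta>, of 1 1] by simp

lemma bij_c: "bij_betw root_c {..<n} {\<omega>. \<omega> ^ n = - 1}"
  using primitive_root_enumeration[OF n_pos \<zeta>, of \<epsilon> "- 1"] \<epsilon> unfolding primitive_root_of_def by simp

lemma root_aE: "\<omega> ^ n = 1 \<Longrightarrow> \<exists>k<n. \<omega> = root_a k"
  using bij_a unfolding bij_betw_def by (auto simp: set_eq_iff image_iff)

lemma root_cE: "\<omega> ^ n = - 1 \<Longrightarrow> \<exists>k<n. \<omega> = root_c k"
  using bij_c unfolding bij_betw_def by (auto simp: set_eq_iff image_iff)

lemma root_a: "k < n \<Longrightarrow> root_a k ^ n = 1"
  using bij_a unfolding bij_betw_def by blast

lemma root_c: "k < n \<Longrightarrow> root_c k ^ n = - 1"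
  using bij_c unfolding bij_betw_def by blast

definition orbit_point :: "nat \<Rightarrow> nat \<Rightarrow> point" where
  "orbit_point i k = special_point n \<zeta> \<epsilon> (i * n + k)"

lemma orbit_point:
  assumes "k < n"
  shows "orbit_point 0 k = (0, root_a k, 1)" "orbit_point 1 k = (root_a k, 0, 1)"
    "orbit_point (Suc 0) k = (root_a k, 0, 1)" "orbit_point 2 k = (root_c k, 1, 0)"
  using assms by (simp_all add: orbit_point_def special_point_def)

lemma orbit_point_on_curve:
  assumes "i < 3" "k < n"
  shows "orbit_point i k \<in> fermat_curve n"
  using assms root_a[OF assms(2)] root_c[OF assms(2)] n_pos
  by (elim less_3_cases) (simp_all add: orbit_point finite_on_curve infinite_on_curve zero_power)

lemma special_unit_generic:
  assumes z: "z \<in> special_units n y \<zeta> \<epsilon>" and on: "x0 ^ n + y0 ^ n = 1" "x0 \<noteq> 0" "y0 \<noteq> 0"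
  shows "val y (x0, y0, 1) z = 0"
proof (rule ccontr)
  assume "val y (x0, y0, 1) z \<noteq> 0"
  with z finite_on_curve[OF on(1)] obtain k where "proj_eq (x0, y0, 1) (special_point n \<zeta> \<epsilon> k)"
    unfolding special_units_def by blast
  then show False using on(2,3) unfolding proj_eq_def special_point_def by (auto split: if_splits)
qed

lemma degree_bounds_val:
  assumes z: "z \<in> F" "z \<noteq> 0"
    and generic: "\<And>x0 y0. x0 ^ n + y0 ^ n = 1 \<Longrightarrow> x0 \<noteq> 0 \<Longrightarrow> y0 \<noteq> 0 \<Longrightarrow> val y (x0, y0, 1) z = 0"
  shows "\<exists>m. degree_bounds n (\<lambda>i k. val y (orbit_point i k) z) m"
proof -
  let ?f = "\<lambda>i k. val y (orbit_point i k) z"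
  define m where "m i = Min (?f i ` {..<n})" for i
  have m_le: "m i \<le> ?f i k" if "k < n" for i k unfolding m_def using that by (intro Min_le) auto
  have m_att: "\<exists>k<n. ?f i k = m i" for i
  proof -
    have "m i \<in> ?f i ` {..<n}" unfolding m_def using n_pos by (intro Min_in) auto
    then show ?thesis by auto
  qed
  interpret cusp_unit n y z "m 0" "m 1" "m 2"
  proof unfold_locales
    fix \<omega> :: complex
    show "m 0 \<le> val y (0, \<omega>, 1) z" "m 1 \<le> val y (\<omega>, 0, 1) z" if "\<omega> ^ n = 1"
      using root_aE[OF that] m_le[of _ 0] m_le[of _ 1] by (auto simp: orbit_point)
    show "m 2 \<le> val y (\<omega>, 1, 0) z" if "\<omega> ^ n = - 1"
      using root_cE[OF that] m_le[of _ 2] by (auto simp: orbit_point)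
  next
    show "\<exists>\<omega>. \<omega> ^ n = 1 \<and> val y (0, \<omega>, 1) z = m 0" "\<exists>\<omega>. \<omega> ^ n = 1 \<and> val y (\<omega>, 0, 1) z = m 1"
      using m_att[of 0] m_att[of 1] root_a by (metis orbit_point(1), metis orbit_point(2))
    show "\<exists>\<omega>. \<omega> ^ n = - 1 \<and> val y (\<omega>, 1, 0) z = m 2"
      using m_att[of 2] root_c by (metis orbit_point(4))
  qed (use z generic in auto)
  have d: "- (\<Sum>i<3. m i) = d" unfolding d_def by (simp add: sum_lessThan_3)
  have "card {k. k < n \<and> m i < ?f i k} \<le> nat d" if "i < 3" for i
    using that
  proof (elim less_3_cases)
    assume "i = 0"
    then have "{k. k < n \<and> m i < ?f i k} = {k. k < n \<and> m 0 < val y (0, root_a k, 1) z}"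
      by (auto simp: orbit_point)
    then show ?thesis using card_a card_bij_betw_Collect[OF bij_a, of "\<lambda>\<omega>. m 0 < val y (0, \<omega>, 1) z"] by simp
  next
    assume "i = 1"
    then have "{k. k < n \<and> m i < ?f i k} = {k. k < n \<and> m 1 < val y (root_a k, 0, 1) z}"
      by (auto simp: orbit_point)
    then show ?thesis using card_b card_bij_betw_Collect[OF bij_a, of "\<lambda>\<omega>. m 1 < val y (\<omega>, 0, 1) z"] by simp
  next
    assume "i = 2"
    then have "{k. k < n \<and> m i < ?f i k} = {k. k < n \<and> m 2 < val y (root_c k, 1, 0) z}"
      by (auto simp: orbit_point)
    then show ?thesis using card_c card_bij_betw_Collect[OF bij_c, of "\<lambda>\<omega>. m 2 < val y (\<omega>, 1, 0) z"] by simp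
  qed
  moreover have "?f i k \<le> m i + 1 \<or> m i + int n \<le> ?f i k" if "d = 1" "i < 3" "k < n" for i k
    using that(2) gap_a[OF that(1) root_a[OF that(3)]] gap_b[OF that(1) root_a[OF that(3)]]
      gap_c[OF that(1) root_c[OF that(3)]]
    by (elim less_3_cases) (simp_all add: orbit_point[OF that(3)])
  ultimately have "degree_bounds n ?f m"
    unfolding degree_bounds_def d Let_def using m_le m_att d_nonneg by (auto simp: le_nat_iff)
  then show ?thesis by (intro exI[of _ m])
qed

text \<open>The vector of \<open>fx powi p * y powi q\<close>; the entry \<open>- p - q\<close>
  comes from the common poles of \<open>x\<close> and \<open>y\<close> at infinity. These vectors
  form a scaled hexagonal lattice, which has kissing number 6.\<close>

definition hex :: "int \<Rightarrow> int \<Rightarrow> nat \<Rightarrow> real" where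
  "hex p q k = of_int (if k < n then p else if k < 2 * n then q else if k < 3 * n then - p - q else 0)"

lemma val_monomial:
  assumes "Q \<in> fermat_curve n"
  shows "val y Q (fx powi p * y powi q) = p * val y Q fx + q * val y Q y"
  using assms by (simp add: val_mult val_power_int F_power_int F_fx F_y fx_nonzero y_nonzero)

lemma sum_3n: "(\<Sum>k<3 * n. g k) = (\<Sum>i<3. \<Sum>k<n. g (i * n + k))" for g :: "nat \<Rightarrow> 'b::comm_monoid_add"
proof -
  have "(\<Sum>k\<in>{i * n..<i * n + n}. g k) = (\<Sum>k<n. g (i * n + k))" for i
    using sum.shift_bounds_nat_ivl[of g 0 "i * n" n]
    by (simp add: atLeast0LessThan add.commute)
  then show ?thesis using sum.nat_group[of g n 3] by simp
qed

lemma index_cases: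
  assumes "k < 3 * n"
  obtains i j where "i < 3" "j < n" "k = i * n + j"
proof
  show "k div n < 3" using assms by (simp add: less_mult_imp_div_less)
  show "k mod n < n" using n_pos by simp
  show "k = k div n * n + k mod n" by simp
qed

lemma hex_in_lattice: "hex p q \<in> fermat_lattice n y \<zeta> \<epsilon>"
proof -
  let ?z = "fx powi p * y powi q"
  have v: "val y (x0, y0, 1) ?z = (if x0 = 0 then p else 0)" if "x0 ^ n + y0 ^ n = 1" "y0 \<noteq> 0" for x0 y0
    using val_finite_coords[OF that] val_monomial[OF finite_on_curve[OF that(1)]] by simp
  have z: "?z \<in> special_units n y \<zeta> \<epsilon>"
    unfolding special_units_def
  proof (intro CollectI conjI ballI impI)
    show "?z \<in> F" by (intro F_mult F_power_int F_fx F_y)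
    show "?z \<noteq> 0" by (simp add: fx_nonzero y_nonzero)
    fix Q assume Q: "Q \<in> fermat_curve n" and nz: "val y Q ?z \<noteq> 0"
    show "\<exists>k<3 * n. proj_eq Q (special_point n \<zeta> \<epsilon> k)"
      using Q
    proof (cases rule: curve_cases)
      case (finite x0 y0)
      then have "x0 = 0" using nz v[of x0 y0] val_proj_eq[OF finite(3)] by (auto split: if_splits)
      then have "y0 ^ n = 1" using finite n_pos by (simp add: zero_power)
      then obtain k where "k < n" "y0 = root_a k" using root_aE by blast
      then show ?thesis using finite \<open>x0 = 0\<close>
        by (intro exI[of _ k]) (simp add: special_point_def)
    next
      case (b x0)
      then obtain k where "k < n" "x0 = root_a k" using root_aE by blast
      then show ?thesis using b by (intro exI[of _ "n + k"]) (simp add: special_point_def)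
    next
      case (c x0)
      then obtain k where "k < n" "x0 = root_c k" using root_cE by blast
      then show ?thesis using c by (intro exI[of _ "2 * n + k"]) (simp add: special_point_def)
    qed
  qed
  have "hex p q = (\<lambda>k. if k < 3 * n then of_int (val y (special_point n \<zeta> \<epsilon> k) ?z) else 0)"
  proof
    fix k
    show "hex p q k = (if k < 3 * n then of_int (val y (special_point n \<zeta> \<epsilon> k) ?z) else 0)"
    proof (cases "k < 3 * n")
      case True
      then obtain i j where ij: "i < 3" "j < n" "k = i * n + j" using index_cases by blast
      have "val y (orbit_point i j) ?z = (if i = 0 then p else if i = 1 then q else - p - q)"
      proof -
        have ra: "root_a j \<noteq> 0" using root_a[OF ij(2)] n_pos by (metis power_0_left less_irrefl zero_neq_one)
        show ?thesis
          using ij(1) root_a[OF ij(2)] v[of 0 "root_a j"] ra val_b_coords[OF root_a[OF ij(2)]]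
            val_c_coords[OF root_c[OF ij(2)]] val_monomial[OF orbit_point_on_curve[OF ij(1,2)]] n_pos
          by (elim less_3_cases) (simp_all add: orbit_point[OF ij(2)] zero_power)
      qed
      then show ?thesis using ij True n_pos unfolding hex_def orbit_point_def
        by (elim less_3_cases) simp_all
    next
      case False
      then show ?thesis by (simp add: hex_def)
    qed
  qed
  then show ?thesis unfolding fermat_lattice_def using z by blast
qed

lemma hex_norm: "(\<Sum>k<3 * n. hex p q k ^ 2) = 2 * n * of_int (p ^ 2 + p * q + q ^ 2)"
  unfolding sum_3n sum_lessThan_3 hex_def by (simp add: power2_eq_square algebra_simps)

lemma short_vector_hex:
  assumes n5: "n \<ge> 5" and v: "v \<in> fermat_lattice n y \<zeta> \<epsilon>" and short: "(\<Sum>k<3 * n. v k ^ 2) \<le> 2 * n"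
  shows "\<exists>p q. v = hex p q"
proof -
  obtain z where z: "z \<in> special_units n y \<zeta> \<epsilon>"
    and v: "v = (\<lambda>k. if k < 3 * n then of_int (val y (special_point n \<zeta> \<epsilon> k) z) else 0)"
    using v unfolding fermat_lattice_def by blast
  let ?f = "\<lambda>i k. val y (orbit_point i k) z"
  have zF: "z \<in> F" "z \<noteq> 0" using z unfolding special_units_def by auto
  have iz: "inverse z = z powi - 1" by simp
  have val_inv: "val y Q (inverse z) = - val y Q z" if "Q \<in> fermat_curve n" for Q
    unfolding iz using val_power_int[OF that zF, of "- 1"] by simp
  obtain m where m: "degree_bounds n ?f m"
    using degree_bounds_val[OF zF special_unit_generic[OF z]] by blast
  have "\<exists>m. degree_bounds n (\<lambda>i k. val y (orbit_point i k) (inverse z)) m"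
    by (rule degree_bounds_val)
      (use zF F_inverse special_unit_generic[OF z] val_inv finite_on_curve in auto)
  then obtain M where M: "degree_bounds n (\<lambda>i k. val y (orbit_point i k) (inverse z)) M" by blast
  have val_inv': "val y (orbit_point i k) (inverse z) = - ?f i k" if "i < 3" "k < n" for i k
    by (rule val_inv[OF orbit_point_on_curve[OF that]])
  \<comment> \<open>The maximum on an orbit is minus the minimum for the inverse function; the
    double negation gives the shape that \<open>short_imp_constant\<close> expects, with
    \<open>- M i\<close> as the maximum.\<close>
  have M: "degree_bounds n (\<lambda>i k. - ?f i k) (\<lambda>i. - (- M i))"
    using M val_inv' unfolding degree_bounds_def by (simp cong: conj_cong)
  have vf: "v (i * n + k) = of_int (?f i k)" if "i < 3" "k < n" for i k
    using that unfolding v orbit_point_def by (elim less_3_cases) simp_all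
  have "(\<Sum>k<3 * n. v k ^ 2) = of_int (\<Sum>i<3. \<Sum>k<n. ?f i k ^ 2)"
    unfolding sum_3n by (simp add: vf cong: sum.cong_simp)
  with short have "(\<Sum>i<3. \<Sum>k<n. ?f i k ^ 2) \<le> 2 * int n" by linarith
  note const = short_imp_constant[OF n5 m M this]
  have f: "?f i k = m i" if "i < 3" "k < n" for i k
  proof -
    have "m i \<le> ?f i k" using m that unfolding degree_bounds_def by blast
    moreover have "- (- M i) \<le> - ?f i k" using M that unfolding degree_bounds_def by blast
    ultimately show ?thesis using const[OF that(1)] by simp
  qed
  \<comment> \<open>This replaces the theorem that a principal divisor has degree 0: minima and
    maxima coincide, so both degrees being nonnegative forces
    \<open>m 0 + m 1 + m 2 = 0\<close>.\<close>
  have "- (\<Sum>i<3. m i) \<ge> 0" using m unfolding degree_bounds_def Let_def by blast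
  moreover have "- (\<Sum>i<3. - (- M i)) \<ge> 0" using M unfolding degree_bounds_def Let_def by blast
  ultimately have "m 2 = - m 0 - m 1"
    using const[of 0] const[of 1] const[of 2] by (simp add: sum_lessThan_3)
  have "v k = hex (m 0) (m 1) k" for k
  proof (cases "k < 3 * n")
    case True
    then obtain i j where ij: "i < 3" "j < n" "k = i * n + j" using index_cases by blast
    then show ?thesis using vf[OF ij(1,2)] f[OF ij(1,2)] \<open>m 2 = _\<close>
      by (elim less_3_cases) (simp_all add: hex_def)
  next
    case False
    then show ?thesis by (simp add: v hex_def)
  qed
  then show ?thesis by blast
qed

end

section \<open>The vectors of minimal norm\<close>

lemma hexagonal_form_le_1:
  fixes p q :: int
  assumes "p ^ 2 + p * q + q ^ 2 \<le> 1"
  shows "(p, q) \<in> {(0, 0), (1, 0), (- 1, 0), (0, 1), (0, - 1), (1, - 1), (- 1, 1)}"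
proof -
  have bound: "3 * b ^ 2 \<le> 4" if "a ^ 2 + a * b + b ^ 2 \<le> 1" for a b :: int
  proof -
    \<comment> \<open>Completing the square; for an integer \<open>b\<close> the bound means that
      its absolute value is at most 1.\<close>
    have "3 * b ^ 2 \<le> (2 * a + b) ^ 2 + 3 * b ^ 2" by simp
    also have "\<dots> = 4 * (a ^ 2 + a * b + b ^ 2)" by (simp add: power2_eq_square algebra_simps)
    also have "\<dots> \<le> 4 * 1" using that by (rule mult_left_mono) simp
    finally show ?thesis by simp
  qed
  have "3 * q ^ 2 \<le> 4" by (rule bound[OF assms])
  moreover have "3 * p ^ 2 \<le> 4" by (rule bound[of q p]) (use assms in \<open>simp add: algebra_simps\<close>)
  ultimately have "\<bar>q\<bar> \<le> 1" "\<bar>p\<bar> \<le> 1" using abs_le_square_iff[of q 1] abs_le_square_iff[of p 1] by auto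
  then have "p \<in> {- 1, 0, 1}" "q \<in> {- 1, 0, 1}" by auto
  then show ?thesis using assms by auto
qed

theorem theorem3p7:
  fixes n :: nat and y :: acfield and \<zeta> \<epsilon> :: complex
  assumes "n \<ge> 5"
    and "fx ^ n + y ^ n = 1"
    and "primitive_root_of n 1 \<zeta>"
    and "primitive_root_of n (-1) \<epsilon>"
  shows "kissing_number (3 * n) (fermat_lattice n y \<zeta> \<epsilon>) = 6"
proof -
  interpret fermat_roots n y \<zeta> \<epsilon>
    by unfold_locales (use assms in auto)
  let ?L = "fermat_lattice n y \<zeta> \<epsilon>"
  let ?H = "{(1, 0), (- 1, 0), (0, 1), (0, - 1), (1, - 1), (- 1, 1)} :: (int \<times> int) set"
  have L2: "L2_set v {..<3 * n} \<le> sqrt (2 * n) \<longleftrightarrow> (\<Sum>k<3 * n. v k ^ 2) \<le> 2 * n" for v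
    unfolding L2_set_def by simp
  have hex_L2: "L2_set (hex p q) {..<3 * n} = sqrt (2 * n * of_int (p ^ 2 + p * q + q ^ 2))" for p q
    unfolding L2_set_def hex_norm ..
  have hex_0: "hex 0 0 = (\<lambda>_. 0)" by (simp add: hex_def fun_eq_iff)
  have hex_eval: "hex p q 0 = of_int p" "hex p q n = of_int q" for p q
    using n_pos by (simp_all add: hex_def)
  have hex_inj: "hex p q = hex p' q' \<longleftrightarrow> p = p' \<and> q = q'" for p q p' q'
    using hex_eval by (metis of_int_eq_iff)
  have hexagon: "p ^ 2 + p * q + q ^ 2 = 1" if "(p, q) \<in> ?H" for p q
    using that by auto
  \<comment> \<open>Stated with \<open>\<le>\<close> in place of equality, so that it yields both
    the lower bound for the minimum distance and the list of the vectors attaining it.\<close>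
  have short: "v = (\<lambda>_. 0) \<or> v \<in> case_prod hex ` ?H"
    if v: "v \<in> ?L" and le: "L2_set v {..<3 * n} \<le> sqrt (2 * n)" for v
  proof -
    obtain p q where pq: "v = hex p q"
      using short_vector_hex[OF assms(1) v] le L2 by blast
    have "2 * real n * of_int (p ^ 2 + p * q + q ^ 2) \<le> 2 * real n * 1"
      using le unfolding L2 pq hex_norm by simp
    then have "real_of_int (p ^ 2 + p * q + q ^ 2) \<le> 1"
      using n_pos by (subst (asm) mult_le_cancel_left_pos) auto
    then have "p ^ 2 + p * q + q ^ 2 \<le> 1" by linarith
    then have "(p, q) \<in> insert (0, 0) ?H" by (rule hexagonal_form_le_1)
    then show ?thesis unfolding pq using hex_0 by (metis case_prod_conv imageI insert_iff prod.inject)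
  qed
  have hex_norm_1: "L2_set v {..<3 * n} = sqrt (2 * n)" "v \<in> ?L" "v \<noteq> (\<lambda>_. 0)"
    if vH: "v \<in> case_prod hex ` ?H" for v
  proof -
    obtain u where u: "v = case_prod hex u" "u \<in> ?H" using vH by (rule imageE)
    obtain p q where "u = (p, q)" by (cases u)
    with u have pq: "(p, q) \<in> ?H" "v = hex p q" by simp_all
    show "L2_set v {..<3 * n} = sqrt (2 * n)" unfolding pq(2) hex_L2 hexagon[OF pq(1)] by simp
    show "v \<in> ?L" unfolding pq(2) by (rule hex_in_lattice)
    show "v \<noteq> (\<lambda>_. 0)" unfolding pq(2) hex_0[symmetric] hex_inj using pq(1) by auto
  qed
  have min: "min_dist (3 * n) ?L = sqrt (2 * n)"
    unfolding min_dist_def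
  proof (rule Least_equality)
    have "hex 1 0 \<in> case_prod hex ` ?H" by force
    then show "\<exists>v\<in>?L - {\<lambda>_. 0}. sqrt (2 * n) = L2_set v {..<3 * n}"
      using hex_norm_1 by (intro bexI[of _ "hex 1 0"]) auto
    fix r assume "\<exists>v\<in>?L - {\<lambda>_. 0}. r = L2_set v {..<3 * n}"
    then obtain v where v: "v \<in> ?L" "v \<noteq> (\<lambda>_. 0)" "r = L2_set v {..<3 * n}" by blast
    show "sqrt (2 * n) \<le> r"
    proof (rule ccontr)
      assume "\<not> sqrt (2 * n) \<le> r"
      then have "L2_set v {..<3 * n} < sqrt (2 * n)" using v by simp
      then show False using short[OF v(1)] v(2) hex_norm_1(1)[of v] by auto
    qed
  qed
  have "{v \<in> ?L. L2_set v {..<3 * n} = min_dist (3 * n) ?L} = case_prod hex ` ?H"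
  proof (intro equalityI subsetI)
    fix v assume "v \<in> {v \<in> ?L. L2_set v {..<3 * n} = min_dist (3 * n) ?L}"
    then have v: "v \<in> ?L" "L2_set v {..<3 * n} = sqrt (2 * n)" using min by auto
    have "v \<noteq> (\<lambda>_. 0)"
    proof
      assume "v = (\<lambda>_. 0)"
      then show False using v(2) n_pos by (simp add: L2_set_def)
    qed
    then show "v \<in> case_prod hex ` ?H" using short[OF v(1)] v(2) by auto
  next
    fix v assume "v \<in> case_prod hex ` ?H"
    then show "v \<in> {v \<in> ?L. L2_set v {..<3 * n} = min_dist (3 * n) ?L}"
      using hex_norm_1[of v] min by simp
  qed
  moreover have "card (case_prod hex ` ?H) = card ?H"
    by (rule card_image) (auto simp: inj_on_def hex_inj)
  ultimately show ?thesis unfolding kissing_number_def by simp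
qed

end
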